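(* Let $N\ge1$. Let $a:\mathbb{R}^N\times\mathbb{R}^N\to\mathbb{R}$ be uniformly continuous, $H\in C(\mathbb{R}^N\times\mathbb{R}^N\times\mathbb{R}^N)$, and $K^1:\mathbb{R}^N\to\mathbb{R}$ nonnegative and measurable. Assume: (1) there is $a_0>0$ with $a_0\le a(x,y)\le a_0^{-1}$ for all $x,y$; the function $\bar k(z):=K^1(z)|z|^{N+1}$ is bounded on $\mathbb{R}^N$, continuous at the origin, and $\bar k(0)=C_{N,1}>0$; (2) $|H(\cdot,\cdot,0)|_\infty<+\infty$, $|a|_\infty<+\infty$, and $a(x,\cdot)$, $H(x,\cdot,p)$ are $\mathbb{Z}^N$-periodic for all $x,p\in\mathbb{R}^N$; (3) there exist $b_0,C_0>0$, $m>1$ such that $\mu H(x,y,\mu^{-1}p)-H(x,y,p)\ge(1-\mu)(b_0|p|^m-C_0)$ for all $\mu\in(0,1)$ and all $x,y,p\in\mathbb{R}^N$; (4) there is $L>0$ such that for all $R>0$, all $X=(x,y),X'=(x',y')\in\mathbb{R}^{2N}$ and all $p,p'\in\mathbb{R}^N$ with $|p|,|p'|\le R$, $$|H(X,p)-H(X',p')|\le L(1+R^m)|X-X'|+L(1+R^{m-1})|p-p'|,\qquad|a(X)-a(X')|\le L|X-X'|;$$ (5) if $K^1$ is not symmetric, then $\int_0^1\bar\omega(r)r^{-1}dr<+\infty$, where $\bar\omega(t)=\sup_{|z|\le t}|\bar k(z)-\bar k(0)|$. Let $b:=\lim_{\rho\to0}\int_{B\setminus B_\rho}\frac{\bar k(z)-\bar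 k(0)}{|z|^{N+1}}z\,dz\in\mathbb{R}^N$ (so $b=0$ if $K^1$ is symmetric). Then for each $x,p\in\mathbb{R}^N$, $l\in\mathbb{R}$ there exists a unique constant $c=\bar H(x,p,l)$ such that the cell problem $$-a(x,y)l+a(x,y)(-\Delta)^{1/2}\psi(y)+a(x,y)\langle b,D\psi(y)\rangle+H(x,y,p+D\psi(y))=c,\qquad y\in\mathbb{T}^N,$$ has a classical solution $\psi\in C^{1,\alpha}$ for some $\alpha\in(0,1)$, and such solution is unique up to an additive constant. Moreover, $$|(-\Delta)^{1/2}\psi|_{L^\infty(\mathbb{T}^N)}\le C(1+|l|+|p|^m)^m,$$ where $C>0$ does not depend on $x$, $l$ nor $p$.
   Context: $\mathbb{T}^N=\mathbb{R}^N/\mathbb{Z}^N$; functions on $\mathbb{T}^N$ are identified with $\mathbb{Z}^N$-periodic functions on $\mathbb{R}^N$. $B_\rho$ is the ball of radius $\rho$ centered at $0$, $B=B_1$. $K^1$ symmetric means $K^1(z)=K^1(-z)$. The fractional Laplacian is $(-\Delta)^{1/2}u(x)=-C_{N,1}\int_{\mathbb{R}^N}[u(x+z)-u(x)-\mathbf 1_B(z)\langle Du(x),z\rangle]|z|^{-(N+1)}dz$, where $C_{N,1}>0$ is the standard normalizing constant (making $(-\Delta)^{1/2}$ the operator with Fourier symbol $|\xi|$). *)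

theory Defs
  imports "HOL-Analysis.Analysis" "HOL-Probability.Essential_Supremum"
begin

text \<open>Functions on the torus are \<open>\<int>\<^sup>N\<close>-periodic functions on \<open>\<real>\<^sup>N = real ^ 'n\<close>, with \<open>N = CARD('n)\<close>.
  Integrals are taken over the completed measure \<^term>\<open>lebesgue\<close>, because the kernel is only assumed
  Lebesgue measurable.\<close>

definition zn_periodic :: "(real ^ 'n \<Rightarrow> real) \<Rightarrow> bool" where
  "zn_periodic f \<longleftrightarrow> (\<forall>y k. (\<forall>i. k $ i \<in> \<int>) \<longrightarrow> f (y + k) = f y)"

definition grad :: "(real ^ 'n \<Rightarrow> real) \<Rightarrow> real ^ 'n \<Rightarrow> real ^ 'n" where
  "grad u x = (THE D. GDERIV u x :> D)"

text \<open>For periodic functions, global differentiability with a globally Hoelder continuous gradient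
  is membership in \<open>C\<^bsup>1,\<alpha>\<^esup>\<close> of the torus; bounds on the function and its gradient are automatic.\<close>

definition C1_holder_torus :: "real \<Rightarrow> (real ^ 'n \<Rightarrow> real) \<Rightarrow> bool" where
  "C1_holder_torus \<alpha> u \<longleftrightarrow> zn_periodic u \<and> (\<forall>x. u differentiable (at x)) \<and>
     (\<exists>M. \<forall>x y. norm (grad u x - grad u y) \<le> M * norm (x - y) powr \<alpha>)"

text \<open>The constant \<open>C\<^bsub>N,1\<^esub>\<close>. By rotation invariance it does not depend on the coordinate chosen,
  and the substitution \<open>z \<mapsto> z / \<bar>\<xi>\<bar>\<close> then gives
  \<open>C\<^bsub>N,1\<^esub> \<integral> (1 - cos (\<xi> \<bullet> z)) / \<bar>z\<bar>\<^bsup>N+1\<^esup> dz = \<bar>\<xi>\<bar>\<close>, that is, the Fourier symbol of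
  the operator \<open>half_laplacian\<close> below is \<open>\<bar>\<xi>\<bar>\<close>.\<close>

definition half_laplacian_const :: "'n::finite itself \<Rightarrow> real" where
  "half_laplacian_const _ =
     1 / (LINT z|lebesgue. (1 - cos ((z :: real ^ 'n) $ (SOME i. True))) / norm z ^ (CARD('n) + 1))"

definition half_laplacian :: "(real ^ 'n \<Rightarrow> real) \<Rightarrow> real ^ 'n \<Rightarrow> real" where
  "half_laplacian u x = - half_laplacian_const TYPE('n) *
     (LINT z|lebesgue. (u (x + z) - u x - indicat_real (ball 0 1) z * (grad u x \<bullet> z))
        / norm z ^ (CARD('n) + 1))"

definition kernel_modulus :: "(real ^ 'n \<Rightarrow> real) \<Rightarrow> real \<Rightarrow> real" where
  "kernel_modulus k t = (SUP z\<in>cball 0 t. \<bar>k z - k 0\<bar>)"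

definition truncated_drift :: "(real ^ 'n \<Rightarrow> real) \<Rightarrow> real \<Rightarrow> real ^ 'n" where
  "truncated_drift k \<rho> =
     (LINT z : ball 0 1 - ball 0 \<rho> | lebesgue. ((k z - k 0) / norm z ^ (CARD('n) + 1)) *\<^sub>R z)"

definition cell_solution ::
  "(real ^ 'n \<Rightarrow> real ^ 'n \<Rightarrow> real) \<Rightarrow> (real ^ 'n \<Rightarrow> real ^ 'n \<Rightarrow> real ^ 'n \<Rightarrow> real) \<Rightarrow> real ^ 'n \<Rightarrow>
   real ^ 'n \<Rightarrow> real ^ 'n \<Rightarrow> real \<Rightarrow> real \<Rightarrow> (real ^ 'n \<Rightarrow> real) \<Rightarrow> bool" where
  "cell_solution a H b x p l c \<psi> \<longleftrightarrow>
     (\<exists>\<alpha>. 0 < \<alpha> \<and> \<alpha> < 1 \<and> C1_holder_torus \<alpha> \<psi>) \<and>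
     (\<forall>y. - a x y * l + a x y * half_laplacian \<psi> y + a x y * (b \<bullet> grad \<psi> y)
            + H x y (p + grad \<psi> y) = c)"

end

theory Submission
  imports Defs "HOL-Complex_Analysis.Great_Picard"
begin

text \<open>Dividing the cell problem by \<open>a(x,\<cdot>)\<close> turns it into \<open>\<Lambda>u + G(y,Du) = c/a\<close>, with \<open>\<Lambda>\<close> the half Laplacian
and the drift absorbed in \<open>G\<close>.

Existence: for \<open>G\<close> Lipschitz in the gradient, solve a monotone finite-difference scheme with truncated
jump kernel and artificial viscosity by contraction. Differences \<open>u(\<cdot>+k) - u\<close> satisfy a linear
inequality with bounded drift. At a maximum of \<open>w(x) - w(y) - M q(x-y)\<close> with
\<open>q(\<xi>) = (|\<xi>|\<^sup>2 + h\<^sup>2) powr (\<alpha>/2)\<close>, the jumps in half of a shell around the midpoint yield a gain of fixed size,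
while drift and kernel acting on the test function cost only \<open>O(\<alpha>)\<close>. For small \<open>\<alpha>\<close> this bounds the
second differences uniformly by \<open>C |k| q(j)\<close>, and the limit is \<open>C\<^bsup>1,\<alpha>\<^esup>\<close>.

Gradient bound: at a maximum of \<open>ln u(x) - ln u(y) - L |x-y|\<close>, with \<open>u\<close> shifted to be positive, the
quotient \<open>u(y)/u(x)\<close> plays the role of the parameter \<open>\<mu>\<close> of the coercivity hypothesis. As the resulting
bound does not see the size of \<open>G\<close> at infinity, \<open>G\<close> may be truncated there.

Uniqueness: the kernel is positive everywhere, so at a maximum of the difference of two solutions the
difference has to be constant.\<close>

text \<open>The half Laplacian and the drift both have order one, so small scales do not make the
  drift negligible: at distance s the shell gain, the kernel acting on q and the drift acting on q
  are all multiples of q(\<xi>)/s. What separates them is the exponent: the two costs carry a factor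
  \<alpha>, the gain, a jump of half the height, does not. The term h^2 in q makes s at least h, so
  that mesh steps are no longer than s and the shell stays outside the hole |z| \<le> h of the
  truncated kernel. A discrete problem is used because its solutions are continuous and satisfy the
  equation at every point, so maxima can be evaluated directly. The data p and l enter through one
  size \<rho> = 1 + |p| + |l|^(1/m), against which gradients scale linearly and the equation like
  \<rho>^m. The logarithmic doubling bounds the gradient only in terms of the oscillation of u; a
  second doubling with a fixed concave profile, combined with superlinear growth of the first-order
  part, bounds the oscillation by a multiple of \<rho>.\<close>

section \<open>Integrability and scaling of the jump kernel\<close>

text \<open>The image of Lebesgue measure under the norm and the measure with the radial density
  agree on the rays \<open>{..<a}\<close>, because the volume of a ball is an antiderivative of that
  density in its radius. The rays form an intersection-stable generator.\<close>

lemma nn_integral_norm_polar: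
  fixes f :: "real \<Rightarrow> ennreal"
  assumes [measurable]: "f \<in> borel_measurable borel"
  defines "d \<equiv> DIM('a::euclidean_space)"
  shows "(\<integral>\<^sup>+ z. f (norm (z::'a)) \<partial>lborel) =
    (\<integral>\<^sup>+ r. ennreal (unit_ball_vol d * real d * r ^ (d - 1)) * indicator {0..} r * f r \<partial>lborel)"
proof -
  let ?g = "\<lambda>r::real. ennreal (unit_ball_vol d * real d * r ^ (d - 1)) * indicator {0..} r"
  let ?M = "distr (lborel :: 'a measure) borel norm"
  let ?N = "density lborel ?g"
  have d: "d > 0" by (simp add: d_def)
  have eq: "emeasure ?M {..<a} = emeasure ?N {..<a}" for a :: real
  proof (cases "a > 0")
    case False
    have "{..<a} \<inter> {0::real..} = {}" using False by auto
    have "?g r * indicator {..<a} r = 0" for r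
      using False by (auto simp: indicator_def)
    then have "emeasure ?N {..<a} = 0" by (subst emeasure_density) (simp_all del: mult_eq_0_iff)
    moreover have "norm -` {..<a} = ({}::'a set)"
      using False by (auto simp: not_less) (smt (verit) norm_ge_zero)
    ultimately show ?thesis by (simp add: emeasure_distr)
  next
    case True
    have "norm -` {..<a} \<inter> space lborel = (ball 0 a :: 'a set)" by auto
    then have 1: "emeasure ?M {..<a} = ennreal (unit_ball_vol d * a ^ d)"
      using True by (simp add: emeasure_distr emeasure_ball d_def)
    have "emeasure ?N {..<a} = (\<integral>\<^sup>+ r. ?g r * indicator {..<a} r \<partial>lborel)"
      by (subst emeasure_density) auto
    also have "\<dots> = (\<integral>\<^sup>+ r. ennreal (unit_ball_vol d * real d * r ^ (d - 1)) * indicator {0..a} r \<partial>lborel)"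
    proof (rule nn_integral_cong_AE)
      have "AE r in lborel. r \<noteq> a" by (rule AE_lborel_singleton)
      then show "AE r in lborel. ?g r * indicator {..<a} r
          = ennreal (unit_ball_vol d * real d * r ^ (d - 1)) * indicator {0..a} r"
        by eventually_elim (auto simp: indicator_def)
    qed
    also have "\<dots> = ennreal (unit_ball_vol d * a ^ d - unit_ball_vol d * 0 ^ d)"
      using True d
      by (intro nn_integral_FTC_Icc[where F = "\<lambda>r. unit_ball_vol d * r ^ d"])
         (auto intro!: derivative_eq_intros)
    finally show ?thesis using 1 by (simp add: zero_power[OF d])
  qed
  have sets: "sets (borel :: real measure) = sigma_sets UNIV (range lessThan)"
    by (subst borel_Iio) (simp add: sets_measure_of)
  have "?M = ?N"
  proof (rule measure_eqI_generator_eq[where E = "range lessThan" and \<Omega> = UNIV and A = "\<lambda>i. {..<real i}"])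
    show "Int_stable (range (lessThan :: real \<Rightarrow> _))"
    proof -
      have "{..<a} \<inter> {..<b} = {..<min a b}" for a b :: real by auto
      then show ?thesis by (auto simp: Int_stable_def)
    qed
    show "\<And>X. X \<in> range lessThan \<Longrightarrow> emeasure ?M X = emeasure ?N X" using eq by auto
    show "(\<Union>i. {..<real i}) = (UNIV :: real set)"
      using reals_Archimedean2 by auto
    show "emeasure ?M {..<real i} \<noteq> \<infinity>" for i
    proof -
      have "norm -` {..<real i} \<inter> space lborel = (ball 0 (real i) :: 'a set)" by auto
      then show ?thesis by (simp add: emeasure_distr emeasure_ball)
    qed
  qed (use sets in auto)
  have "(\<integral>\<^sup>+ z. f (norm (z::'a)) \<partial>lborel) = (\<integral>\<^sup>+ r. f r \<partial>?M)"
    by (simp add: nn_integral_distr)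
  also have "\<dots> = (\<integral>\<^sup>+ r. f r \<partial>?N)" by (simp only: \<open>?M = ?N\<close>)
  also have "\<dots> = (\<integral>\<^sup>+ r. ?g r * f r \<partial>lborel)" by (simp add: nn_integral_density)
  finally show ?thesis .
qed

text \<open>The normalizing constant is left out and reappears later as the factor \<kappa>.
  Division by zero gives the value 0 at the origin, so products with the kernel vanish there without
  a side condition.\<close>

definition jump_kernel :: "real ^ 'n \<Rightarrow> real" where
  "jump_kernel z = 1 / norm z ^ (CARD('n) + 1)"

text \<open>A common majorant for second differences; the two branches meet at |z| = 1. The square
  root at infinity, rather than a constant, leaves room for test functions that grow like
  |z|^\<alpha> with \<alpha> \<le> 1/2.\<close>

definition jump_weight :: "real \<Rightarrow> real ^ 'n \<Rightarrow> real" where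
  "jump_weight \<beta> z = min (norm z powr (1 + \<beta>)) (sqrt (norm z))"

lemma jump_kernel_nonneg [simp]: "0 \<le> jump_kernel z"
  by (simp add: jump_kernel_def)

lemma jump_kernel_uminus [simp]: "jump_kernel (- z) = jump_kernel z"
  by (simp add: jump_kernel_def)

lemma jump_kernel_zero [simp]: "jump_kernel 0 = 0"
  by (simp add: jump_kernel_def)

lemma jump_kernel_measurable [measurable]: "jump_kernel \<in> borel_measurable borel"
  unfolding jump_kernel_def by measurable

lemma jump_weight_nonneg [simp]: "0 \<le> jump_weight \<beta> z"
  by (simp add: jump_weight_def)

lemma jump_weight_measurable [measurable]: "jump_weight \<beta> \<in> borel_measurable borel"
  unfolding jump_weight_def by measurable

text \<open>The Jacobian r^(N-1) against the kernel r^(-N-1) leaves 1/r^2, hence r^(\<beta>-1) near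
  0 and r^(-3/2) at infinity.\<close>

lemma nn_integral_finite_radial:
  assumes "\<beta> > 0"
  shows "(\<integral>\<^sup>+ r. ennreal (min (r powr (1 + \<beta>)) (sqrt r) / r\<^sup>2) * indicator {0..} r \<partial>lborel) < \<infinity>"
proof -
  have 0: "(\<integral>\<^sup>+ r. ennreal (r powr (\<beta> - 1) * indicator {0..1} r) \<partial>lborel) < \<infinity>"
  proof -
    have "((\<lambda>x. x powr (\<beta> - 1)) has_integral (1 powr (\<beta> - 1 + 1) / (\<beta> - 1 + 1))) {0..1}"
      by (rule has_integral_powr_from_0) (use assms in auto)
    then have "((\<lambda>x. x powr (\<beta> - 1) * indicator {0..1} x) has_integral 1 / \<beta>) UNIV"
      by (subst (asm) has_integral_restrict_UNIV[symmetric])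
         (simp add: indicator_def of_bool_def if_distrib cong: if_cong)
    then show ?thesis
      by (subst nn_integral_has_integral_lborel) auto
  qed
  have 1: "(\<integral>\<^sup>+ r. ennreal (r powr (- 3/2) * indicator {1..} r) \<partial>lborel) < \<infinity>"
  proof -
    have "((\<lambda>x. x powr (- 3/2)) has_integral -(1 powr (- 3/2 + 1)) / (- 3/2 + 1 :: real)) {1..}"
      by (rule has_integral_powr_to_inf) auto
    then have "((\<lambda>x. x powr (- 3/2) * indicator {1..} x) has_integral -(1 powr (- 3/2 + 1)) / (- 3/2 + 1 :: real)) UNIV"
      by (subst (asm) has_integral_restrict_UNIV[symmetric])
         (simp add: indicator_def of_bool_def if_distrib cong: if_cong)
    then show ?thesis
      by (subst nn_integral_has_integral_lborel) auto
  qed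
  have le: "ennreal (min (r powr (1 + \<beta>)) (sqrt r) / r\<^sup>2) * indicator {0..} r
     \<le> ennreal (r powr (\<beta> - 1) * indicator {0..1} r) + ennreal (r powr (- 3/2) * indicator {1..} r)" for r :: real
  proof (cases "r > 0")
    case True
    have a: "r powr (1 + \<beta>) / r\<^sup>2 = r powr (\<beta> - 1)" "sqrt r / r\<^sup>2 = r powr (- 3/2)"
      using True powr_realpow[of r 2] powr_half_sqrt[of r] powr_diff[of r "1 + \<beta>" 2] powr_diff[of r "1 / 2" 2]
      by simp_all
    have "min (r powr (1 + \<beta>)) (sqrt r) / r\<^sup>2 \<le> r powr (1 + \<beta>) / r\<^sup>2"
         "min (r powr (1 + \<beta>)) (sqrt r) / r\<^sup>2 \<le> sqrt r / r\<^sup>2"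
      by (intro divide_right_mono; simp)+
    then have "min (r powr (1 + \<beta>)) (sqrt r) / r\<^sup>2
        \<le> r powr (\<beta> - 1) * indicator {0..1} r + r powr (- 3/2) * indicator {1..} r"
      unfolding a using True by (auto simp: indicator_def)
    then show ?thesis using True
      by (simp add: ennreal_plus[symmetric] del: ennreal_plus)
  qed (auto simp: indicator_def)
  have "(\<integral>\<^sup>+ r. ennreal (min (r powr (1 + \<beta>)) (sqrt r) / r\<^sup>2) * indicator {0..} r \<partial>lborel)
     \<le> (\<integral>\<^sup>+ r. ennreal (r powr (\<beta> - 1) * indicator {0..1} r) + ennreal (r powr (- 3/2) * indicator {1..} r) \<partial>lborel)"
    by (rule nn_integral_mono) (rule le)
  also have "\<dots> < \<infinity>" using 0 1 by (subst nn_integral_add) auto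
  finally show ?thesis .
qed

lemma jump_weight_integrable:
  assumes "\<beta> > 0"
  shows "integrable lborel (\<lambda>z::real^'n. jump_weight \<beta> z * jump_kernel z)"
proof (rule integrableI_nonneg)
  let ?N = "CARD('n)"
  have "(\<integral>\<^sup>+ z. ennreal (jump_weight \<beta> z * jump_kernel (z::real^'n)) \<partial>lborel)
     = (\<integral>\<^sup>+ z. ennreal (min (norm z powr (1 + \<beta>)) (sqrt (norm z)) / norm (z::real^'n) ^ (?N + 1)) \<partial>lborel)"
    by (simp add: jump_weight_def jump_kernel_def)
  also have "\<dots> = (\<integral>\<^sup>+ r. ennreal (unit_ball_vol ?N * real ?N * r ^ (?N - 1)) * indicator {0..} r *
       ennreal (min (r powr (1 + \<beta>)) (sqrt r) / r ^ (?N + 1)) \<partial>lborel)"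
    by (subst nn_integral_norm_polar[where f = "\<lambda>r. ennreal (min (r powr (1 + \<beta>)) (sqrt r) / r ^ (?N + 1))"]) auto
  also have "\<dots> = (\<integral>\<^sup>+ r. ennreal (unit_ball_vol ?N * real ?N) *
      (ennreal (min (r powr (1 + \<beta>)) (sqrt r) / r\<^sup>2) * indicator {0..} r) \<partial>lborel)"
  proof (rule nn_integral_cong)
    fix r :: real
    obtain k where k: "?N = Suc k" using zero_less_card_finite[where 'a='n] by (metis gr0_implies_Suc)
    have "r ^ (?N - 1) * (c / r ^ (?N + 1)) = c / r\<^sup>2" for c
      unfolding k by (cases "r = 0") (simp_all add: power2_eq_square field_simps)
    then have "(unit_ball_vol ?N * real ?N * r ^ (?N - 1)) * (c / r ^ (?N + 1)) = (unit_ball_vol ?N * real ?N) * (c / r\<^sup>2)" for c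
      by (metis mult.assoc)
    then show "ennreal (unit_ball_vol ?N * real ?N * r ^ (?N - 1)) * indicator {0..} r *
       ennreal (min (r powr (1 + \<beta>)) (sqrt r) / r ^ (?N + 1)) = ennreal (unit_ball_vol ?N * real ?N) *
      (ennreal (min (r powr (1 + \<beta>)) (sqrt r) / r\<^sup>2) * indicator {0..} r)"
      by (cases "r \<ge> 0") (simp_all add: ennreal_mult'[symmetric] ennreal_mult[symmetric] del: power_Suc)
  qed
  also have "\<dots> < \<infinity>"
    using nn_integral_finite_radial[OF assms]
    by (subst nn_integral_cmult) (auto simp: ennreal_mult_less_top)
  finally show "(\<integral>\<^sup>+ z. ennreal (jump_weight \<beta> z * jump_kernel (z::real^'n)) \<partial>lborel) < \<infinity>" .
qed auto

lemma lborel_scaleR: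
  fixes f :: "'a::euclidean_space \<Rightarrow> real"
  assumes s: "s > 0" and [measurable]: "f \<in> borel_measurable borel"
  shows integral_lborel_scaleR: "(LINT z|lborel. f ((1 / s) *\<^sub>R z)) = s ^ DIM('a) * (LINT z|lborel. f z)"
    and integrable_lborel_scaleR: "integrable lborel f \<Longrightarrow> integrable lborel (\<lambda>z. f ((1 / s) *\<^sub>R z))"
proof -
  let ?D = "distr lborel borel (\<lambda>x::'a. 0 + (1 / s) *\<^sub>R x)"
  have eq: "lborel = density ?D (\<lambda>_. ennreal ((1 / s) ^ DIM('a)))"
    using lborel_affine[of "1 / s" "0::'a"] s by simp
  have "(LINT z|lborel. f z) = (LINT z|density ?D (\<lambda>_. ennreal ((1 / s) ^ DIM('a))). f z)"
    using eq by simp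
  also have "\<dots> = (1 / s) ^ DIM('a) * (LINT z|lborel. f ((1 / s) *\<^sub>R z))"
    using s by (subst integral_density) (auto simp: integral_distr)
  finally show "(LINT z|lborel. f ((1 / s) *\<^sub>R z)) = s ^ DIM('a) * (LINT z|lborel. f z)"
    using s by (simp add: field_simps)
  assume "integrable lborel f"
  then have "integrable (density ?D (\<lambda>_. ennreal ((1 / s) ^ DIM('a)))) f" using eq by simp
  then have "integrable lborel (\<lambda>z. (1 / s) ^ DIM('a) * f ((1 / s) *\<^sub>R z))"
    using s by (subst (asm) integrable_density) (auto simp: integrable_distr_eq)
  then show "integrable lborel (\<lambda>z. f ((1 / s) *\<^sub>R z))"
    using s by simp
qed

lemma jump_kernel_scaleR:
  assumes "s > 0"
  shows "jump_kernel ((1 / s) *\<^sub>R z) = s ^ (CARD('n) + 1) * jump_kernel (z::real^'n)"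
  using assms by (simp add: jump_kernel_def power_divide del: power_Suc)

text \<open>The kernel is homogeneous of degree -(N+1) and Lebesgue measure of degree N, so a
  dilation by s costs exactly one factor 1/s. This is the order one of the operator and the source
  of the 1/s in the estimates at distance s.\<close>

lemma jump_weight_scaled:
  assumes s: "s > 0" and "\<beta> > 0"
  shows "integrable lborel (\<lambda>z::real^'n. jump_weight \<beta> ((1 / s) *\<^sub>R z) * jump_kernel z)"
    and "(LINT z|lborel. jump_weight \<beta> ((1 / s) *\<^sub>R z) * jump_kernel (z::real^'n))
       = (LINT z|lborel. jump_weight \<beta> z * jump_kernel (z::real^'n)) / s"
proof -
  let ?f = "\<lambda>z::real^'n. jump_weight \<beta> z * jump_kernel z"
  have eq: "jump_weight \<beta> ((1 / s) *\<^sub>R z) * jump_kernel z = (1 / s ^ (CARD('n) + 1)) * ?f ((1 / s) *\<^sub>R z)" for z :: "real^'n"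
    using s by (simp add: jump_kernel_scaleR del: power_Suc)
  show "integrable lborel (\<lambda>z::real^'n. jump_weight \<beta> ((1 / s) *\<^sub>R z) * jump_kernel z)"
    unfolding eq
    by (rule integrable_mult_right, rule integrable_lborel_scaleR[OF s]) (use jump_weight_integrable[OF assms(2)] in auto)
  have "(LINT z|lborel. ?f ((1 / s) *\<^sub>R z)) = s ^ CARD('n) * (LINT z|lborel. ?f z)"
    by (subst integral_lborel_scaleR[OF s]) auto
  then show "(LINT z|lborel. jump_weight \<beta> ((1 / s) *\<^sub>R z) * jump_kernel (z::real^'n)) = (LINT z|lborel. ?f z) / s"
    unfolding eq using s by (simp add: field_simps)
qed

subsection \<open>Periodic functions\<close>

lemma zn_periodic_representative:
  fixes y :: "real^'n"
  obtains k where "\<forall>i. k $ i \<in> \<int>" "y + k \<in> cbox 0 1"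
proof
  let ?k = "(\<chi> i. - of_int \<lfloor>y $ i\<rfloor>) :: real^'n"
  show "\<forall>i. ?k $ i \<in> \<int>" by simp
  show "y + ?k \<in> cbox 0 1"
    by (auto simp: mem_box_cart) linarith+
qed

lemma zn_periodic_attains_max:
  assumes "zn_periodic (f :: real^'n \<Rightarrow> real)" "continuous_on UNIV f"
  obtains x where "\<And>y. f y \<le> f x"
proof -
  have ne: "cbox 0 (1::real^'n) \<noteq> {}" using zn_periodic_representative by blast
  obtain x where x: "\<forall>y\<in>cbox 0 1. f y \<le> f x"
    using continuous_attains_sup[of "cbox 0 (1::real^'n)" f] ne assms(2)
    by (meson compact_cbox continuous_on_subset subset_UNIV)
  have "f y \<le> f x" for y
  proof -
    obtain k where "\<forall>i. k $ i \<in> \<int>" "y + k \<in> cbox 0 1" by (rule zn_periodic_representative)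
    then show ?thesis using x assms(1) unfolding zn_periodic_def by metis
  qed
  then show thesis by (rule that)
qed

lemma zn_periodic_uminus: "zn_periodic f \<Longrightarrow> zn_periodic (\<lambda>x. - f x)"
  by (simp add: zn_periodic_def)

lemma zn_periodic_attains_min:
  assumes "zn_periodic (f :: real^'n \<Rightarrow> real)" "continuous_on UNIV f"
  obtains x where "\<And>y. f x \<le> f y"
  using zn_periodic_attains_max[OF zn_periodic_uminus[OF assms(1)]] assms(2)
  by (metis continuous_on_minus neg_le_iff_le)

lemma zn_periodic_bounded:
  assumes "zn_periodic (f :: real^'n \<Rightarrow> real)" "continuous_on UNIV f"
  shows "\<exists>B\<ge>0. \<forall>y. \<bar>f y\<bar> \<le> B"
proof -
  obtain x where x: "\<And>y. f y \<le> f x" using zn_periodic_attains_max[OF assms] by blast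
  obtain x' where x': "\<And>y. f x' \<le> f y" using zn_periodic_attains_min[OF assms] by blast
  have "\<bar>f y\<bar> \<le> \<bar>f x\<bar> + \<bar>f x'\<bar>" for y using x[of y] x'[of y] by linarith
  then show ?thesis by (intro exI[of _ "\<bar>f x\<bar> + \<bar>f x'\<bar>"]) simp
qed

subsection \<open>The half Laplacian in symmetric form\<close>

text \<open>Pairing the jumps z and -z cancels the gradient corrector, so the operator can also be
  written for functions without a gradient, such as solutions of a difference scheme. Each jump is
  then counted twice, hence the later factors \<open>\<kappa> / 2\<close>.\<close>

definition second_diff :: "(real^'n \<Rightarrow> real) \<Rightarrow> real^'n \<Rightarrow> real^'n \<Rightarrow> real" where
  "second_diff u x z = u (x + z) + u (x - z) - 2 * u x"

definition jump_integral :: "(real^'n \<Rightarrow> real) \<Rightarrow> real^'n \<Rightarrow> real" where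
  "jump_integral u x = (LINT z|lborel. second_diff u x z * jump_kernel z)"

lemma gderiv_unique:
  fixes u :: "real^'n \<Rightarrow> real"
  assumes "GDERIV u x :> D" "GDERIV u x :> E"
  shows "D = E"
proof -
  have "(\<lambda>h. h \<bullet> D) = (\<lambda>h. h \<bullet> E)"
    using assms unfolding gderiv_def by (rule has_derivative_unique)
  then have "h \<bullet> D = h \<bullet> E" for h by metis
  then show ?thesis using vector_eq_ldot[of D E] by simp
qed

lemma gderiv_grad:
  fixes u :: "real^'n \<Rightarrow> real"
  assumes "u differentiable (at x)"
  shows "GDERIV u x :> grad u x"
proof -
  obtain f' where f': "(u has_derivative f') (at x)" using assms unfolding differentiable_def by blast
  then have lin: "linear f'" by (rule has_derivative_linear)
  define D where "D = (\<Sum>b\<in>Basis. f' b *\<^sub>R b)"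
  have "f' h = h \<bullet> D" for h
  proof -
    have "f' h = f' (\<Sum>b\<in>Basis. (h \<bullet> b) *\<^sub>R b)" by (simp add: euclidean_representation)
    also have "\<dots> = (\<Sum>b\<in>Basis. (h \<bullet> b) * f' b)"
      using lin by (simp add: linear_sum linear_cmul)
    also have "\<dots> = h \<bullet> D"
      by (simp add: D_def inner_sum_right mult.commute)
    finally show ?thesis .
  qed
  then have "GDERIV u x :> D" using f' unfolding gderiv_def by presburger
  then show ?thesis
    unfolding grad_def using gderiv_unique by (metis the_equality)
qed

lemma grad_eqI: "GDERIV u x :> D \<Longrightarrow> grad u x = D" for u :: "real^'n \<Rightarrow> real"
  by (metis gderiv_unique gderiv_def gderiv_grad differentiable_def)

lemma gderiv_along_line:
  fixes u :: "real^'n \<Rightarrow> real"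
  assumes "GDERIV u (x + t *\<^sub>R z) :> D"
  shows "((\<lambda>t. u (x + t *\<^sub>R z)) has_real_derivative D \<bullet> z) (at t)"
proof -
  have "((\<lambda>t. x + t *\<^sub>R z) has_derivative (\<lambda>h. h *\<^sub>R z)) (at t)"
    by (auto intro!: derivative_eq_intros)
  from has_derivative_compose[OF this, of u "\<lambda>h. h \<bullet> D"]
  have "((\<lambda>t. u (x + t *\<^sub>R z)) has_derivative (\<lambda>h. (h *\<^sub>R z) \<bullet> D)) (at t)"
    using assms unfolding gderiv_def by simp
  then show ?thesis
    by (simp add: has_field_derivative_def mult.commute inner_commute mult_commute_abs)
qed

lemma C1_holder_torus_taylor:
  assumes "C1_holder_torus \<alpha> u" "0 < \<alpha>"
  shows "\<exists>M\<ge>0. (\<forall>x y. norm (grad u x - grad u y) \<le> M * norm (x - y) powr \<alpha>) \<and>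
    (\<forall>x z. \<bar>u (x + z) - u x - grad u x \<bullet> z\<bar> \<le> M * norm z powr (1 + \<alpha>))"
proof -
  obtain M0 where M0: "\<And>x y. norm (grad u x - grad u y) \<le> M0 * norm (x - y) powr \<alpha>"
    using assms unfolding C1_holder_torus_def by blast
  define M where "M = max M0 0"
  have M: "norm (grad u x - grad u y) \<le> M * norm (x - y) powr \<alpha>" for x y
    by (rule order_trans[OF M0]) (auto simp: M_def intro: mult_right_mono)
  have d: "GDERIV u x :> grad u x" for x
    using assms unfolding C1_holder_torus_def by (auto intro: gderiv_grad)
  have "\<bar>u (x + z) - u x - grad u x \<bullet> z\<bar> \<le> M * norm z powr (1 + \<alpha>)" for x z
  proof -
    have "\<exists>t. 0 < t \<and> t < 1 \<and> u (x + 1 *\<^sub>R z) - u (x + 0 *\<^sub>R z) = (1 - 0) * (grad u (x + t *\<^sub>R z) \<bullet> z)"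
      by (rule MVT2) (auto intro!: gderiv_along_line d)
    then obtain t where t: "0 < t" "t < 1" "u (x + z) - u x = grad u (x + t *\<^sub>R z) \<bullet> z" by auto
    have "\<bar>u (x + z) - u x - grad u x \<bullet> z\<bar> = \<bar>(grad u (x + t *\<^sub>R z) - grad u x) \<bullet> z\<bar>"
      by (simp add: t(3) inner_diff_left)
    also have "\<dots> \<le> norm (grad u (x + t *\<^sub>R z) - grad u x) * norm z"
      by (rule Cauchy_Schwarz_ineq2)
    also have "\<dots> \<le> (M * norm (t *\<^sub>R z) powr \<alpha>) * norm z"
      using M[of "x + t *\<^sub>R z" x] by (intro mult_right_mono) auto
    also have "\<dots> \<le> (M * norm z powr \<alpha>) * norm z"
      using t assms(2) by (intro mult_right_mono mult_left_mono powr_mono2) (auto simp: M_def mult_left_le_one_le)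
    also have "\<dots> = M * norm z powr (1 + \<alpha>)"
      by (cases "z = 0") (auto simp: powr_add)
    finally show ?thesis .
  qed
  then show ?thesis using M by (intro exI[of _ M]) (auto simp: M_def)
qed

lemma C1_holder_torus_continuous:
  assumes "C1_holder_torus \<alpha> u"
  shows "continuous_on UNIV u"
  using assms unfolding C1_holder_torus_def
  by (auto intro!: continuous_at_imp_continuous_on differentiable_imp_continuous_within)

lemma C1_holder_torus_gderiv: "C1_holder_torus \<alpha> u \<Longrightarrow> GDERIV u x :> grad u x"
  unfolding C1_holder_torus_def by (auto intro: gderiv_grad)

lemma C1_holder_torus_grad_continuous:
  assumes "C1_holder_torus \<alpha> u" "0 < \<alpha>"
  shows "continuous_on UNIV (grad u)"
proof -
  obtain M where M: "0 \<le> M" "\<And>x y. norm (grad u x - grad u y) \<le> M * norm (x - y) powr \<alpha>"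
    "\<And>x z. \<bar>u (x + z) - u x - grad u x \<bullet> z\<bar> \<le> M * norm z powr (1 + \<alpha>)"
    using C1_holder_torus_taylor[OF assms] by auto
  have "(grad u \<longlongrightarrow> grad u x) (at x)" for x
  proof (rule Lim_null[THEN iffD2], rule Lim_null_comparison)
    show "\<forall>\<^sub>F y in at x. norm (grad u y - grad u x) \<le> M * norm (y - x) powr \<alpha>"
      using M by auto
    have "((\<lambda>y. norm (y - x)) \<longlongrightarrow> norm (x - x)) (at x)" by (intro tendsto_intros)
    then have "((\<lambda>y. norm (y - x)) \<longlongrightarrow> 0) (at x)" by simp
    then have "((\<lambda>y. norm (y - x) powr \<alpha>) \<longlongrightarrow> 0 powr \<alpha>) (at x)"
      using assms(2) by (intro tendsto_powr') auto
    then show "((\<lambda>y. M * norm (y - x) powr \<alpha>) \<longlongrightarrow> 0) (at x)"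
      using assms(2) by (auto intro!: tendsto_mult_right_zero)
  qed
  then show ?thesis by (simp add: continuous_on_def)
qed

lemma powr_ge_sqrt_iff:
  fixes r :: real assumes "0 < \<beta>" "r \<ge> 0"
  shows "r \<le> 1 \<Longrightarrow> min (r powr (1 + \<beta>)) (sqrt r) = r powr (1 + \<beta>)"
    and "r \<ge> 1 \<Longrightarrow> min (r powr (1 + \<beta>)) (sqrt r) = sqrt r"
proof -
  have s: "sqrt r = r powr (1 / 2)" using powr_half_sqrt[OF assms(2)] by simp
  show "min (r powr (1 + \<beta>)) (sqrt r) = r powr (1 + \<beta>)" if "r \<le> 1"
    unfolding s using that assms by (intro min_absorb1 powr_mono') auto
  show "min (r powr (1 + \<beta>)) (sqrt r) = sqrt r" if "r \<ge> 1"
    unfolding s using that assms by (intro min_absorb2 powr_mono) auto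
qed

text \<open>Inside the unit ball the Taylor remainder has order 1 + \<alpha>; outside it periodicity
  bounds the function, and the weight is at least 1 there.\<close>

lemma C1_holder_torus_weight_bound:
  assumes "C1_holder_torus \<alpha> u" "0 < \<alpha>" "\<alpha> < 1"
  shows "\<exists>C\<ge>0. (\<forall>x z. \<bar>u (x + z) - u x - indicat_real (ball 0 1) z * (grad u x \<bullet> z)\<bar> \<le> C * jump_weight \<alpha> z)
    \<and> (\<forall>x z. \<bar>second_diff u x z\<bar> \<le> C * jump_weight \<alpha> z)"
proof -
  obtain M where M': "0 \<le> M" "\<And>x y. norm (grad u x - grad u y) \<le> M * norm (x - y) powr \<alpha>"
    "\<And>x z. \<bar>u (x + z) - u x - grad u x \<bullet> z\<bar> \<le> M * norm z powr (1 + \<alpha>)"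
    using C1_holder_torus_taylor[OF assms(1,2)] by auto
  note M = M'(1,3)
  have "zn_periodic u" using assms(1) by (simp add: C1_holder_torus_def)
  then obtain B where B': "\<And>y. \<bar>u y\<bar> \<le> B" "0 \<le> B"
    using zn_periodic_bounded[OF _ C1_holder_torus_continuous[OF assms(1)]] by auto
  note B = B'(2,1)
  have 1: "\<bar>u (x + z) - u x - indicat_real (ball 0 1) z * (grad u x \<bullet> z)\<bar> \<le> (M + 2 * B) * jump_weight \<alpha> z" for x z
  proof (cases "norm z < 1")
    case True
    then have "jump_weight \<alpha> z = norm z powr (1 + \<alpha>)"
      unfolding jump_weight_def using assms by (intro powr_ge_sqrt_iff) auto
    moreover have "0 \<le> 2 * B * norm z powr (1 + \<alpha>)" using B by simp
    ultimately show ?thesis using M(2)[of x z] True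
      by (simp add: distrib_right)
  next
    case False
    then have w: "jump_weight \<alpha> z = sqrt (norm z)"
      unfolding jump_weight_def using assms by (intro powr_ge_sqrt_iff) auto
    have "2 * B * 1 \<le> (M + 2 * B) * sqrt (norm z)" using False M B by (intro mult_mono) auto
    moreover have "\<bar>u (x + z) - u x\<bar> \<le> 2 * B" using B(2)[of "x+z"] B(2)[of x] by linarith
    ultimately show ?thesis using False w by simp
  qed
  have 2: "\<bar>second_diff u x z\<bar> \<le> 2 * (M + 2 * B) * jump_weight \<alpha> z" for x z
  proof -
    have "indicat_real (ball 0 1) (-z) = indicat_real (ball 0 1) z" by (simp add: indicator_def)
    moreover have "jump_weight \<alpha> (- z) = jump_weight \<alpha> z" by (simp add: jump_weight_def)
    ultimately show ?thesis
      using 1[of x z] 1[of x "-z"] unfolding second_diff_def mult.assoc[of 2 "M + 2 * B"] diff_conv_add_uminus inner_minus_right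
      by (smt (verit) mult_minus_right)
  qed
  have 3: "(M + 2 * B) * jump_weight \<alpha> z \<le> 2 * (M + 2 * B) * jump_weight \<alpha> z" for z :: "real^'a"
    using M B by (simp add: mult_right_mono)
  show ?thesis
    by (intro exI[of _ "2 * (M + 2 * B)"] conjI allI order_trans[OF 1 3] 2) (use M B in simp)
qed

lemma integrable_jump_bound:
  fixes f :: "real^'n \<Rightarrow> real"
  assumes [measurable]: "f \<in> borel_measurable borel" and "\<And>z. \<bar>f z\<bar> \<le> C * jump_weight \<beta> z" "0 < \<beta>"
  shows "integrable lborel (\<lambda>z. f z * jump_kernel z)"
proof (rule Bochner_Integration.integrable_bound)
  show "integrable lborel (\<lambda>z::real^'n. C * (jump_weight \<beta> z * jump_kernel z))"
    by (intro integrable_mult_right jump_weight_integrable assms)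
  show "AE z in lborel. norm (f z * jump_kernel z) \<le> norm (C * (jump_weight \<beta> z * jump_kernel z))"
  proof (rule AE_I2)
    fix z :: "real^'n"
    have "\<bar>f z\<bar> * jump_kernel z \<le> (C * jump_weight \<beta> z) * jump_kernel z"
      by (intro mult_right_mono assms) auto
    then show "norm (f z * jump_kernel z) \<le> norm (C * (jump_weight \<beta> z * jump_kernel z))"
      using abs_ge_self[of "C * (jump_weight \<beta> z * jump_kernel z)"]
      by (simp add: abs_mult[of "f z"] mult.assoc)
  qed
qed simp

lemma integral_lborel_reflect:
  fixes f :: "'a::euclidean_space \<Rightarrow> real"
  assumes [measurable]: "f \<in> borel_measurable borel"
  shows "(LINT z|lborel. f (- z)) = (LINT z|lborel. f z)"
    and "integrable lborel (\<lambda>z. f (- z)) \<longleftrightarrow> integrable lborel f"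
proof -
  have eq: "lborel = distr lborel borel (\<lambda>x::'a. - x)"
    using lborel_affine[of "-1" "0::'a"] by (simp add: density_1)
  have "(LINT z|lborel. f z) = (LINT z|distr lborel borel (\<lambda>x. - x). f z)" using eq by simp
  also have "\<dots> = (LINT z|lborel. f (- z))" by (subst integral_distr) auto
  finally show "(LINT z|lborel. f (- z)) = (LINT z|lborel. f z)" ..
  have "integrable lborel f \<longleftrightarrow> integrable (distr lborel borel (\<lambda>x. - x)) f" using eq by simp
  then show "integrable lborel (\<lambda>z. f (- z)) \<longleftrightarrow> integrable lborel f"
    by (subst (asm) integrable_distr_eq) auto
qed

lemma continuous_on_translate:
  fixes u :: "real^'n \<Rightarrow> real"
  assumes "continuous_on UNIV u"
  shows "continuous_on UNIV (\<lambda>z. u (x + z))" "continuous_on UNIV (\<lambda>z. u (x - z))" "continuous_on UNIV (\<lambda>z. u (z + x))"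
  by (rule continuous_on_compose2[OF assms]; auto intro!: continuous_intros)+

lemma second_diff_measurable:
  assumes "continuous_on UNIV u"
  shows "second_diff u x \<in> borel_measurable borel"
  unfolding second_diff_def [abs_def]
  by (rule borel_measurable_continuous_onI,
      intro continuous_on_add continuous_on_diff continuous_on_mult continuous_on_const continuous_on_translate[OF assms])

lemma second_diff_integrable:
  assumes "C1_holder_torus \<alpha> u" "0 < \<alpha>" "\<alpha> < 1"
  shows "integrable lborel (\<lambda>z. second_diff u x z * jump_kernel z)"
proof -
  obtain C where "\<And>x z. \<bar>second_diff u x z\<bar> \<le> C * jump_weight \<alpha> z"
    using C1_holder_torus_weight_bound[OF assms] by auto
  then show ?thesis
    by (intro integrable_jump_bound[OF second_diff_measurable _ assms(2)] C1_holder_torus_continuous[OF assms(1)])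
qed

text \<open>Averaging the integrand over z and -z removes the corrector, which is odd because the
  unit ball is symmetric. The integrand is Borel, so the completed measure may be replaced by
  \<open>lborel\<close>.\<close>

lemma half_laplacian_eq_jump_integral:
  fixes u :: "real^'n \<Rightarrow> real"
  assumes "C1_holder_torus \<alpha> u" "0 < \<alpha>" "\<alpha> < 1"
  shows "half_laplacian u x = - (half_laplacian_const TYPE('n) / 2) * jump_integral u x"
proof -
  define g where "g z = u (x + z) - u x - indicat_real (ball 0 1) z * (grad u x \<bullet> z)" for z
  have cu: "continuous_on UNIV u" by (rule C1_holder_torus_continuous[OF assms(1)])
  have [measurable]: "(\<lambda>z. u (x + z)) \<in> borel_measurable borel"
    by (rule borel_measurable_continuous_onI, rule continuous_on_translate[OF cu])
  have [measurable]: "(\<lambda>z. grad u x \<bullet> z) \<in> borel_measurable borel"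
    by (intro borel_measurable_continuous_onI continuous_intros)
  have [measurable]: "indicat_real (ball (0::real^'n) 1) \<in> borel_measurable borel"
    by (intro borel_measurable_indicator) auto
  have [measurable]: "g \<in> borel_measurable borel"
    unfolding g_def [abs_def] by measurable
  obtain C where C: "\<And>z. \<bar>g z\<bar> \<le> C * jump_weight \<alpha> z"
    unfolding g_def using C1_holder_torus_weight_bound[OF assms] by auto
  have int: "integrable lborel (\<lambda>z. g z * jump_kernel z)"
    by (rule integrable_jump_bound[OF _ C assms(2)]) auto
  have int': "integrable lborel (\<lambda>z. g (- z) * jump_kernel z)"
    using integral_lborel_reflect(2)[of "\<lambda>z. g z * jump_kernel z"] int by simp
  have "(LINT z|lebesgue. g z * jump_kernel z) = (LINT z|lborel. g z * jump_kernel z)"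
    by (rule integral_completion) simp
  moreover have "jump_integral u x = (LINT z|lborel. g z * jump_kernel z + g (- z) * jump_kernel z)"
    unfolding jump_integral_def
    by (rule Bochner_Integration.integral_cong)
       (auto simp: g_def second_diff_def indicator_def algebra_simps)
  moreover have "\<dots> = 2 * (LINT z|lborel. g z * jump_kernel z)"
    using int int' integral_lborel_reflect(1)[of "\<lambda>z. g z * jump_kernel z"]
    by (subst Bochner_Integration.integral_add) auto
  moreover have "half_laplacian u x = - half_laplacian_const TYPE('n) * (LINT z|lebesgue. g z * jump_kernel z)"
    unfolding half_laplacian_def g_def jump_kernel_def by simp
  ultimately show ?thesis by simp
qed

subsection \<open>One-point Hoelder estimate for truncated operators\<close>

lemma norm_unit_cube_le:
  fixes \<xi> :: "real^'n" assumes "\<xi> \<in> cbox 0 1"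
  shows "norm \<xi> \<le> real CARD('n)"
proof -
  have "norm \<xi> \<le> (\<Sum>i\<in>UNIV. \<bar>\<xi> $ i\<bar>)" by (rule norm_le_l1_cart)
  also have "\<dots> \<le> (\<Sum>i\<in>(UNIV::'n set). 1)"
    using assms by (intro sum_mono) (auto simp: mem_box_cart)
  finally show ?thesis by simp
qed

text \<open>Integer translations move x into the unit cube, and a difference x - y longer than N can
  be replaced by its representative in the unit cube. That representative is shorter, so the
  monotone penalty does not increase. Only a compact set of pairs remains.\<close>

lemma periodic_doubling_attains_max:
  fixes v :: "real^'n \<Rightarrow> real" and \<phi> :: "real \<Rightarrow> real"
  assumes per: "zn_periodic v" and cont: "continuous_on UNIV v"
    and \<phi>: "continuous_on {0..} \<phi>" "\<And>r s. 0 \<le> r \<Longrightarrow> r \<le> s \<Longrightarrow> \<phi> r \<le> \<phi> s"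
  shows "\<exists>a b. norm (a - b) \<le> real CARD('n) \<and>
    (\<forall>x y. v x - v y - \<phi> (norm (x - y)) \<le> v a - v b - \<phi> (norm (a - b)))"
proof -
  define F where "F = (\<lambda>(x, \<xi>). v x - v (x - \<xi>) - \<phi> (norm \<xi>))"
  define S where "S = cbox (0::real^'n) 1 \<times> cball (0::real^'n) (real CARD('n))"
  have "compact S" unfolding S_def by (intro compact_Times) auto
  moreover have "S \<noteq> {}"
    unfolding S_def using zn_periodic_representative by (metis SigmaI centre_in_cball empty_iff of_nat_0_le_iff)
  moreover have "continuous_on S F"
    unfolding F_def case_prod_beta
    by (intro continuous_on_diff continuous_on_compose2[OF cont] continuous_on_compose2[OF \<phi>(1)] continuous_intros) auto
  ultimately obtain p where p: "p \<in> S" "\<forall>q\<in>S. F q \<le> F p"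
    using continuous_attains_sup by metis
  obtain a \<xi> where a: "p = (a, \<xi>)" by (cases p)
  have *: "F (x, x - y) \<le> F p" for x y
  proof -
    obtain k where k: "\<forall>i. k $ i \<in> \<int>" "x + k \<in> cbox 0 1" by (rule zn_periodic_representative)
    obtain l where l: "\<forall>i. l $ i \<in> \<int>" "norm (x - y + l) \<le> real CARD('n)" "\<phi> (norm (x - y + l)) \<le> \<phi> (norm (x - y))"
    proof (cases "norm (x - y) \<le> real CARD('n)")
      case True
      then show thesis using that[of 0] by simp
    next
      case False
      obtain l where "\<forall>i. l $ i \<in> \<int>" "x - y + l \<in> cbox 0 1" by (rule zn_periodic_representative)
      then show thesis using that[of l] False norm_unit_cube_le[of "x - y + l"] \<phi>(2)[of "norm (x - y + l)" "norm (x - y)"] by auto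
    qed
    have "v (x + k - (x - y + l)) = v (y + (k - l))" by (simp add: algebra_simps)
    also have "\<dots> = v y" using per k(1) l(1) unfolding zn_periodic_def by (auto intro: Ints_diff)
    finally have 1: "v (x + k - (x - y + l)) = v y" .
    have 2: "v (x + k) = v x" using per k(1) unfolding zn_periodic_def by auto
    have "F (x, x - y) \<le> F (x + k, x - y + l)" unfolding F_def using 1 2 l(3) by simp
    also have "\<dots> \<le> F p" using p(2) k(2) l(2) by (auto simp: S_def)
    finally show ?thesis .
  qed
  show ?thesis
  proof (rule exI[of _ a], rule exI[of _ "a - \<xi>"], intro conjI allI)
    show "norm (a - (a - \<xi>)) \<le> real CARD('n)" using p(1) a by (simp add: S_def)
    show "v x - v y - \<phi> (norm (x - y)) \<le> v a - v (a - \<xi>) - \<phi> (norm (a - (a - \<xi>)))" for x y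
      using *[of x y] by (simp add: F_def a)
  qed
qed

section \<open>Increments of the smoothed power\<close>

text \<open>The concave power lies below its tangent at t; after division by
  \<open>t powr \<beta>\<close> this is Young's weighted inequality for t'/t and 1.\<close>

lemma powr_concave_tangent:
  fixes t t' \<beta> :: real
  assumes "0 < t" "0 < t'" "0 < \<beta>" "\<beta> \<le> 1"
  shows "t' powr \<beta> - t powr \<beta> \<le> \<beta> * t powr \<beta> * ((t' - t) / t)"
proof -
  have "(t' / t) powr \<beta> * 1 powr (1 - \<beta>) \<le> \<beta> * (t' / t) + (1 - \<beta>) * 1"
    using assms by (intro Youngs_inequality_0) auto
  then have "t' powr \<beta> / t powr \<beta> \<le> 1 + \<beta> * ((t' - t) / t)"
    using assms by (simp add: powr_divide field_simps)
  then have "t powr \<beta> * (t' powr \<beta> / t powr \<beta>) \<le> t powr \<beta> * (1 + \<beta> * ((t' - t) / t))"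
    by (intro mult_left_mono) auto
  then show ?thesis using assms by (simp add: algebra_simps)
qed

context
  fixes \<alpha> h s :: real and \<xi> :: "real^'n" and \<phi> :: "real^'n \<Rightarrow> real"
  assumes \<alpha>: "0 < \<alpha>" "\<alpha> \<le> 1/2" and h: "0 < h"
  defines "\<phi> \<equiv> \<lambda>z. ((norm z)\<^sup>2 + h\<^sup>2) powr (\<alpha> / 2)"
  defines "s \<equiv> sqrt ((norm \<xi>)\<^sup>2 + h\<^sup>2)"
begin

private lemma s_pos: "0 < s" and s_sq: "s\<^sup>2 = (norm \<xi>)\<^sup>2 + h\<^sup>2"
  using h by (auto simp: s_def add_nonneg_pos)

private lemma \<phi>_pos: "0 < \<phi> z"
  using h by (auto simp: \<phi>_def add_nonneg_pos)

text \<open>As a function of the squared norm, \<open>\<phi>\<close> is a power with exponent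
  \<alpha>/2, and concavity in that variable leaves only a quadratic polynomial in z. The bound is
  efficient for z short compared with s.\<close>

lemma smoothed_power_tangent:
  "\<phi> (\<xi> + z) - \<phi> \<xi> \<le> \<alpha> / 2 * \<phi> \<xi> * ((2 * (\<xi> \<bullet> z) + (norm z)\<^sup>2) / s\<^sup>2)"
proof -
  have "(norm (\<xi> + z))\<^sup>2 + h\<^sup>2 - ((norm \<xi>)\<^sup>2 + h\<^sup>2) = 2 * (\<xi> \<bullet> z) + (norm z)\<^sup>2"
    by (simp add: power2_norm_eq_inner inner_add_left inner_add_right inner_commute)
  then show ?thesis
    using powr_concave_tangent[of "(norm \<xi>)\<^sup>2 + h\<^sup>2" "(norm (\<xi> + z))\<^sup>2 + h\<^sup>2" "\<alpha> / 2"] \<alpha> h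
    unfolding \<phi>_def s_sq by (simp add: add_nonneg_pos)
qed

text \<open>For long z the quadratic bound is useless. With x = |z|/s, the inequality 1 + x \<le> (1
  + sqrt x)^2 produces the power 2\<alpha> of 1 + sqrt x, and Bernoulli's inequality for that
  exponent, which is at most 1 because \<alpha> \<le> 1/2, extracts the factor \<alpha>.\<close>

lemma smoothed_power_growth:
  "\<phi> (\<xi> + z) - \<phi> \<xi> \<le> 2 * \<alpha> * \<phi> \<xi> * sqrt (norm z / s)"
proof -
  define x where "x = norm z / s"
  have x: "0 \<le> x" using s_pos by (simp add: x_def)
  have le: "norm \<xi> \<le> s" unfolding s_def by (rule real_le_rsqrt) simp
  have "(norm (\<xi> + z))\<^sup>2 + h\<^sup>2 \<le> (norm \<xi> + norm z)\<^sup>2 + h\<^sup>2"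
    by (intro add_right_mono power_mono norm_triangle_ineq) auto
  also have "\<dots> \<le> (s + norm z)\<^sup>2"
    using mult_right_mono[OF le norm_ge_zero[of z]] by (simp add: power2_sum s_sq)
  also have "\<dots> = s\<^sup>2 * (1 + x)\<^sup>2"
    using s_pos by (simp add: x_def field_simps flip: power_mult_distrib)
  also have "\<dots> \<le> s\<^sup>2 * ((1 + sqrt x)\<^sup>2)\<^sup>2"
    using x by (intro mult_left_mono power_mono) (auto simp: power2_sum)
  finally have 1: "(norm (\<xi> + z))\<^sup>2 + h\<^sup>2 \<le> s\<^sup>2 * (1 + sqrt x) ^ 4" by (simp flip: power_mult)
  have pos: "0 < 1 + sqrt x" using x by (simp add: add_pos_nonneg)
  have "\<phi> (\<xi> + z) \<le> (s\<^sup>2 * (1 + sqrt x) ^ 4) powr (\<alpha> / 2)"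
    unfolding \<phi>_def using 1 \<alpha> by (intro powr_mono2) auto
  also have "\<dots> = \<phi> \<xi> * (1 + sqrt x) powr (2 * \<alpha>)"
  proof -
    have "((1 + sqrt x) ^ 4) powr (\<alpha> / 2) = (1 + sqrt x) powr (2 * \<alpha>)"
    proof -
      have "(1 + sqrt x) ^ 4 = (1 + sqrt x) powr 4" using pos powr_realpow[of "1 + sqrt x" 4] by simp
      then show ?thesis by (simp add: powr_powr)
    qed
    then show ?thesis using pos s_pos by (simp add: powr_mult \<phi>_def s_sq)
  qed
  also have "\<dots> \<le> \<phi> \<xi> * (1 + 2 * \<alpha> * sqrt x)"
  proof (rule mult_left_mono)
    show "(1 + sqrt x) powr (2 * \<alpha>) \<le> 1 + 2 * \<alpha> * sqrt x"
      using powr_concave_tangent[of 1 "1 + sqrt x" "2 * \<alpha>"] \<alpha> pos by simp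
  qed (use \<phi>_pos[of \<xi>] in simp)
  finally show ?thesis by (simp add: x_def algebra_simps)
qed

text \<open>The linear terms of the two tangent bounds at z and -z cancel, which gives the quadratic
  branch of the weight; the growth bound gives the square root branch.\<close>

lemma smoothed_power_second_diff:
  "\<phi> (\<xi> + z) + \<phi> (\<xi> - z) - 2 * \<phi> \<xi> \<le> 4 * \<alpha> * \<phi> \<xi> * jump_weight 1 ((1 / s) *\<^sub>R z)"
proof -
  have 1: "\<phi> (\<xi> + z) + \<phi> (\<xi> - z) - 2 * \<phi> \<xi> \<le> \<alpha> * \<phi> \<xi> * ((norm z)\<^sup>2 / s\<^sup>2)"
  proof -
    have "\<phi> (\<xi> + z) - \<phi> \<xi> + (\<phi> (\<xi> + - z) - \<phi> \<xi>) \<le>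
        \<alpha> / 2 * \<phi> \<xi> * ((2 * (\<xi> \<bullet> z) + (norm z)\<^sup>2) / s\<^sup>2) + \<alpha> / 2 * \<phi> \<xi> * ((2 * (\<xi> \<bullet> - z) + (norm (- z))\<^sup>2) / s\<^sup>2)"
      by (intro add_mono smoothed_power_tangent)
    also have "\<dots> = \<alpha> * \<phi> \<xi> * ((norm z)\<^sup>2 / s\<^sup>2)"
      using s_pos by (simp add: field_simps)
    finally show ?thesis by simp
  qed
  have 2: "\<phi> (\<xi> + z) + \<phi> (\<xi> - z) - 2 * \<phi> \<xi> \<le> 4 * \<alpha> * \<phi> \<xi> * sqrt (norm z / s)"
    using smoothed_power_growth[of z] smoothed_power_growth[of "- z"] by simp
  have 3: "\<alpha> * \<phi> \<xi> * ((norm z)\<^sup>2 / s\<^sup>2) \<le> 4 * \<alpha> * \<phi> \<xi> * ((norm z)\<^sup>2 / s\<^sup>2)"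
    using \<alpha> \<phi>_pos[of \<xi>] by (intro mult_right_mono) auto
  have "norm ((1 / s) *\<^sub>R z) powr (1 + 1) = (norm z)\<^sup>2 / s\<^sup>2"
    using s_pos by (cases "z = 0") (simp_all add: powr_numeral power_divide)
  moreover have "norm ((1 / s) *\<^sub>R z) = norm z / s" using s_pos by simp
  ultimately show ?thesis
    unfolding jump_weight_def using 1 2 3 by (auto simp: min_def)
qed

end

text \<open>Removing the jumps of length at most h leaves a kernel of finite mass, so the operator
  acts on all bounded continuous functions. The same h serves as mesh size of the scheme.\<close>

definition truncated_jump_integral :: "real \<Rightarrow> (real^'n \<Rightarrow> real) \<Rightarrow> real^'n \<Rightarrow> real" where
  "truncated_jump_integral h u x =
     (LINT z|lborel. second_diff u x z * indicat_real {z. h < norm z} z * jump_kernel z)"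

lemma indicator_norm_measurable [measurable]: "indicat_real {z::real^'n. h < norm z} \<in> borel_measurable borel"
  by (intro borel_measurable_indicator borel_open open_Collect_less continuous_intros)

lemma jump_weight_ge:
  assumes "0 < h" "h < norm z" "- 1 < \<beta>"
  shows "min (h powr (1 + \<beta>)) (sqrt h) \<le> jump_weight \<beta> z"
proof -
  have "h powr (1 + \<beta>) \<le> norm z powr (1 + \<beta>)" using assms by (intro powr_mono2) auto
  moreover have "sqrt h \<le> sqrt (norm z)" using assms by simp
  ultimately show ?thesis unfolding jump_weight_def by linarith
qed

lemma truncated_kernel_integrable:
  fixes f :: "real^'n \<Rightarrow> real"
  assumes [measurable]: "f \<in> borel_measurable borel" and B: "\<And>z. \<bar>f z\<bar> \<le> B" and h: "0 < h"
  shows "integrable lborel (\<lambda>z. f z * indicat_real {z. h < norm z} z * jump_kernel z)"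
proof (rule integrable_jump_bound)
  define c where "c = min (h powr (1 + 1)) (sqrt h)"
  have c: "0 < c" using h by (auto simp: c_def)
  have B0: "0 \<le> B" using B[of 0] by linarith
  show "\<bar>f z * indicat_real {z. h < norm z} z\<bar> \<le> (B / c) * jump_weight 1 z" for z
  proof (cases "h < norm z")
    case True
    then have "c \<le> jump_weight 1 z" using jump_weight_ge[OF h True, of 1] by (simp add: c_def)
    then have "B / c * c \<le> B / c * jump_weight 1 z"
      using B0 c by (intro mult_left_mono) auto
    then show ?thesis using True B[of z] c by simp
  next
    case False
    then show ?thesis using B0 c by simp
  qed
qed auto

text \<open>Contact from above with \<open>L * \<phi>\<close> reduces second differences of v to
  those of \<open>\<phi>\<close>, whose integral scales to a multiple of \<alpha>/s. On E the jump z
  is charged with its known drop instead, while the opposite jump -z, about which nothing is known,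
  is still paid for by the growth bound on \<open>\<phi>\<close>. The kernel on E is at least its
  value at radius 7/2 s.\<close>

lemma one_point_bound:
  fixes v :: "real^'n \<Rightarrow> real" and \<phi> :: "real^'n \<Rightarrow> real" and a \<xi> :: "real^'n"
  assumes \<alpha>: "0 < \<alpha>" "\<alpha> \<le> 1/2" and h: "0 < h"
  defines "\<phi> \<equiv> \<lambda>z. ((norm z)\<^sup>2 + h\<^sup>2) powr (\<alpha> / 2)"
  defines "s \<equiv> sqrt ((norm \<xi>)\<^sup>2 + h\<^sup>2)"
  assumes cont: "continuous_on UNIV v" and B: "\<And>x. \<bar>v x\<bar> \<le> B" and L: "0 \<le> L"
    and inc: "\<And>z. v (a + z) - v a \<le> L * (\<phi> (\<xi> + z) - \<phi> \<xi>)"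
    and E [measurable]: "E \<in> sets borel" "emeasure lborel E < \<infinity>"
    and Eb: "\<And>z. z \<in> E \<Longrightarrow> 3/2 * s \<le> norm z \<and> norm z \<le> 7/2 * s"
    and Ev: "\<And>z. z \<in> E \<Longrightarrow> v (a + z) - v a \<le> - (L * \<phi> \<xi> / 2)"
  shows "truncated_jump_integral h v a \<le>
     L * \<phi> \<xi> * (4 * \<alpha> * (LINT z|lborel. jump_weight 1 z * jump_kernel (z::real^'n)) / s
       - measure lborel E / (2 * (7/2 * s) ^ (CARD('n) + 1)))"
proof -
  let ?C1 = "LINT z|lborel. jump_weight 1 z * jump_kernel (z::real^'n)"
  let ?N = "CARD('n) + 1"
  let ?j = "\<lambda>z::real^'n. jump_weight 1 ((1 / s) *\<^sub>R z)"
  have s: "0 < s" using h by (auto simp: s_def add_nonneg_pos)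
  have hs: "h \<le> s" unfolding s_def by (rule real_le_rsqrt) simp
  have \<phi>: "0 < \<phi> z" for z using h by (auto simp: \<phi>_def add_nonneg_pos)
  have grow: "\<phi> (\<xi> + z) - \<phi> \<xi> \<le> 2 * \<alpha> * \<phi> \<xi> * sqrt (norm z / s)" for z
    unfolding \<phi>_def s_def by (rule smoothed_power_growth[OF \<alpha> h])
  have sd: "\<phi> (\<xi> + z) + \<phi> (\<xi> - z) - 2 * \<phi> \<xi> \<le> 4 * \<alpha> * \<phi> \<xi> * ?j z" for z
    unfolding \<phi>_def s_def by (rule smoothed_power_second_diff[OF \<alpha> h])
  have meas: "second_diff v a \<in> borel_measurable borel" by (rule second_diff_measurable[OF cont])
  have 1: "second_diff v a z \<le> L * \<phi> \<xi> * (4 * \<alpha> * ?j z) - L * \<phi> \<xi> / 2 * indicat_real E z" for z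
  proof (cases "z \<in> E")
    case True
    have w: "?j z = sqrt (norm z / s)"
    proof -
      have "1 \<le> norm z / s" using Eb[OF True] s by (simp add: field_simps)
      then show ?thesis unfolding jump_weight_def using s by (subst powr_ge_sqrt_iff) auto
    qed
    have "v (a + - z) - v a \<le> L * (\<phi> (\<xi> + - z) - \<phi> \<xi>)" by (rule inc)
    also have "\<dots> \<le> L * (2 * \<alpha> * \<phi> \<xi> * sqrt (norm (- z) / s))"
      by (intro mult_left_mono grow L)
    also have "\<dots> \<le> L * (4 * \<alpha> * \<phi> \<xi> * sqrt (norm (- z) / s))"
      using \<alpha> \<phi>[of \<xi>] s by (intro mult_left_mono mult_right_mono L) auto
    finally have "v (a - z) - v a \<le> L * \<phi> \<xi> * (4 * \<alpha> * ?j z)"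
      by (simp add: w mult_ac)
    then show ?thesis using Ev[OF True] True unfolding second_diff_def by simp
  next
    case False
    have "second_diff v a z \<le> L * (\<phi> (\<xi> + z) - \<phi> \<xi>) + L * (\<phi> (\<xi> + - z) - \<phi> \<xi>)"
      using inc[of z] inc[of "- z"] unfolding second_diff_def by simp
    also have "\<dots> = L * (\<phi> (\<xi> + z) + \<phi> (\<xi> - z) - 2 * \<phi> \<xi>)" by (simp add: algebra_simps)
    also have "\<dots> \<le> L * (4 * \<alpha> * \<phi> \<xi> * ?j z)" by (intro mult_left_mono sd L)
    finally show ?thesis using False by (simp add: mult_ac)
  qed
  let ?g = "\<lambda>z. L * \<phi> \<xi> * 4 * \<alpha> * (?j z * jump_kernel z) - L * \<phi> \<xi> / 2 / (7/2 * s) ^ ?N * indicat_real E z"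
  have le: "second_diff v a z * indicat_real {z. h < norm z} z * jump_kernel z \<le> ?g z" for z
  proof -
    have "second_diff v a z * (indicat_real {z. h < norm z} z * jump_kernel z)
       \<le> (L * \<phi> \<xi> * (4 * \<alpha> * ?j z) - L * \<phi> \<xi> / 2 * indicat_real E z) * (indicat_real {z. h < norm z} z * jump_kernel z)"
      using 1 by (intro mult_right_mono) auto
    also have "\<dots> \<le> ?g z"
    proof (cases "z \<in> E")
      case True
      then have "3/2 * s \<le> norm z" "norm z \<le> 7/2 * s" using Eb by auto
      then have z: "h < norm z" "0 < norm z" using hs s by linarith+
      have "1 / (7/2 * s) ^ ?N \<le> jump_kernel z"
        unfolding jump_kernel_def using z \<open>norm z \<le> 7/2 * s\<close>
        by (intro divide_left_mono power_mono mult_pos_pos zero_less_power) (use s in auto)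
      then have "L * \<phi> \<xi> / 2 * (1 / (7/2 * s) ^ ?N) \<le> L * \<phi> \<xi> / 2 * jump_kernel z"
        using L \<phi>[of \<xi>] by (intro mult_left_mono) auto
      then show ?thesis using True z by (simp add: algebra_simps)
    next
      case False
      have "0 \<le> L * \<phi> \<xi> * (4 * \<alpha> * ?j z) * jump_kernel z"
        using L \<phi>[of \<xi>] \<alpha> by (intro mult_nonneg_nonneg) auto
      then show ?thesis using False by (auto simp: indicator_def mult_ac)
    qed
    finally show ?thesis by (simp add: mult.assoc)
  qed
  have "\<bar>second_diff v a z\<bar> \<le> 4 * B" for z
    using B[of "a + z"] B[of "a - z"] B[of a] unfolding second_diff_def by (simp add: abs_le_iff)
  then have int1: "integrable lborel (\<lambda>z. second_diff v a z * indicat_real {z. h < norm z} z * jump_kernel z)"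
    by (rule truncated_kernel_integrable[OF meas _ h])
  have int2: "integrable lborel (\<lambda>z. ?j z * jump_kernel z)" by (rule jump_weight_scaled(1)[OF s]) simp
  have int3: "integrable lborel (\<lambda>z. indicat_real E z)" using E by simp
  have "truncated_jump_integral h v a \<le> (LINT z|lborel. ?g z)"
    unfolding truncated_jump_integral_def
    by (rule integral_mono[OF int1 _ le]) (use int2 int3 in auto)
  also have "\<dots> = L * \<phi> \<xi> * 4 * \<alpha> * (LINT z|lborel. ?j z * jump_kernel z) - L * \<phi> \<xi> / 2 / (7/2 * s) ^ ?N * measure lborel E"
    using int2 int3 E by (subst Bochner_Integration.integral_diff) auto
  also have "(LINT z|lborel. ?j z * jump_kernel z) = ?C1 / s"
    using s by (rule jump_weight_scaled(2)) simp
  finally show ?thesis using s by (simp add: field_simps)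
qed

section \<open>The shell around the midpoint and the resulting Hoelder estimate\<close>

text \<open>The radii 2 and 3 are chosen so that, for two points at distance at most s, the shell
  with radii 2s and 3s about their midpoint keeps a distance between 3/2 s and 7/2 s from both: it
  lies beyond the cut-off h \<le> s, and the kernel is bounded below on it.\<close>

definition shell_constant :: "'n::finite itself \<Rightarrow> real" where
  "shell_constant _ = measure lborel (ball (0::real^'n) 3) - measure lborel (ball (0::real^'n) 2)"

lemma shell_constant_pos: "0 < shell_constant TYPE('n::finite)"
proof -
  have "(2::real) ^ CARD('n) < 3 ^ CARD('n)" by (rule power_strict_mono) auto
  then have "0 < unit_ball_vol (real CARD('n)) * (3 ^ CARD('n) - 2 ^ CARD('n))" by simp
  then show ?thesis by (simp add: shell_constant_def content_ball algebra_simps)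
qed

lemma shell_measure:
  fixes c :: "real^'n" assumes "0 < s"
  shows "measure lborel (ball c (3 * s) - ball c (2 * s)) = shell_constant TYPE('n) * s ^ CARD('n)"
proof -
  let ?w = "unit_ball_vol (real CARD('n))"
  have sh: "shell_constant TYPE('n) = ?w * (3 ^ CARD('n) - 2 ^ CARD('n))"
    by (simp add: shell_constant_def content_ball algebra_simps)
  have "measure lborel (ball c (3 * s) - ball c (2 * s)) = measure lborel (ball c (3 * s)) - measure lborel (ball c (2 * s))"
    using assms by (intro measure_Diff) (auto simp: emeasure_ball)
  then show ?thesis
    using assms by (simp add: sh content_ball algebra_simps power_mult_distrib)
qed

text \<open>Each point of the shell has a value at most or at least the mean of \<open>v a\<close>
  and \<open>v b\<close>, so one of the two sets fills half of the shell. A low value is a large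
  drop seen from a, a high value a large rise seen from b; \<open>E1\<close> and \<open>E2\<close>
  are these sets written as sets of jumps.\<close>

lemma half_shell_measure:
  fixes v :: "real^'n \<Rightarrow> real"
  assumes cont: "continuous_on UNIV v" and s: "0 < s" "norm (a - b) \<le> s"
  defines "A \<equiv> ball ((1/2) *\<^sub>R (a + b)) (3 * s) - ball ((1/2) *\<^sub>R (a + b)) (2 * s)"
  defines "E1 \<equiv> {z. a + z \<in> A \<and> v (a + z) \<le> (v a + v b) / 2}"
    and "E2 \<equiv> {z. b + z \<in> A \<and> v (b + z) \<ge> (v a + v b) / 2}"
  shows "E1 \<in> sets borel" "E2 \<in> sets borel" "emeasure lborel E1 < \<infinity>" "emeasure lborel E2 < \<infinity>"
    "\<And>z. z \<in> E1 \<Longrightarrow> 3/2 * s \<le> norm z \<and> norm z \<le> 7/2 * s"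
    "\<And>z. z \<in> E2 \<Longrightarrow> 3/2 * s \<le> norm z \<and> norm z \<le> 7/2 * s"
    "measure lborel E1 \<ge> shell_constant TYPE('n) * s ^ CARD('n) / 2 \<or>
     measure lborel E2 \<ge> shell_constant TYPE('n) * s ^ CARD('n) / 2"
proof -
  let ?m = "(1/2) *\<^sub>R (a + b)"
  let ?W1 = "{w \<in> A. v w \<le> (v a + v b) / 2}" and ?W2 = "{w \<in> A. v w \<ge> (v a + v b) / 2}"
  have [measurable]: "v \<in> borel_measurable borel" by (rule borel_measurable_continuous_onI[OF cont])
  have [measurable]: "A \<in> sets borel" unfolding A_def by auto
  have W: "?W1 \<in> sets borel" "?W2 \<in> sets borel" by measurable
  have Wf: "emeasure lborel ?W1 < \<infinity>" "emeasure lborel ?W2 < \<infinity>"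
  proof -
    have "emeasure lborel S < \<infinity>" if "S \<subseteq> A" for S
    proof -
      have "emeasure lborel S \<le> emeasure lborel (ball ?m (3 * s))"
        using that by (intro emeasure_mono) (auto simp: A_def)
      also have "\<dots> < \<infinity>" using s by (simp add: emeasure_ball)
      finally show ?thesis .
    qed
    then show "emeasure lborel ?W1 < \<infinity>" "emeasure lborel ?W2 < \<infinity>" by auto
  qed
  have E: "E1 = (+) (- a) ` ?W1" "E2 = (+) (- b) ` ?W2"
  proof -
    have im: "{z. c + z \<in> S} = (+) (- c) ` S" for c :: "real^'n" and S
    proof (intro set_eqI iffI)
      fix z assume "z \<in> {z. c + z \<in> S}"
      then show "z \<in> (+) (- c) ` S" by (intro image_eqI[of _ _ "c + z"]) auto
    qed auto
    show "E1 = (+) (- a) ` ?W1" "E2 = (+) (- b) ` ?W2"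
      unfolding im[symmetric] E1_def E2_def by auto
  qed
  have tr: "emeasure lborel ((+) c ` S) = emeasure lborel S" "(+) c ` S \<in> sets borel" if "S \<in> sets borel" for c :: "real^'n" and S
  proof -
    have im: "(+) c ` S = (\<lambda>x. - c + x) -` S \<inter> space borel"
    proof (intro set_eqI iffI)
      fix z assume "z \<in> (\<lambda>x. - c + x) -` S \<inter> space borel"
      then show "z \<in> (+) c ` S" by (intro image_eqI[of _ _ "- c + z"]) auto
    qed auto
    moreover have "(\<lambda>x. - c + x) \<in> borel_measurable borel" by measurable
    ultimately show "(+) c ` S \<in> sets borel" using that by (metis measurable_sets)
    have "emeasure lborel S = emeasure (distr lborel borel ((+) (- c))) S" by (simp add: lborel_distr_plus)
    also have "\<dots> = emeasure lborel ((+) (- c) -` S \<inter> space lborel)" using that by (intro emeasure_distr) auto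
    also have "(+) (- c) -` S \<inter> space lborel = (+) c ` S" unfolding im by auto
    finally show "emeasure lborel ((+) c ` S) = emeasure lborel S" ..
  qed
  show "E1 \<in> sets borel" "E2 \<in> sets borel" unfolding E by (rule tr(2)[OF W(1)], rule tr(2)[OF W(2)])
  show "emeasure lborel E1 < \<infinity>" "emeasure lborel E2 < \<infinity>" unfolding E tr(1)[OF W(1)] tr(1)[OF W(2)] by (rule Wf)+
  have geo: "3/2 * s \<le> norm z \<and> norm z \<le> 7/2 * s" if "c + z \<in> A" "c = a \<or> c = b" for c z
  proof -
    have 1: "2 * s \<le> norm (c + z - ?m)" "norm (c + z - ?m) < 3 * s"
      using that by (auto simp: A_def dist_norm norm_minus_commute)
    have "c - ?m = (1/2) *\<^sub>R (a - b) \<or> c - ?m = - ((1/2) *\<^sub>R (a - b))"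
      using that(2) by (auto simp: vec_eq_iff field_simps)
    then have 2: "norm (c - ?m) \<le> s / 2" using s(2) by (auto simp del: scaleR_right_diff_distrib)
    have 3: "norm (c + z - ?m) \<le> norm z + norm (c - ?m)"
      using norm_triangle_ineq[of z "c - ?m"] by (simp add: algebra_simps)
    have 4: "norm z \<le> norm (c + z - ?m) + norm (c - ?m)"
      using norm_triangle_ineq4[of "c + z - ?m" "c - ?m"] by simp
    show ?thesis using 1 2 3 4 by linarith
  qed
  show "\<And>z. z \<in> E1 \<Longrightarrow> 3/2 * s \<le> norm z \<and> norm z \<le> 7/2 * s"
    using geo[of a] by (simp add: E1_def)
  show "\<And>z. z \<in> E2 \<Longrightarrow> 3/2 * s \<le> norm z \<and> norm z \<le> 7/2 * s"
    using geo[of b] by (simp add: E2_def)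
  have "measure lborel A \<le> measure lborel (?W1 \<union> ?W2)"
    using W Wf by (intro measure_mono_fmeasurable) (auto simp: fmeasurable_def intro!: le_less_trans[OF emeasure_subadditive])
  also have "\<dots> \<le> measure lborel ?W1 + measure lborel ?W2"
    using W by (intro measure_Un_le) auto
  finally have le: "measure lborel A \<le> measure lborel ?W1 + measure lborel ?W2" .
  have "measure lborel ?W1 = measure lborel E1" "measure lborel ?W2 = measure lborel E2"
    unfolding E measure_def tr(1)[OF W(1)] tr(1)[OF W(2)] by (rule refl)+
  then show "measure lborel E1 \<ge> shell_constant TYPE('n) * s ^ CARD('n) / 2 \<or>
     measure lborel E2 \<ge> shell_constant TYPE('n) * s ^ CARD('n) / 2"
    using le shell_measure[OF s(1), of ?m] unfolding A_def by linarith
qed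

text \<open>This is how one-sided information of a monotone scheme enters: at a point where the increments of
  \<open>v\<close> along the coordinate steps are at most \<open>S * h\<close>, the scheme bounds the jump integral from below.\<close>

definition one_sided_scheme :: "real \<Rightarrow> real \<Rightarrow> real \<Rightarrow> (real^'n \<Rightarrow> real) \<Rightarrow> bool" where
  "one_sided_scheme h A F v \<longleftrightarrow> (\<forall>y S. 0 \<le> S \<longrightarrow>
     (\<forall>i. v (y + h *\<^sub>R axis i 1) - v y \<le> S * h \<and> v (y - h *\<^sub>R axis i 1) - v y \<le> S * h) \<longrightarrow>
     - A * S - F \<le> truncated_jump_integral h v y)"

text \<open>The gap between \<open>v a\<close> and \<open>v b\<close> turns membership in E into a
  drop of at least half of \<open>L * \<phi> (a - b)\<close>. The bound on the jump integral from
  contact is then confronted with the one from the scheme: the shell contributes a fixed gain, while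
  kernel and drift contribute terms proportional to \<alpha>. Only the lower half of the shell is
  treated.\<close>

lemma one_point_contradiction:
  fixes v :: "real^'n \<Rightarrow> real" and a b :: "real^'n"
  assumes \<alpha>: "0 < \<alpha>" "\<alpha> \<le> 1/2" and h: "0 < h"
  defines "\<phi> \<equiv> \<lambda>z::real^'n. ((norm z)\<^sup>2 + h\<^sup>2) powr (\<alpha> / 2)"
  defines "s \<equiv> sqrt ((norm (a - b))\<^sup>2 + h\<^sup>2)"
  assumes cont: "continuous_on UNIV v" and B: "\<And>x. \<bar>v x\<bar> \<le> B" and L: "0 \<le> L" and A: "0 \<le> A"
    and max: "\<And>x y. v x - v y - L * \<phi> (x - y) \<le> v a - v b - L * \<phi> (a - b)"
    and gap: "L * \<phi> (a - b) \<le> v a - v b"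
    and sch: "one_sided_scheme h A F v"
    and E: "E = {z. a + z \<in> ball ((1/2) *\<^sub>R (a + b)) (3 * s) - ball ((1/2) *\<^sub>R (a + b)) (2 * s) \<and> v (a + z) \<le> (v a + v b) / 2}"
    and mE: "measure lborel E \<ge> shell_constant TYPE('n) * s ^ CARD('n) / 2"
  shows "L * \<phi> (a - b) / s * (shell_constant TYPE('n) / (4 * (7/2) ^ (CARD('n) + 1))
      - 4 * \<alpha> * (LINT z|lborel. jump_weight 1 z * jump_kernel (z::real^'n)) - 3/2 * \<alpha> * A) \<le> F"
proof -
  let ?C1 = "LINT z|lborel. jump_weight 1 z * jump_kernel (z::real^'n)"
  let ?\<xi> = "a - b"
  let ?n = "CARD('n)"
  have s: "0 < s" "norm (a - b) \<le> s" using h unfolding s_def by (auto simp: add_nonneg_pos intro: real_le_rsqrt)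
  have hs: "h \<le> s" unfolding s_def by (rule real_le_rsqrt) simp
  have \<phi>: "0 < \<phi> z" for z using h by (auto simp: \<phi>_def add_nonneg_pos)
  note shell = half_shell_measure[OF cont s, folded E]
  have inc: "v (a + z) - v a \<le> L * (\<phi> (?\<xi> + z) - \<phi> ?\<xi>)" for z
    using max[of "a + z" b] by (simp add: algebra_simps)
  have "v a - v b \<ge> L * \<phi> ?\<xi>" by (rule gap)
  then have Ev: "v (a + z) - v a \<le> - (L * \<phi> ?\<xi> / 2)" if "z \<in> E" for z
  proof -
    have "v (a + z) \<le> (v a + v b) / 2" using that E by auto
    then show ?thesis using gap by argo
  qed
  have ub: "truncated_jump_integral h v a \<le>
     L * \<phi> ?\<xi> * (4 * \<alpha> * ?C1 / s - measure lborel E / (2 * (7/2 * s) ^ (?n + 1)))"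
    unfolding \<phi>_def s_def
    by (rule one_point_bound[OF \<alpha> h cont B L])
       (use inc Ev shell(1,3,5) in \<open>unfold \<phi>_def s_def, auto\<close>)
  \<comment> \<open>The slope allowed by contact along a mesh step: for |z| = h \<le> s the tangent
    bound has numerator at most 2 s h + h^2 \<le> 3 s h.\<close>
  define S where "S = L * (3/2 * \<alpha> * \<phi> ?\<xi> / s)"
  have S: "0 \<le> S" unfolding S_def using L \<alpha> \<phi>[of ?\<xi>] s by (intro mult_nonneg_nonneg divide_nonneg_nonneg) auto
  have step: "v (a + z) - v a \<le> S * h" if z: "norm z = h" for z
  proof -
    have "\<bar>?\<xi> \<bullet> z\<bar> \<le> s * h" using Cauchy_Schwarz_ineq2[of ?\<xi> z] s(2) z h
      by (metis abs_of_pos mult_right_mono norm_ge_zero order_trans)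
    moreover have "h\<^sup>2 \<le> s * h" using hs h by (simp add: power2_eq_square)
    ultimately have 1: "2 * (?\<xi> \<bullet> z) + (norm z)\<^sup>2 \<le> 3 * (s * h)" using z by (simp add: abs_le_iff)
    have "v (a + z) - v a \<le> L * (\<phi> (?\<xi> + z) - \<phi> ?\<xi>)" by (rule inc)
    also have "\<dots> \<le> L * (\<alpha> / 2 * \<phi> ?\<xi> * ((2 * (?\<xi> \<bullet> z) + (norm z)\<^sup>2) / s\<^sup>2))"
      unfolding \<phi>_def s_def by (intro mult_left_mono smoothed_power_tangent L \<alpha> h)
    also have "\<dots> \<le> L * (\<alpha> / 2 * \<phi> ?\<xi> * ((3 * (s * h)) / s\<^sup>2))"
      using L \<alpha> \<phi>[of ?\<xi>] 1 by (intro mult_left_mono divide_right_mono) auto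
    also have "\<dots> = S * h" unfolding S_def using s by (simp add: power2_eq_square field_simps)
    finally show ?thesis .
  qed
  have lb: "- A * S - F \<le> truncated_jump_integral h v a"
  proof -
    have "v (a + h *\<^sub>R axis i 1) - v a \<le> S * h \<and> v (a - h *\<^sub>R axis i 1) - v a \<le> S * h" for i
      using step[of "h *\<^sub>R axis i 1"] step[of "- (h *\<^sub>R axis i 1)"] h by simp
    then show ?thesis using sch S unfolding one_sided_scheme_def by blast
  qed
  let ?c = "shell_constant TYPE('n)"
  have "?c / (4 * (7/2) ^ (?n + 1)) / s = (?c * s ^ ?n / 2) / (2 * (7/2 * s) ^ (?n + 1))"
    using s by (simp add: power_mult_distrib field_simps)
  also have "\<dots> \<le> measure lborel E / (2 * (7/2 * s) ^ (?n + 1))"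
    using mE s by (intro divide_right_mono) auto
  finally have "L * \<phi> ?\<xi> * (4 * \<alpha> * ?C1 / s - measure lborel E / (2 * (7/2 * s) ^ (?n + 1)))
     \<le> L * \<phi> ?\<xi> * (4 * \<alpha> * ?C1 / s - ?c / (4 * (7/2) ^ (?n + 1)) / s)"
    using L \<phi>[of ?\<xi>] by (intro mult_left_mono) auto
  with ub lb have "- A * S - F \<le> L * \<phi> ?\<xi> * (4 * \<alpha> * ?C1 / s - ?c / (4 * (7/2) ^ (?n + 1)) / s)" by linarith
  also have "\<dots> = L * \<phi> ?\<xi> / s * (4 * \<alpha> * ?C1 - ?c / (4 * (7/2) ^ (?n + 1)))"
    using s by (simp add: field_simps)
  finally have "- (A * S) \<le> F + L * \<phi> ?\<xi> / s * (4 * \<alpha> * ?C1 - ?c / (4 * (7/2) ^ (?n + 1)))" by simp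
  moreover have "A * S = L * \<phi> ?\<xi> / s * (3/2 * \<alpha> * A)" unfolding S_def by (simp add: ac_simps)
  ultimately show ?thesis by (simp only: right_diff_distrib)
qed

lemma truncated_jump_integral_uminus:
  "truncated_jump_integral h (\<lambda>x. - v x) a = - truncated_jump_integral h v a"
proof -
  have "second_diff (\<lambda>x. - v x) a z = - second_diff v a z" for z by (simp add: second_diff_def)
  then show ?thesis by (simp add: truncated_jump_integral_def)
qed

text \<open>If the bound failed, the doubled function would have a positive maximum for some L above
  \<open>C * F\<close>, and the one-point inequality there would give 2 L \<le> C F. The exponent
  depends only on A and the dimension, and the bound is linear in F, so one exponent serves
  increments of every size.\<close>

theorem discrete_holder_estimate:
  fixes A :: real
  assumes A: "0 \<le> A"
  shows "\<exists>\<alpha> C. 0 < \<alpha> \<and> \<alpha> \<le> 1/2 \<and> 0 < C \<and>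
    (\<forall>(v::real^'n \<Rightarrow> real) h F x y. 0 < h \<longrightarrow> h \<le> 1 \<longrightarrow> 0 \<le> F \<longrightarrow> zn_periodic v \<longrightarrow> continuous_on UNIV v \<longrightarrow>
      one_sided_scheme h A F v \<longrightarrow> one_sided_scheme h A F (\<lambda>x. - v x) \<longrightarrow>
      v x - v y \<le> C * F * ((norm (x - y))\<^sup>2 + h\<^sup>2) powr (\<alpha> / 2))"
proof -
  let ?C1 = "LINT z|lborel. jump_weight 1 z * jump_kernel (z::real^'n)"
  let ?n = "real CARD('n)"
  define c0 where "c0 = shell_constant TYPE('n) / (4 * (7/2) ^ (CARD('n) + 1))"
  have c0: "0 < c0" unfolding c0_def using shell_constant_pos[where 'n='n] by simp
  have C1: "0 \<le> ?C1" by (rule integral_nonneg_AE) simp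
  \<comment> \<open>Makes the costs of kernel and drift together at most half of the gain
    \<open>c0\<close>; the added 1 keeps the denominator positive.\<close>
  define \<alpha> where "\<alpha> = min (1/2) (c0 / (2 * (4 * ?C1 + 3/2 * A + 1)))"
  have D: "0 < 4 * ?C1 + 3/2 * A + 1" using C1 A by (simp add: add_nonneg_pos)
  have "0 < c0 / (2 * (4 * ?C1 + 3/2 * A + 1))" using c0 D by (intro divide_pos_pos) auto
  then have \<alpha>: "0 < \<alpha>" "\<alpha> \<le> 1/2" unfolding \<alpha>_def by linarith+
  have "\<alpha> * (4 * ?C1 + 3/2 * A) \<le> \<alpha> * (4 * ?C1 + 3/2 * A + 1)" using \<alpha> by (intro mult_left_mono) auto
  also have "\<dots> \<le> c0 / (2 * (4 * ?C1 + 3/2 * A + 1)) * (4 * ?C1 + 3/2 * A + 1)"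
    using D by (intro mult_right_mono) (auto simp: \<alpha>_def)
  also have "\<dots> = c0 / 2" using D by (simp add: field_simps)
  finally have small: "c0 / 2 \<le> c0 - 4 * \<alpha> * ?C1 - 3/2 * \<alpha> * A" by (simp add: algebra_simps)
  \<comment> \<open>One factor 2 accounts for the half of the gain that remains, N + 1 bounds s, and
    the other factor 2 leaves room for the contradiction 2 L \<le> C F < L.\<close>
  define C where "C = 4 * (?n + 1) / c0"
  have C: "0 < C" using c0 by (simp add: C_def)
  have "v x - v y \<le> C * F * ((norm (x - y))\<^sup>2 + h\<^sup>2) powr (\<alpha> / 2)"
    if h: "0 < h" "h \<le> 1" and F: "0 \<le> F" and v: "zn_periodic v" "continuous_on UNIV v"
      and sch: "one_sided_scheme h A F v" "one_sided_scheme h A F (\<lambda>x. - v x)"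
    for v :: "real^'n \<Rightarrow> real" and h F x y
  proof (rule ccontr)
    define \<phi> where "\<phi> = (\<lambda>z::real^'n. ((norm z)\<^sup>2 + h\<^sup>2) powr (\<alpha> / 2))"
    have \<phi>: "0 < \<phi> z" for z using h by (auto simp: \<phi>_def add_nonneg_pos)
    assume "\<not> ?thesis"
    then have "C * F < (v x - v y) / \<phi> (x - y)"
      using \<phi>[of "x - y"] by (simp add: field_simps \<phi>_def)
    then obtain L where L': "C * F < L" "L < (v x - v y) / \<phi> (x - y)" using dense by blast
    have L: "0 < L" using L'(1) C F by (smt (verit) mult_nonneg_nonneg)
    have Lxy: "0 < v x - v y - L * \<phi> (x - y)" using L'(2) \<phi>[of "x - y"] by (simp add: field_simps)
    have cphi: "continuous_on {0..} (\<lambda>r. L * (r\<^sup>2 + h\<^sup>2) powr (\<alpha> / 2))"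
      using h \<alpha> by (intro continuous_intros) (auto simp: add_nonneg_pos power2_eq_square intro!: add_nonneg_pos[THEN less_imp_neq, THEN not_sym])
    have mphi: "L * (r\<^sup>2 + h\<^sup>2) powr (\<alpha> / 2) \<le> L * (t\<^sup>2 + h\<^sup>2) powr (\<alpha> / 2)" if "0 \<le> r" "r \<le> t" for r t
      using that L \<alpha> by (intro mult_left_mono powr_mono2 add_right_mono power_mono) auto
    obtain a b where ab: "norm (a - b) \<le> ?n"
      "\<And>x y. v x - v y - L * \<phi> (x - y) \<le> v a - v b - L * \<phi> (a - b)"
      using periodic_doubling_attains_max[OF v cphi mphi] unfolding \<phi>_def by auto
    have gap: "L * \<phi> (a - b) \<le> v a - v b" using ab(2)[of x y] Lxy by linarith
    define s where "s = sqrt ((norm (a - b))\<^sup>2 + h\<^sup>2)"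
    have s: "0 < s" "norm (a - b) \<le> s" using h unfolding s_def by (auto simp: add_nonneg_pos intro: real_le_rsqrt)
    have "s \<le> norm (a - b) + h" unfolding s_def using h by (intro sqrt_sum_squares_le_sum) auto
    then have s1: "s \<le> ?n + 1" using ab(1) h by linarith
    obtain B where B: "\<And>y. \<bar>v y\<bar> \<le> B" using zn_periodic_bounded[OF v] by auto
    have main: "L * \<phi> (a - b) / s * (c0 - 4 * \<alpha> * ?C1 - 3/2 * \<alpha> * A) \<le> F"
    proof -
      let ?A = "ball ((1/2) *\<^sub>R (a + b)) (3 * s) - ball ((1/2) *\<^sub>R (a + b)) (2 * s)"
      let ?E1 = "{z. a + z \<in> ?A \<and> v (a + z) \<le> (v a + v b) / 2}"
      let ?E2 = "{z. b + z \<in> ?A \<and> v (b + z) \<ge> (v a + v b) / 2}"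
      from half_shell_measure(7)[OF v(2) s]
      consider "measure lborel ?E1 \<ge> shell_constant TYPE('n) * s ^ CARD('n) / 2"
        | "measure lborel ?E2 \<ge> shell_constant TYPE('n) * s ^ CARD('n) / 2" by blast
      then show ?thesis
      proof cases
        case 1
        show ?thesis
          using one_point_contradiction[OF \<alpha> h(1) v(2) B less_imp_le[OF L] A ab(2)[unfolded \<phi>_def] gap[unfolded \<phi>_def] sch(1), folded s_def, OF refl 1]
          unfolding c0_def \<phi>_def .
      next
        case 2
        \<comment> \<open>The upper half of the shell becomes the lower half for -v with a and b
          exchanged; this is what the one-sided scheme for -v is for.\<close>
        let ?w = "\<lambda>x. - v x"
        have cw: "continuous_on UNIV ?w" using v(2) by (intro continuous_intros)
        have sym: "\<phi> (x - y) = \<phi> (y - x)" for x y by (simp add: \<phi>_def norm_minus_commute)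
        have maxw: "?w x - ?w y - L * \<phi> (x - y) \<le> ?w b - ?w a - L * \<phi> (b - a)" for x y
          using ab(2)[of y x] sym[of x y] sym[of a b] by simp
        have gapw: "L * \<phi> (b - a) \<le> ?w b - ?w a" using gap sym[of a b] by simp
        have sw: "sqrt ((norm (b - a))\<^sup>2 + h\<^sup>2) = s" unfolding s_def by (simp add: norm_minus_commute)
        have E2: "?E2 = {z. b + z \<in> ball ((1/2) *\<^sub>R (b + a)) (3 * s) - ball ((1/2) *\<^sub>R (b + a)) (2 * s) \<and> ?w (b + z) \<le> (?w b + ?w a) / 2}"
          by (auto simp: add.commute[of b a])
        have "L * \<phi> (b - a) / s * (c0 - 4 * \<alpha> * ?C1 - 3/2 * \<alpha> * A) \<le> F"
          using one_point_contradiction[OF \<alpha> h(1) cw _ less_imp_le[OF L] A maxw[unfolded \<phi>_def] gapw[unfolded \<phi>_def] sch(2), unfolded sw, OF _ E2 2, of B] B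
          unfolding c0_def \<phi>_def by simp
        then show ?thesis using sym by simp
      qed
    qed
    \<comment> \<open>The quotient is s^(\<alpha>-1), and s \<le> N + 1 because the maximizing pair
      lies within distance N and h \<le> 1.\<close>
    have "1 / (?n + 1) \<le> \<phi> (a - b) / s"
    proof -
      have "\<phi> (a - b) = s powr \<alpha>"
        unfolding \<phi>_def s_def using h by (simp add: powr_half_sqrt[symmetric] powr_powr add_nonneg_pos)
      moreover have "s powr \<alpha> / s = s powr (\<alpha> - 1)" using s by (simp add: powr_diff)
      moreover have "s powr (\<alpha> - 1) \<ge> (?n + 1) powr (\<alpha> - 1)" using s s1 \<alpha> by (intro powr_mono2') auto
      moreover have "(?n + 1) powr (\<alpha> - 1) \<ge> (?n + 1) powr (- 1)" using \<alpha> by (intro powr_mono) auto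
      moreover have "(?n + 1) powr (- 1) = 1 / (?n + 1)" by (simp add: powr_minus_divide)
      ultimately show ?thesis by simp
    qed
    then have "(1 / (?n + 1)) * (c0 / 2) \<le> (\<phi> (a - b) / s) * (c0 - 4 * \<alpha> * ?C1 - 3/2 * \<alpha> * A)"
      using small c0 \<phi>[of "a - b"] s by (intro mult_mono) auto
    then have "L * ((1 / (?n + 1)) * (c0 / 2)) \<le> L * ((\<phi> (a - b) / s) * (c0 - 4 * \<alpha> * ?C1 - 3/2 * \<alpha> * A))"
      using L by (intro mult_left_mono) auto
    with main have "L * ((1 / (?n + 1)) * (c0 / 2)) \<le> F" by simp
    then have LF: "L * 2 \<le> C * F" unfolding C_def using c0 by (simp add: field_simps)
    show False using LF L L'(1) by linarith
  qed
  then show ?thesis using \<alpha> C by blast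
qed

subsection \<open>A monotone difference scheme\<close>

text \<open>Stated through increments at possibly different base points, so that it covers the
  difference of two functions at one point as well as the difference of one function at y + k and
  y.\<close>

lemma truncated_jump_integral_diff:
  fixes u u' d :: "real^'n \<Rightarrow> real"
  assumes "continuous_on UNIV u" "continuous_on UNIV u'" "\<And>x. \<bar>u x\<bar> \<le> B" "\<And>x. \<bar>u' x\<bar> \<le> B'" "0 < h"
    "\<And>z. d (y + z) - d y = (u (x + z) - u x) - (u' (x' + z) - u' x')"
  shows "truncated_jump_integral h d y = truncated_jump_integral h u x - truncated_jump_integral h u' x'"
proof -
  have b: "\<bar>second_diff f x z\<bar> \<le> 4 * C" if "\<And>x. \<bar>f x\<bar> \<le> C" for f :: "real^'n \<Rightarrow> real" and x z C
    using that[of "x + z"] that[of "x - z"] that[of x] unfolding second_diff_def by (simp add: abs_le_iff)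
  have "second_diff d y z = second_diff u x z - second_diff u' x' z" for z
    using assms(6)[of z] assms(6)[of "- z"] by (simp add: second_diff_def)
  then have "truncated_jump_integral h d y = (LINT z|lborel.
      second_diff u x z * indicat_real {z. h < norm z} z * jump_kernel z - second_diff u' x' z * indicat_real {z. h < norm z} z * jump_kernel z)"
    unfolding truncated_jump_integral_def by (simp add: left_diff_distrib)
  also have "\<dots> = truncated_jump_integral h u x - truncated_jump_integral h u' x'"
    unfolding truncated_jump_integral_def
    using truncated_kernel_integrable[OF second_diff_measurable[OF assms(1)] b[OF assms(3)] assms(5)]
      truncated_kernel_integrable[OF second_diff_measurable[OF assms(2)] b[OF assms(4)] assms(5)]
    by (rule Bochner_Integration.integral_diff)
  finally show ?thesis .
qed

lemma truncated_jump_integral_nonpos: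
  fixes u :: "real^'n \<Rightarrow> real"
  assumes "\<And>x. u x \<le> u y" shows "truncated_jump_integral h u y \<le> 0"
proof -
  have "0 \<le> (LINT z|lborel. - (second_diff u y z * indicat_real {z. h < norm z} z * jump_kernel z))"
  proof (rule integral_nonneg_AE, rule AE_I2)
  fix z :: "real^'n"
  have "second_diff u y z \<le> 0" using assms[of "y + z"] assms[of "y - z"] by (simp add: second_diff_def)
  then have "second_diff u y z * (indicat_real {z. h < norm z} z * jump_kernel z) \<le> 0"
    by (intro mult_nonpos_nonneg) auto
  then show "0 \<le> - (second_diff u y z * indicat_real {z. h < norm z} z * jump_kernel z)"
    by (simp add: mult.assoc)
  qed
  then show ?thesis by (simp add: truncated_jump_integral_def)
qed

lemma truncated_jump_integral_continuous:
  fixes u :: "real^'n \<Rightarrow> real"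
  assumes "continuous_on UNIV u" "\<And>x. \<bar>u x\<bar> \<le> B" "0 < h"
  shows "continuous_on UNIV (truncated_jump_integral h u)"
  unfolding truncated_jump_integral_def [abs_def]
proof (rule continuous_on_sequentiallyI)
  have [measurable]: "second_diff u x \<in> borel_measurable borel" for x by (rule second_diff_measurable[OF assms(1)])
  fix X and a :: "real^'n" assume X: "X \<longlonglongrightarrow> a"
  show "(\<lambda>n. LINT z|lborel. second_diff u (X n) z * indicat_real {z. h < norm z} z * jump_kernel z)
     \<longlonglongrightarrow> (LINT z|lborel. second_diff u a z * indicat_real {z. h < norm z} z * jump_kernel z)"
  proof (rule integral_dominated_convergence)
    show "integrable lborel (\<lambda>z. (4 * B) * indicat_real {z. h < norm z} z * jump_kernel z)"
      by (rule truncated_kernel_integrable[OF _ _ assms(3), where B = "\<bar>4 * B\<bar>"]) auto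
    show "AE z in lborel. (\<lambda>n. second_diff u (X n) z * indicat_real {z. h < norm z} z * jump_kernel z)
       \<longlonglongrightarrow> second_diff u a z * indicat_real {z. h < norm z} z * jump_kernel z"
    proof (rule AE_I2)
      fix z
      have "(\<lambda>n. u (X n + c)) \<longlonglongrightarrow> u (a + c)" for c
        by (rule continuous_on_tendsto_compose[OF assms(1)]) (auto intro!: tendsto_intros X)
      from this[of z] this[of "- z"] this[of 0]
      have "(\<lambda>n. second_diff u (X n) z) \<longlonglongrightarrow> second_diff u a z"
        unfolding second_diff_def by (intro tendsto_intros) auto
      then show "(\<lambda>n. second_diff u (X n) z * indicat_real {z. h < norm z} z * jump_kernel z)
       \<longlonglongrightarrow> second_diff u a z * indicat_real {z. h < norm z} z * jump_kernel z"
        by (intro tendsto_intros)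
    qed
    show "AE z in lborel. norm (second_diff u (X n) z * indicat_real {z. h < norm z} z * jump_kernel z)
       \<le> 4 * B * indicat_real {z. h < norm z} z * jump_kernel z" for n
    proof (rule AE_I2)
      fix z
      have "\<bar>second_diff u (X n) z\<bar> \<le> 4 * B"
        using assms(2)[of "X n + z"] assms(2)[of "X n - z"] assms(2)[of "X n"] unfolding second_diff_def by (simp add: abs_le_iff)
      then show "norm (second_diff u (X n) z * indicat_real {z. h < norm z} z * jump_kernel z)
       \<le> 4 * B * indicat_real {z. h < norm z} z * jump_kernel z"
        unfolding norm_mult by (intro mult_mono) auto
    qed
  qed measurable
qed

text \<open>The weight w is the factor of the unknown constant in the divided equation, that is 1/a,
  and G is its first-order part; here G is Lipschitz in both variables with a constant that does not
  grow with the gradient.\<close>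

locale lipschitz_cell_data =
  fixes \<kappa> L w0 w1 G0 :: real and w :: "real^'n \<Rightarrow> real" and G :: "real^'n \<Rightarrow> real^'n \<Rightarrow> real"
  assumes \<kappa>: "0 < \<kappa>" and L: "0 < L" and w0: "0 < w0"
    and w_bounds: "\<And>y. w0 \<le> w y" "\<And>y. w y \<le> w1"
    and w_lipschitz: "\<And>y y'. \<bar>w y - w y'\<bar> \<le> L * norm (y - y')"
    and w_periodic: "zn_periodic w"
    and G_periodic: "\<And>q. zn_periodic (\<lambda>y. G y q)"
    and G_zero: "\<And>y. \<bar>G y 0\<bar> \<le> G0"
    and G_lipschitz: "\<And>y y' q q'. \<bar>G y q - G y' q'\<bar> \<le> L * norm (y - y') + L * norm (q - q')"
begin

definition central_grad :: "real \<Rightarrow> (real^'n \<Rightarrow> real) \<Rightarrow> real^'n \<Rightarrow> real^'n" where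
  "central_grad h u y = (\<chi> i. (u (y + h *\<^sub>R axis i 1) - u (y - h *\<^sub>R axis i 1)) / (2 * h))"

text \<open>Equal to -L h times the discrete Laplacian: the coefficient \<open>L / h\<close> is
  large enough to dominate the central differences of G, yet the term vanishes in the limit for
  C^(1,\<alpha>) regularity.\<close>

definition viscosity :: "real \<Rightarrow> (real^'n \<Rightarrow> real) \<Rightarrow> real^'n \<Rightarrow> real" where
  "viscosity h u y = (\<Sum>i\<in>UNIV. L / h * (2 * u y - u (y + h *\<^sub>R axis i 1) - u (y - h *\<^sub>R axis i 1)))"

text \<open>The discount term with small l makes the problem strictly monotone. It carries the
  weight w so that, when l u tends to a constant, what remains is a constant multiple of w, as the
  cell problem requires.\<close>

definition scheme :: "real \<Rightarrow> real \<Rightarrow> (real^'n \<Rightarrow> real) \<Rightarrow> real^'n \<Rightarrow> real" where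
  "scheme h l u y = l * w y * u y - \<kappa> / 2 * truncated_jump_integral h u y
     + viscosity h u y + G y (central_grad h u y)"

text \<open>The increment of G is distributed over the coordinates in proportion to |q_i - q'_i|;
  the Euclidean distance is at most the sum of these, which bounds each coefficient by L. For q = q'
  all coefficients are 0 by the convention for division by zero.\<close>

lemma G_linearized:
  "\<exists>B. (\<forall>i. \<bar>B i\<bar> \<le> L) \<and> G y q - G y q' = (\<Sum>i\<in>UNIV. B i * (q $ i - q' $ i))"
proof -
  define S where "S = (\<Sum>i\<in>UNIV. \<bar>q $ i - q' $ i\<bar>)"
  define B where "B i = (G y q - G y q') / S * sgn (q $ i - q' $ i)" for i
  have "norm (q - q') \<le> S" unfolding S_def using norm_le_l1_cart[of "q - q'"] by simp
  then have le: "\<bar>G y q - G y q'\<bar> \<le> L * S"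
    using G_lipschitz[of y q y q'] mult_left_mono[of "norm (q - q')" S L] L
    by (simp, linarith)
  have S0: "0 \<le> S" unfolding S_def by (intro sum_nonneg) auto
  have "\<bar>B i\<bar> \<le> L" for i
  proof (cases "S = 0")
    case False
    then have "S > 0" using S0 by simp
    then have "\<bar>(G y q - G y q') / S\<bar> \<le> L" using le by (simp add: field_simps)
    moreover have "\<bar>sgn (q $ i - q' $ i)\<bar> \<le> 1" by (simp add: sgn_real_def)
    ultimately have "\<bar>(G y q - G y q') / S\<bar> * \<bar>sgn (q $ i - q' $ i)\<bar> \<le> L * 1"
      using L by (intro mult_mono) auto
    then show ?thesis by (simp add: B_def abs_mult)
  qed (use L in \<open>simp add: B_def\<close>)
  moreover have "G y q - G y q' = (\<Sum>i\<in>UNIV. B i * (q $ i - q' $ i))"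
  proof -
    have "(\<Sum>i\<in>UNIV. B i * (q $ i - q' $ i)) = (\<Sum>i\<in>UNIV. (G y q - G y q') / S * \<bar>q $ i - q' $ i\<bar>)"
      by (intro sum.cong refl) (simp add: B_def abs_sgn mult_ac)
    also have "\<dots> = (G y q - G y q') / S * S" by (simp add: S_def sum_distrib_left)
    also have "\<dots> = G y q - G y q'" using le by (cases "S = 0") auto
    finally show ?thesis ..
  qed
  ultimately show ?thesis by blast
qed

text \<open>Differences of the first-order part are combinations of one-sided differences with coefficients
  of one sign; this is where the artificial viscosity is needed.\<close>

lemma scheme_first_order_difference:
  assumes h: "0 < h" and d: "\<And>x. d x = u x - u' x"
  shows "\<exists>cp cm. (\<forall>i. 0 \<le> cp i \<and> 0 \<le> cm i \<and> cp i + cm i = 2 * L / h) \<and>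
    viscosity h u y + G z (central_grad h u y) - (viscosity h u' y + G z (central_grad h u' y))
    = (\<Sum>i\<in>UNIV. cp i * (d y - d (y + h *\<^sub>R axis i 1)) + cm i * (d y - d (y - h *\<^sub>R axis i 1)))"
proof -
  obtain B where B: "\<And>i. \<bar>B i\<bar> \<le> L"
    "G z (central_grad h u y) - G z (central_grad h u' y)
     = (\<Sum>i\<in>UNIV. B i * (central_grad h u y $ i - central_grad h u' y $ i))"
    using G_linearized[of z "central_grad h u y" "central_grad h u' y"] by blast
  define cp where "cp i = L / h - B i / (2 * h)" for i
  define cm where "cm i = L / h + B i / (2 * h)" for i
  have "0 \<le> cp i \<and> 0 \<le> cm i \<and> cp i + cm i = 2 * L / h" for i
  proof -
    have "\<bar>B i\<bar> \<le> 2 * L" using B(1)[of i] L by linarith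
    then have "B i / (2 * h) \<le> L / h" "- (B i / (2 * h)) \<le> L / h" using h by (auto simp: field_simps)
    then show ?thesis unfolding cp_def cm_def by simp
  qed
  moreover have "viscosity h u y + G z (central_grad h u y) - (viscosity h u' y + G z (central_grad h u' y))
    = (\<Sum>i\<in>UNIV. cp i * (d y - d (y + h *\<^sub>R axis i 1)) + cm i * (d y - d (y - h *\<^sub>R axis i 1)))"
  proof -
    have "viscosity h u y + G z (central_grad h u y) - (viscosity h u' y + G z (central_grad h u' y))
      = viscosity h u y - viscosity h u' y + (G z (central_grad h u y) - G z (central_grad h u' y))" by simp
    also have "\<dots> = (\<Sum>i\<in>UNIV. L / h * (2 * u y - u (y + h *\<^sub>R axis i 1) - u (y - h *\<^sub>R axis i 1))
         - L / h * (2 * u' y - u' (y + h *\<^sub>R axis i 1) - u' (y - h *\<^sub>R axis i 1))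
         + B i * (central_grad h u y $ i - central_grad h u' y $ i))"
      unfolding B(2) viscosity_def by (simp add: sum.distrib sum_subtractf)
    also have "\<dots> = (\<Sum>i\<in>UNIV. cp i * (d y - d (y + h *\<^sub>R axis i 1)) + cm i * (d y - d (y - h *\<^sub>R axis i 1)))"
      using h by (intro sum.cong refl) (simp add: cp_def cm_def d central_grad_def field_simps)
    finally show ?thesis .
  qed
  ultimately show ?thesis by blast
qed

lemma w_continuous: "continuous_on UNIV w"
  by (rule lipschitz_on_continuous_on[of L])
     (use w_lipschitz L in \<open>auto simp: lipschitz_on_def dist_norm\<close>)

lemma G_continuous_compose:
  fixes g :: "'z \<Rightarrow> real^'n"
  assumes "(X \<longlongrightarrow> a) F" "(g \<longlongrightarrow> b) F"
  shows "((\<lambda>n. G (X n) (g n)) \<longlongrightarrow> G a b) F"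
proof (rule Lim_null[THEN iffD2], rule Lim_null_comparison)
  show "\<forall>\<^sub>F n in F. norm (G (X n) (g n) - G a b) \<le> L * norm (X n - a) + L * norm (g n - b)"
    using G_lipschitz by (auto intro!: always_eventually)
  show "((\<lambda>n. L * norm (X n - a) + L * norm (g n - b)) \<longlongrightarrow> 0) F"
    using tendsto_norm_zero[OF Lim_null[THEN iffD1, OF assms(1)]] tendsto_norm_zero[OF Lim_null[THEN iffD1, OF assms(2)]]
    by (auto intro!: tendsto_add_zero tendsto_mult_right_zero)
qed

lemma scheme_continuous:
  assumes u: "continuous_on UNIV u" "\<And>x. \<bar>u x\<bar> \<le> B" and h: "0 < h"
  shows "continuous_on UNIV (scheme h l u)"
proof -
  have tr: "continuous_on UNIV (\<lambda>y. u (y + c))" "continuous_on UNIV (\<lambda>y. u (y - c))" for c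
    using continuous_on_translate(3)[OF u(1), of c] continuous_on_translate(3)[OF u(1), of "- c"] by simp_all
  have "continuous_on UNIV (central_grad h u)"
    unfolding central_grad_def [abs_def] using h by (intro continuous_intros tr) auto
  then have "continuous_on UNIV (\<lambda>y. G y (central_grad h u y))"
    unfolding continuous_on_def by (intro ballI G_continuous_compose) (auto intro: tendsto_ident_at)
  then show ?thesis
    unfolding scheme_def [abs_def] viscosity_def [abs_def]
    by (intro continuous_intros w_continuous u tr truncated_jump_integral_continuous[OF u h])
qed

lemma scheme_difference:
  assumes u: "continuous_on UNIV u" "\<And>x. \<bar>u x\<bar> \<le> B"
    and u': "continuous_on UNIV u'" "\<And>x. \<bar>u' x\<bar> \<le> B'" and h: "0 < h"
  shows "\<exists>cp cm. (\<forall>i. 0 \<le> cp i \<and> 0 \<le> cm i \<and> cp i + cm i = 2 * L / h) \<and>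
    scheme h l u y - scheme h l u' y = l * w y * (u y - u' y)
      - \<kappa> / 2 * truncated_jump_integral h (\<lambda>x. u x - u' x) y
      + (\<Sum>i\<in>UNIV. cp i * ((u y - u' y) - (u (y + h *\<^sub>R axis i 1) - u' (y + h *\<^sub>R axis i 1)))
           + cm i * ((u y - u' y) - (u (y - h *\<^sub>R axis i 1) - u' (y - h *\<^sub>R axis i 1))))"
proof -
  have J: "truncated_jump_integral h (\<lambda>x. u x - u' x) y = truncated_jump_integral h u y - truncated_jump_integral h u' y"
    by (rule truncated_jump_integral_diff[OF u(1) u'(1) u(2) u'(2) h]) simp
  obtain cp cm where c: "\<forall>i. 0 \<le> cp i \<and> 0 \<le> cm i \<and> cp i + cm i = 2 * L / h"
    and eq: "viscosity h u y + G y (central_grad h u y) - (viscosity h u' y + G y (central_grad h u' y))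
    = (\<Sum>i\<in>UNIV. cp i * ((u y - u' y) - (u (y + h *\<^sub>R axis i 1) - u' (y + h *\<^sub>R axis i 1)))
           + cm i * ((u y - u' y) - (u (y - h *\<^sub>R axis i 1) - u' (y - h *\<^sub>R axis i 1))))"
    using scheme_first_order_difference[OF h, of "\<lambda>x. u x - u' x" u u' y y] by blast
  show ?thesis
    by (rule exI[of _ cp], rule exI[of _ cm], rule conjI[OF c])
       (unfold J eq[symmetric] scheme_def, simp add: algebra_simps)
qed

text \<open>Under the step size condition, the difference after one explicit step combines values of
  the old difference at y, at the jump targets and at the mesh neighbours with coefficients whose
  absolute values sum to at most 1 - \<tau> l w(y). Only the discount makes this sum less than
  1.\<close>

lemma scheme_step_contraction:
  assumes u: "continuous_on UNIV u" "\<And>x. \<bar>u x\<bar> \<le> B"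
    and u': "continuous_on UNIV u'" "\<And>x. \<bar>u' x\<bar> \<le> B'" and h: "0 < h" and l: "0 < l"
    and D: "\<And>x. \<bar>u x - u' x\<bar> \<le> D"
    and \<tau>: "0 < \<tau>" "\<tau> * (l * w1 + \<kappa> * (LINT z|lborel. indicat_real {z. h < norm z} z * jump_kernel (z::real^'n)) + real CARD('n) * (2 * L / h)) \<le> 1"
  shows "\<bar>(u y - \<tau> * scheme h l u y) - (u' y - \<tau> * scheme h l u' y)\<bar> \<le> (1 - \<tau> * l * w0) * D"
proof -
  define m where "m = (LINT z|lborel. indicat_real {z. h < norm z} z * jump_kernel (z::real^'n))"
  define d where "d x = u x - u' x" for x
  have d: "\<bar>d x\<bar> \<le> D" for x using D by (simp add: d_def)
  have D0: "0 \<le> D" using d[of 0] by linarith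
  have cd: "continuous_on UNIV d" unfolding d_def using u u' by (intro continuous_intros)
  obtain cp cm where c: "\<And>i. 0 \<le> cp i \<and> 0 \<le> cm i \<and> cp i + cm i = 2 * L / h"
    and eq: "scheme h l u y - scheme h l u' y = l * w y * d y - \<kappa> / 2 * truncated_jump_integral h d y
      + (\<Sum>i\<in>UNIV. cp i * (d y - d (y + h *\<^sub>R axis i 1)) + cm i * (d y - d (y - h *\<^sub>R axis i 1)))"
    using scheme_difference[OF u u' h, of l y] unfolding d_def by blast
  let ?k = "\<lambda>z::real^'n. indicat_real {z. h < norm z} z * jump_kernel z"
  have int: "integrable lborel ?k"
    using truncated_kernel_integrable[of "\<lambda>z::real^'n. 1" 1 h] h by simp
  define I where "I = (LINT z|lborel. (d (y + z) + d (y - z)) * indicat_real {z. h < norm z} z * jump_kernel z)"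
  have meas [measurable]: "(\<lambda>z. d (y + z) + d (y - z)) \<in> borel_measurable borel"
    by (rule borel_measurable_continuous_onI) (intro continuous_intros continuous_on_translate[OF cd])
  have bd: "\<bar>d (y + z) + d (y - z)\<bar> \<le> 2 * D" for z using d[of "y + z"] d[of "y - z"] by linarith
  have intI: "integrable lborel (\<lambda>z. (d (y + z) + d (y - z)) * indicat_real {z. h < norm z} z * jump_kernel z)"
    by (rule truncated_kernel_integrable[OF meas bd h])
  have J: "truncated_jump_integral h d y = I - 2 * d y * m"
  proof -
    have "truncated_jump_integral h d y = (LINT z|lborel. (d (y + z) + d (y - z)) * indicat_real {z. h < norm z} z * jump_kernel z - 2 * d y * ?k z)"
      unfolding truncated_jump_integral_def second_diff_def by (simp add: algebra_simps)
    also have "\<dots> = I - 2 * d y * m"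
      unfolding I_def m_def using intI int by (subst Bochner_Integration.integral_diff) auto
    finally show ?thesis .
  qed
  have I: "\<bar>I\<bar> \<le> 2 * D * m"
  proof -
    have "norm I \<le> (LINT z|lborel. 2 * D * ?k z)"
      unfolding I_def
    proof (rule Bochner_Integration.integral_norm_bound_integral)
      show "integrable lborel (\<lambda>z. 2 * D * ?k z)" using int by simp
      show "norm ((d (y + z) + d (y - z)) * indicat_real {z. h < norm z} z * jump_kernel z) \<le> 2 * D * ?k z" for z
        using bd[of z] unfolding norm_mult mult.assoc[of _ "_::real" "jump_kernel z"]
        by (simp add: mult.assoc[symmetric]) (intro mult_right_mono; simp)
    qed (rule intI)
    then show ?thesis unfolding m_def using int by simp
  qed
  let ?N = "real CARD('n)"
  define Q where "Q = (\<Sum>i\<in>UNIV. cp i * d (y + h *\<^sub>R axis i 1) + cm i * d (y - h *\<^sub>R axis i 1))"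
  have Q: "\<bar>Q\<bar> \<le> ?N * (2 * L / h) * D"
  proof -
    have "\<bar>Q\<bar> \<le> (\<Sum>i\<in>(UNIV::'n set). 2 * L / h * D)"
      unfolding Q_def
    proof (rule order_trans[OF sum_abs], rule sum_mono)
      fix i :: 'n
      have "\<bar>cp i * d (y + h *\<^sub>R axis i 1) + cm i * d (y - h *\<^sub>R axis i 1)\<bar>
          \<le> cp i * \<bar>d (y + h *\<^sub>R axis i 1)\<bar> + cm i * \<bar>d (y - h *\<^sub>R axis i 1)\<bar>"
        using c[of i] by (simp add: abs_mult order_trans[OF abs_triangle_ineq])
      also have "\<dots> \<le> cp i * D + cm i * D" using c[of i] d by (intro add_mono mult_left_mono) auto
      also have "\<dots> = 2 * L / h * D" using c[of i] by (simp add: distrib_right[symmetric])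
      finally show "\<bar>cp i * d (y + h *\<^sub>R axis i 1) + cm i * d (y - h *\<^sub>R axis i 1)\<bar> \<le> 2 * L / h * D" .
    qed
    then show ?thesis by simp
  qed
  have sumeq: "(\<Sum>i\<in>UNIV. cp i * (d y - d (y + h *\<^sub>R axis i 1)) + cm i * (d y - d (y - h *\<^sub>R axis i 1)))
      = ?N * (2 * L / h) * d y - Q"
  proof -
    have "(\<Sum>i\<in>UNIV. cp i * (d y - d (y + h *\<^sub>R axis i 1)) + cm i * (d y - d (y - h *\<^sub>R axis i 1)))
       = (\<Sum>i\<in>UNIV. (cp i + cm i) * d y) - Q"
      unfolding Q_def by (subst sum_subtractf[symmetric]) (intro sum.cong refl, simp add: algebra_simps)
    then show ?thesis using c by simp
  qed
  define c0 where "c0 = 1 - \<tau> * (l * w y) - \<tau> * \<kappa> * m - \<tau> * (?N * (2 * L / h))"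
  have "\<tau> * (l * w y) \<le> \<tau> * (l * w1)" using \<tau> l w_bounds by (intro mult_left_mono) auto
  then have c0: "0 \<le> c0" using \<tau>(2) unfolding c0_def m_def by (simp add: distrib_left)
  have "(u y - \<tau> * scheme h l u y) - (u' y - \<tau> * scheme h l u' y) = d y - \<tau> * (scheme h l u y - scheme h l u' y)"
    by (simp add: d_def algebra_simps)
  also have "\<dots> = c0 * d y + \<tau> * \<kappa> / 2 * I + \<tau> * Q"
    unfolding eq sumeq J c0_def by (simp add: algebra_simps)
  also have "\<bar>\<dots>\<bar> \<le> c0 * \<bar>d y\<bar> + \<tau> * \<kappa> / 2 * \<bar>I\<bar> + \<tau> * \<bar>Q\<bar>"
    using c0 \<tau> \<kappa> by (auto simp: abs_mult intro!: order_trans[OF abs_triangle_ineq] add_mono)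
  also have "\<dots> \<le> c0 * D + \<tau> * \<kappa> / 2 * (2 * D * m) + \<tau> * (?N * (2 * L / h) * D)"
    using c0 \<tau> \<kappa> I Q d by (intro add_mono mult_left_mono) auto
  also have "\<dots> = (1 - \<tau> * (l * w y)) * D"
    unfolding c0_def by (simp add: algebra_simps)
  also have "\<dots> \<le> (1 - \<tau> * (l * w0)) * D"
    using \<tau> l w_bounds D0 by (intro mult_right_mono diff_left_mono mult_left_mono) auto
  finally show ?thesis by (simp add: mult.assoc)
qed

lemma scheme_translate:
  assumes k: "\<forall>i. k $ i \<in> \<int>"
  shows "scheme h l (\<lambda>x. u (x + k)) y = scheme h l u (y + k)"
proof -
  have "w (y + k) = w y" "\<And>q. G (y + k) q = G y q"
    using w_periodic G_periodic k unfolding zn_periodic_def by auto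
  moreover have "central_grad h (\<lambda>x. u (x + k)) y = central_grad h u (y + k)"
    by (simp add: central_grad_def algebra_simps)
  moreover have "viscosity h (\<lambda>x. u (x + k)) y = viscosity h u (y + k)"
    by (simp add: viscosity_def algebra_simps)
  moreover have "truncated_jump_integral h (\<lambda>x. u (x + k)) y = truncated_jump_integral h u (y + k)"
    by (simp add: truncated_jump_integral_def second_diff_def algebra_simps)
  ultimately show ?thesis by (simp add: scheme_def)
qed

text \<open>A zero of the scheme is a fixed point of the explicit step, which contracts the space of
  bounded continuous functions on the whole space. Periodicity is not built into that space: integer
  translates of the fixed point are fixed points too, hence equal to it.\<close>

lemma scheme_solvable:
  assumes h: "0 < h" and l: "0 < l"
  shows "\<exists>u. continuous_on UNIV u \<and> zn_periodic u \<and> (\<forall>y. scheme h l u y = 0)"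
proof -
  define m where "m = (LINT z|lborel. indicat_real {z. h < norm z} z * jump_kernel (z::real^'n))"
  have m: "0 \<le> m" unfolding m_def by (rule integral_nonneg_AE) simp
  have w1: "w0 \<le> w1" using w_bounds[of 0] by linarith
  define Z where "Z = l * w1 + \<kappa> * m + real CARD('n) * (2 * L / h)"
  have Z: "0 < Z" "l * w0 \<le> Z" unfolding Z_def using m w1 w0 l \<kappa> L h by (auto simp: add_nonneg_pos add_increasing2)
  define \<tau> where "\<tau> = 1 / Z"
  have \<tau>: "0 < \<tau>" "\<tau> * Z \<le> 1" "0 < \<tau> * l * w0" "\<tau> * l * w0 \<le> 1"
    using Z l w0 by (auto simp: \<tau>_def field_simps)
  note contr = scheme_step_contraction[where h = h and l = l and \<tau> = \<tau>, OF _ _ _ _ h l _ \<tau>(1) \<tau>(2)[unfolded Z_def m_def]]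
  define T0 where "T0 u y = u y - \<tau> * scheme h l u y" for u y
  have T0: "T0 f \<in> bcontfun" if f: "continuous_on UNIV f" "\<And>x. \<bar>f x\<bar> \<le> B" for f B
  proof -
    have "continuous_on UNIV (T0 f)" unfolding T0_def [abs_def]
      by (intro continuous_intros f scheme_continuous[OF f h])
    moreover have "\<bar>T0 f y\<bar> \<le> (1 - \<tau> * l * w0) * B + \<tau> * G0" for y
    proof -
      have "truncated_jump_integral h (\<lambda>x::real^'n. 0) y = 0" by (simp add: truncated_jump_integral_def second_diff_def)
      moreover have "central_grad h (\<lambda>x::real^'n. 0) y = 0" by (simp add: central_grad_def vec_eq_iff)
      ultimately have 0: "T0 (\<lambda>x. 0) y = - \<tau> * G y 0" by (simp add: T0_def scheme_def viscosity_def)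
      have "\<bar>T0 f y - T0 (\<lambda>x. 0) y\<bar> \<le> (1 - \<tau> * l * w0) * B"
        unfolding T0_def by (rule contr[OF f, of _ 0]) (use f in auto)
      moreover have "\<bar>\<tau> * G y 0\<bar> \<le> \<tau> * G0" using \<tau> G_zero[of y] by (simp add: abs_mult)
      ultimately show ?thesis unfolding 0 by (simp add: abs_le_iff)
    qed
    then have "bounded (range (T0 f))" by (auto simp: bounded_iff)
    ultimately show ?thesis by (simp add: bcontfun_def)
  qed
  have bd: "\<exists>B. \<forall>x. \<bar>apply_bcontfun f x\<bar> \<le> B" for f :: "(real^'n) \<Rightarrow>\<^sub>C real"
    using bounded_apply_bcontfun[of f] by (auto simp: bounded_iff)
  define T where "T f = Bcontfun (T0 (apply_bcontfun f))" for f :: "(real^'n) \<Rightarrow>\<^sub>C real"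
  have T: "apply_bcontfun (T f) = T0 (apply_bcontfun f)" for f
  proof -
    obtain B where "\<forall>x. \<bar>apply_bcontfun f x\<bar> \<le> B" using bd by blast
    then show ?thesis unfolding T_def by (intro Bcontfun_inverse T0[of _ B]) auto
  qed
  have "\<exists>!f. T f = f"
  proof (rule banach_fix_type)
    show "0 \<le> 1 - \<tau> * l * w0" "1 - \<tau> * l * w0 < 1" using \<tau> by auto
    show "\<forall>f g. dist (T f) (T g) \<le> (1 - \<tau> * l * w0) * dist f g"
    proof (intro allI dist_bound)
      fix f g :: "(real^'n) \<Rightarrow>\<^sub>C real" and y
      obtain B B' where "\<forall>x. \<bar>apply_bcontfun f x\<bar> \<le> B" "\<forall>x. \<bar>apply_bcontfun g x\<bar> \<le> B'" using bd by metis
      then show "dist (T f y) (T g y) \<le> (1 - \<tau> * l * w0) * dist f g"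
        unfolding T T0_def dist_real_def
        by (intro contr[of _ B _ B']) (use dist_bounded[of f _ g] in \<open>auto simp: dist_real_def\<close>)
    qed
  qed
  then obtain f where f: "T f = f" "\<And>g. T g = g \<Longrightarrow> g = f" by blast
  let ?u = "apply_bcontfun f"
  have "T0 ?u = ?u" using f(1) T by metis
  then have sol: "scheme h l ?u y = 0" for y using \<tau>(1) by (simp add: T0_def fun_eq_iff)
  have "?u (y + k) = ?u y" if k: "\<forall>i. k $ i \<in> \<int>" for y k
  proof -
    have gb: "(\<lambda>x. ?u (x + k)) \<in> bcontfun"
    proof -
      obtain B where "\<forall>x. \<bar>?u x\<bar> \<le> B" using bd by blast
      then show ?thesis unfolding bcontfun_def
        by (auto intro!: continuous_on_translate simp: bounded_iff)
    qed
    define g where "g = Bcontfun (\<lambda>x. ?u (x + k))"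
    have g: "apply_bcontfun g = (\<lambda>x. ?u (x + k))" unfolding g_def by (rule Bcontfun_inverse[OF gb])
    have "T g = g"
      by (rule bcontfun_eqI) (simp add: T T0_def g scheme_translate[OF k] sol)
    then have "g = f" by (rule f(2))
    then show ?thesis using g by metis
  qed
  then show ?thesis using sol by (intro exI[of _ ?u]) (auto simp: zn_periodic_def)
qed

end

section \<open>Bounds uniform in mesh size and discount\<close>

lemma zn_periodic_nearby:
  fixes v :: "real^'n \<Rightarrow> real"
  assumes "zn_periodic v"
  obtains y' where "v y' = v y" "norm (x - y') \<le> real CARD('n)"
proof -
  obtain k where k: "\<forall>i. k $ i \<in> \<int>" "x - y + k \<in> cbox 0 1" by (rule zn_periodic_representative)
  have "\<forall>i. (- k) $ i \<in> \<int>" using k(1) by simp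
  then have "v (y + (- k)) = v y" using assms unfolding zn_periodic_def by blast
  moreover have "norm (x - (y + - k)) \<le> real CARD('n)" using norm_unit_cube_le[OF k(2)] by (simp add: algebra_simps)
  ultimately show thesis by (rule that)
qed

context lipschitz_cell_data
begin

text \<open>Comparison with the zero function: at a maximum or minimum of u all jump and difference
  terms have a favourable sign, so only the discount term and G at zero gradient remain. The
  estimate is for l u, which is what stays bounded as l tends to 0.\<close>

lemma scheme_solution_bound:
  assumes u: "continuous_on UNIV u" "zn_periodic u" and sol: "\<And>y. scheme h l u y = 0"
    and h: "0 < h" and l: "0 < l"
  shows "\<bar>l * u y\<bar> \<le> G0 / w0"
proof -
  obtain B where B: "\<And>y. \<bar>u y\<bar> \<le> B" using zn_periodic_bounded[OF u(2,1)] by auto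
  have zero: "scheme h l (\<lambda>x. 0) y = G y 0" for y
  proof -
    have "truncated_jump_integral h (\<lambda>x::real^'n. 0) y = 0" by (simp add: truncated_jump_integral_def second_diff_def)
    moreover have "central_grad h (\<lambda>x::real^'n. 0) y = 0" by (simp add: central_grad_def vec_eq_iff)
    ultimately show ?thesis by (simp add: scheme_def viscosity_def)
  qed
  have G0: "0 \<le> G0" using G_zero[of 0] by linarith
  have scale: "l * x \<le> G0 / w0" if "l * w y * x \<le> G0" for x y
  proof (cases "x \<le> 0")
    case True
    then have "l * x \<le> 0" using l by (simp add: mult_nonneg_nonpos)
    then show ?thesis using G0 w0 by (smt (verit) divide_nonneg_nonneg)
  next
    case False
    then have "w0 * (l * x) \<le> w y * (l * x)" using l w_bounds by (intro mult_right_mono) auto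
    then have "w0 * (l * x) \<le> G0" using that by (simp add: ac_simps)
    then show ?thesis using w0 by (simp add: field_simps)
  qed
  have diff: "\<exists>cp cm. (\<forall>i. 0 \<le> cp i \<and> 0 \<le> cm i) \<and>
     - G y 0 = l * w y * u y - \<kappa> / 2 * truncated_jump_integral h u y
      + (\<Sum>i\<in>UNIV. cp i * (u y - u (y + h *\<^sub>R axis i 1)) + cm i * (u y - u (y - h *\<^sub>R axis i 1)))" for y
  proof -
    obtain cp cm where "\<forall>i. 0 \<le> cp i \<and> 0 \<le> cm i \<and> cp i + cm i = 2 * L / h"
      and "scheme h l u y - scheme h l (\<lambda>x. 0) y = l * w y * (u y - 0)
      - \<kappa> / 2 * truncated_jump_integral h (\<lambda>x. u x - 0) y
      + (\<Sum>i\<in>UNIV. cp i * ((u y - 0) - (u (y + h *\<^sub>R axis i 1) - 0))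
           + cm i * ((u y - 0) - (u (y - h *\<^sub>R axis i 1) - 0)))"
      using scheme_difference[OF u(1) B, of "\<lambda>x. 0" 0 h l y] h by auto
    then show ?thesis
      by - (rule exI[of _ cp], rule exI[of _ cm], simp add: zero sol)
  qed
  obtain a where a: "\<And>y. u y \<le> u a" using zn_periodic_attains_max[OF u(2,1)] by blast
  obtain b where b: "\<And>y. u b \<le> u y" using zn_periodic_attains_min[OF u(2,1)] by blast
  have up: "l * u a \<le> G0 / w0"
  proof -
    obtain cp cm where c: "\<And>i. 0 \<le> cp i \<and> 0 \<le> cm i"
     "- G a 0 = l * w a * u a - \<kappa> / 2 * truncated_jump_integral h u a
      + (\<Sum>i\<in>UNIV. cp i * (u a - u (a + h *\<^sub>R axis i 1)) + cm i * (u a - u (a - h *\<^sub>R axis i 1)))"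
      using diff[of a] by blast
    have "0 \<le> (\<Sum>i\<in>UNIV. cp i * (u a - u (a + h *\<^sub>R axis i 1)) + cm i * (u a - u (a - h *\<^sub>R axis i 1)))"
      using c(1) a by (intro sum_nonneg add_nonneg_nonneg mult_nonneg_nonneg) auto
    moreover have "\<kappa> / 2 * truncated_jump_integral h u a \<le> 0"
      using truncated_jump_integral_nonpos[of u a h] a \<kappa> by (intro mult_nonneg_nonpos) auto
    ultimately have "l * w a * u a \<le> G0" using c(2) G_zero[of a] by (simp add: abs_le_iff)
    then show ?thesis by (rule scale)
  qed
  have lo: "l * (- u b) \<le> G0 / w0"
  proof -
    obtain cp cm where c: "\<And>i. 0 \<le> cp i \<and> 0 \<le> cm i"
     "- G b 0 = l * w b * u b - \<kappa> / 2 * truncated_jump_integral h u b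
      + (\<Sum>i\<in>UNIV. cp i * (u b - u (b + h *\<^sub>R axis i 1)) + cm i * (u b - u (b - h *\<^sub>R axis i 1)))"
      using diff[of b] by blast
    have "(\<Sum>i\<in>UNIV. cp i * (u b - u (b + h *\<^sub>R axis i 1)) + cm i * (u b - u (b - h *\<^sub>R axis i 1))) \<le> 0"
      using c(1) b by (intro sum_nonpos add_nonpos_nonpos mult_nonneg_nonpos) auto
    moreover have "0 \<le> \<kappa> / 2 * truncated_jump_integral h u b"
      using truncated_jump_integral_nonpos[of "\<lambda>x. - u x" b h] b \<kappa>
      by (intro mult_nonneg_nonneg) (auto simp: truncated_jump_integral_uminus)
    ultimately have "l * w b * (- u b) \<le> G0" using c(2) G_zero[of b] by (simp add: abs_le_iff)
    then show ?thesis by (rule scale)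
  qed
  have "l * u y \<le> l * u a" "l * (- u y) \<le> l * (- u b)" using a b l by auto
  then show ?thesis using up lo by (simp add: abs_le_iff)
qed

text \<open>Subtracting the scheme at y from the scheme at y + k leaves a linear drift with total
  coefficient 2 L/h per direction, plus an error from the discount and from the shift of w and G in
  space. The latter is of order |k| because G is compared at the same gradient and because l u is
  already bounded. Increments at most S h in each direction turn the drift into 2 N L S, and
  division by \<kappa>/2 gives the constant.\<close>

lemma scheme_increment_one_sided:
  assumes u: "continuous_on UNIV u" "zn_periodic u" and sol: "\<And>y. scheme h l u y = 0"
    and h: "0 < h" and l: "0 < l"
    and V: "\<And>y. \<bar>u (y + k) - u y\<bar> \<le> V"
  defines "F \<equiv> 2 / \<kappa> * (l * w1 * V + (G0 / w0 + 1) * L * norm k)"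
  shows "one_sided_scheme h (4 * L * real CARD('n) / \<kappa>) F (\<lambda>y. u (y + k) - u y)"
    and "one_sided_scheme h (4 * L * real CARD('n) / \<kappa>) F (\<lambda>y. - (u (y + k) - u y))"
proof -
  let ?N = "real CARD('n)"
  obtain B where B: "\<And>y. \<bar>u y\<bar> \<le> B" using zn_periodic_bounded[OF u(2,1)] by auto
  define v where "v y = u (y + k) - u y" for y
  have V0: "0 \<le> V" using V[of 0] by linarith
  have eq: "\<exists>cp cm e. (\<forall>i. 0 \<le> cp i \<and> 0 \<le> cm i \<and> cp i + cm i = 2 * L / h) \<and> \<bar>e\<bar> \<le> \<kappa> / 2 * F \<and>
     \<kappa> / 2 * truncated_jump_integral h v y
      = e + (\<Sum>i\<in>UNIV. cp i * (v y - v (y + h *\<^sub>R axis i 1)) + cm i * (v y - v (y - h *\<^sub>R axis i 1)))" for y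
  proof -
    let ?u = "\<lambda>x. u (x + k)"
    obtain cp cm where c: "\<forall>i. 0 \<le> cp i \<and> 0 \<le> cm i \<and> cp i + cm i = 2 * L / h"
      and fo: "viscosity h ?u y + G y (central_grad h ?u y) - (viscosity h u y + G y (central_grad h u y))
        = (\<Sum>i\<in>UNIV. cp i * (v y - v (y + h *\<^sub>R axis i 1)) + cm i * (v y - v (y - h *\<^sub>R axis i 1)))"
      using scheme_first_order_difference[OF h, of v ?u u y y] unfolding v_def by blast
    have J: "truncated_jump_integral h v y = truncated_jump_integral h u (y + k) - truncated_jump_integral h u y"
      by (rule truncated_jump_integral_diff[OF u(1) u(1) B B h]) (simp add: v_def algebra_simps)
    have cg: "central_grad h ?u y = central_grad h u (y + k)" by (simp add: central_grad_def algebra_simps)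
    have vi: "viscosity h ?u y = viscosity h u (y + k)" by (simp add: viscosity_def algebra_simps)
    define e where "e = l * w (y + k) * u (y + k) - l * w y * u y
       + (G (y + k) (central_grad h u (y + k)) - G y (central_grad h u (y + k)))"
    have "\<bar>e\<bar> \<le> \<kappa> / 2 * F"
    proof -
      have "e = l * w y * v y + (l * u (y + k)) * (w (y + k) - w y)
         + (G (y + k) (central_grad h u (y + k)) - G y (central_grad h u (y + k)))"
        by (simp add: e_def v_def algebra_simps)
      moreover have "\<bar>l * w y * v y\<bar> \<le> l * w1 * V"
        unfolding abs_mult using l w_bounds[of y] w0 V[of y] by (intro mult_mono) (auto simp: v_def)
      moreover have "\<bar>(l * u (y + k)) * (w (y + k) - w y)\<bar> \<le> G0 / w0 * (L * norm k)"
        unfolding abs_mult[of "l * u (y + k)"] using scheme_solution_bound[OF u sol h l, of "y + k"] w_lipschitz[of "y + k" y]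
        by (intro mult_mono) auto
      moreover have "\<bar>G (y + k) (central_grad h u (y + k)) - G y (central_grad h u (y + k))\<bar> \<le> L * norm k"
        using G_lipschitz[of "y + k" "central_grad h u (y + k)" y "central_grad h u (y + k)"] by simp
      ultimately have "\<bar>e\<bar> \<le> l * w1 * V + G0 / w0 * (L * norm k) + L * norm k" by linarith
      also have "\<dots> = \<kappa> / 2 * F" using \<kappa> by (simp add: F_def algebra_simps)
      finally show ?thesis .
    qed
    moreover have "\<kappa> / 2 * truncated_jump_integral h v y
      = e + (\<Sum>i\<in>UNIV. cp i * (v y - v (y + h *\<^sub>R axis i 1)) + cm i * (v y - v (y - h *\<^sub>R axis i 1)))"
      using sol[of "y + k"] sol[of y] fo unfolding scheme_def J e_def cg vi by (simp add: algebra_simps)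
    ultimately show ?thesis using c by blast
  qed
  have main: "one_sided_scheme h (4 * L * ?N / \<kappa>) F (\<lambda>y. s * v y)" if s: "s = 1 \<or> s = - 1" for s
    unfolding one_sided_scheme_def
  proof (intro allI impI)
    fix y S assume S: "0 \<le> S"
      and inc: "\<forall>i. s * v (y + h *\<^sub>R axis i 1) - s * v y \<le> S * h \<and> s * v (y - h *\<^sub>R axis i 1) - s * v y \<le> S * h"
    obtain cp cm e where c: "\<And>i. 0 \<le> cp i \<and> 0 \<le> cm i \<and> cp i + cm i = 2 * L / h" and e: "\<bar>e\<bar> \<le> \<kappa> / 2 * F"
      and J: "\<kappa> / 2 * truncated_jump_integral h v y
      = e + (\<Sum>i\<in>UNIV. cp i * (v y - v (y + h *\<^sub>R axis i 1)) + cm i * (v y - v (y - h *\<^sub>R axis i 1)))"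
      using eq[of y] by blast
    have "(\<Sum>i\<in>(UNIV::'n set). - (2 * L / h * (S * h))) \<le> (\<Sum>i\<in>UNIV. cp i * (s * v y - s * v (y + h *\<^sub>R axis i 1)) + cm i * (s * v y - s * v (y - h *\<^sub>R axis i 1)))"
    proof (rule sum_mono)
      fix i
      have "cp i * (- (S * h)) + cm i * (- (S * h)) \<le> cp i * (s * v y - s * v (y + h *\<^sub>R axis i 1)) + cm i * (s * v y - s * v (y - h *\<^sub>R axis i 1))"
        using c[of i] inc[rule_format, of i] by (intro add_mono mult_left_mono) linarith+
      moreover have "cp i * (- (S * h)) + cm i * (- (S * h)) = - (2 * L / h * (S * h))"
        using c[of i] by (metis distrib_right mult_minus_right)
      ultimately show "- (2 * L / h * (S * h)) \<le> cp i * (s * v y - s * v (y + h *\<^sub>R axis i 1)) + cm i * (s * v y - s * v (y - h *\<^sub>R axis i 1))" by simp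
    qed
    also have "\<dots> = s * (\<Sum>i\<in>UNIV. cp i * (v y - v (y + h *\<^sub>R axis i 1)) + cm i * (v y - v (y - h *\<^sub>R axis i 1)))"
      by (simp add: sum_distrib_left algebra_simps)
    finally have 1: "- (2 * ?N * L * S) \<le> s * (\<Sum>i\<in>UNIV. cp i * (v y - v (y + h *\<^sub>R axis i 1)) + cm i * (v y - v (y - h *\<^sub>R axis i 1)))"
      using h by (simp add: ac_simps)
    have "- (\<kappa> / 2 * F) \<le> s * e" using e s by (auto simp: abs_le_iff)
    then have "- (2 * ?N * L * S) - \<kappa> / 2 * F \<le> s * (\<kappa> / 2 * truncated_jump_integral h v y)"
      unfolding J using 1 by (simp add: distrib_left)
    then have "2 / \<kappa> * (- (2 * ?N * L * S) - \<kappa> / 2 * F) \<le> 2 / \<kappa> * (s * (\<kappa> / 2 * truncated_jump_integral h v y))"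
      using \<kappa> by (intro mult_left_mono) auto
    also have "\<dots> = s * truncated_jump_integral h v y" using \<kappa> by simp
    also have "\<dots> = truncated_jump_integral h (\<lambda>y. s * v y) y"
      using s by (auto simp: truncated_jump_integral_uminus)
    finally show "- (4 * L * ?N / \<kappa>) * S - F \<le> truncated_jump_integral h (\<lambda>y. s * v y) y"
      using \<kappa> by (simp add: field_simps)
  qed
  show "one_sided_scheme h (4 * L * ?N / \<kappa>) F (\<lambda>y. u (y + k) - u y)"
    using main[of 1] by (simp add: v_def)
  show "one_sided_scheme h (4 * L * ?N / \<kappa>) F (\<lambda>y. - (u (y + k) - u y))"
    using main[of "- 1"] by (simp add: v_def)
qed

text \<open>The forcing of an increment contains its own supremum V, with the small factor l. The
  Hoelder estimate over one period gives V \<le> P (l w1 V + c |k|), and l \<le> l0 makes P l w1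
  \<le> 1/2, so V is absorbed. What remains is linear in |k|, uniformly in h and l.\<close>

lemma scheme_uniform_estimates:
  "\<exists>\<alpha> K l0. 0 < \<alpha> \<and> \<alpha> \<le> 1/2 \<and> 0 < K \<and> 0 < l0 \<and>
    (\<forall>h l. 0 < h \<longrightarrow> h \<le> 1 \<longrightarrow> 0 < l \<longrightarrow> l \<le> l0 \<longrightarrow>
      (\<exists>u. continuous_on UNIV u \<and> zn_periodic u \<and> (\<forall>y. scheme h l u y = 0) \<and> (\<forall>y. \<bar>l * u y\<bar> \<le> G0 / w0) \<and>
         (\<forall>k x. \<bar>u (x + k) - u x\<bar> \<le> K * norm k) \<and>
         (\<forall>k x y. \<bar>(u (x + k) - u x) - (u (y + k) - u y)\<bar> \<le> K * norm k * ((norm (x - y))\<^sup>2 + h\<^sup>2) powr (\<alpha> / 2))))"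
proof -
  let ?N = "real CARD('n)"
  define A where "A = 4 * L * ?N / \<kappa>"
  have A: "0 \<le> A" using L \<kappa> by (simp add: A_def)
  have w1: "0 < w1" using w0 w_bounds[of 0] by linarith
  have G0: "0 \<le> G0" using G_zero[of 0] by linarith
  obtain \<alpha> C where \<alpha>: "0 < \<alpha>" "\<alpha> \<le> 1/2" and C: "0 < C"
    and est: "\<And>(v::real^'n \<Rightarrow> real) h F x y. 0 < h \<Longrightarrow> h \<le> 1 \<Longrightarrow> 0 \<le> F \<Longrightarrow> zn_periodic v \<Longrightarrow> continuous_on UNIV v \<Longrightarrow>
      one_sided_scheme h A F v \<Longrightarrow> one_sided_scheme h A F (\<lambda>x. - v x) \<Longrightarrow>
      v x - v y \<le> C * F * ((norm (x - y))\<^sup>2 + h\<^sup>2) powr (\<alpha> / 2)"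
    using discrete_holder_estimate[OF A] by metis
  define P where "P = C * (?N + 1) * (2 / \<kappa>)"
  have P: "0 < P" using C \<kappa> by (simp add: P_def add_nonneg_pos)
  define c where "c = (G0 / w0 + 1) * L"
  have c: "0 < c" using G0 w0 L by (simp add: c_def add_nonneg_pos)
  define l0 where "l0 = 1 / (2 * P * w1)"
  have l0: "0 < l0" using P w1 by (simp add: l0_def)
  define K where "K = 2 * P * c + C * (2 / \<kappa> * (2 * c))"
  have K1: "2 * P * c \<le> K" "C * (2 / \<kappa> * (2 * c)) \<le> K" "0 < K" using P C c \<kappa> by (auto simp: K_def add_pos_pos)
  have "\<exists>u. continuous_on UNIV u \<and> zn_periodic u \<and> (\<forall>y. scheme h l u y = 0) \<and> (\<forall>y. \<bar>l * u y\<bar> \<le> G0 / w0) \<and>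
         (\<forall>k x. \<bar>u (x + k) - u x\<bar> \<le> K * norm k) \<and>
         (\<forall>k x y. \<bar>(u (x + k) - u x) - (u (y + k) - u y)\<bar> \<le> K * norm k * ((norm (x - y))\<^sup>2 + h\<^sup>2) powr (\<alpha> / 2))"
    if h: "0 < h" "h \<le> 1" and l: "0 < l" "l \<le> l0" for h l
  proof -
    obtain u where u: "continuous_on UNIV u" "zn_periodic u" and sol: "\<And>y. scheme h l u y = 0"
      using scheme_solvable[OF h(1) l(1)] by blast
    have lw: "P * (l * w1) \<le> 1 / 2"
    proof -
      have "P * (l * w1) \<le> P * (l0 * w1)" using P w1 l by (intro mult_left_mono mult_right_mono) auto
      also have "\<dots> = 1 / 2" using P w1 by (simp add: l0_def)
      finally show ?thesis .
    qed
    have both: "\<bar>u (x + k) - u x\<bar> \<le> 2 * P * c * norm k \<and>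
       \<bar>(u (x + k) - u x) - (u (y + k) - u y)\<bar> \<le> C * (2 / \<kappa> * (2 * c)) * norm k * ((norm (x - y))\<^sup>2 + h\<^sup>2) powr (\<alpha> / 2)" for k x y
    proof -
      define v where "v y = u (y + k) - u y" for y
      have vper: "zn_periodic v"
      proof -
        have "u (y + j + k) = u (y + k)" if "\<forall>i. j $ i \<in> \<int>" for y j
          using u(2) that unfolding zn_periodic_def by (metis add.commute add.left_commute)
        then show ?thesis using u(2) by (auto simp: zn_periodic_def v_def)
      qed
      have vcont: "continuous_on UNIV v" unfolding v_def by (intro continuous_intros u continuous_on_translate(3))
      have "zn_periodic (\<lambda>y. \<bar>v y\<bar>)" "continuous_on UNIV (\<lambda>y. \<bar>v y\<bar>)"
        using vper vcont by (auto simp: zn_periodic_def intro!: continuous_intros)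
      then obtain a where a: "\<And>y. \<bar>v y\<bar> \<le> \<bar>v a\<bar>" using zn_periodic_attains_max by blast
      define V where "V = \<bar>v a\<bar>"
      have V: "\<bar>u (y + k) - u y\<bar> \<le> V" "0 \<le> V" for y using a by (auto simp: V_def v_def)
      define F where "F = 2 / \<kappa> * (l * w1 * V + c * norm k)"
      have F: "0 \<le> F" unfolding F_def using \<kappa> l w1 V c by (intro mult_nonneg_nonneg add_nonneg_nonneg) auto
      have os: "one_sided_scheme h A F v" "one_sided_scheme h A F (\<lambda>x. - v x)"
        using scheme_increment_one_sided[OF u sol h(1) l(1) V(1)] unfolding A_def F_def c_def v_def by auto
      have hol: "v x - v y \<le> C * F * ((norm (x - y))\<^sup>2 + h\<^sup>2) powr (\<alpha> / 2)" for x y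
        by (rule est[OF h F vper vcont os])
      have phi: "(r\<^sup>2 + h\<^sup>2) powr (\<alpha> / 2) \<le> ?N + 1" if "0 \<le> r" "r \<le> ?N" for r
      proof -
        have "r\<^sup>2 + h\<^sup>2 \<le> (?N + 1)\<^sup>2"
        proof -
          have "r\<^sup>2 \<le> ?N\<^sup>2" "h\<^sup>2 \<le> 1" using that h by (auto intro: power_mono simp: power_le_one)
          then show ?thesis by (simp add: power2_sum)
        qed
        then have "(r\<^sup>2 + h\<^sup>2) powr (\<alpha> / 2) \<le> ((?N + 1)\<^sup>2) powr (\<alpha> / 2)"
          using \<alpha> by (intro powr_mono2) auto
        also have "\<dots> \<le> ((?N + 1)\<^sup>2) powr (1 / 2)" using \<alpha> by (intro powr_mono) auto
        also have "\<dots> = ?N + 1" by (simp add: powr_half_sqrt)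
        finally show ?thesis .
      qed
      have osc: "v x - v y \<le> C * F * (?N + 1)" for x y
      proof -
        obtain y' where y': "v y' = v y" "norm (x - y') \<le> ?N" using zn_periodic_nearby[OF vper] by blast
        have "v x - v y' \<le> C * F * ((norm (x - y'))\<^sup>2 + h\<^sup>2) powr (\<alpha> / 2)" by (rule hol)
        also have "\<dots> \<le> C * F * (?N + 1)" using C F y' by (intro mult_left_mono phi) auto
        finally show ?thesis using y' by simp
      qed
      \<comment> \<open>The increment is nonpositive at a maximum of u and nonnegative at a minimum,
        so its supremum norm is bounded by its oscillation.\<close>
      obtain p where p: "\<And>y. u y \<le> u p" using zn_periodic_attains_max[OF u(2,1)] by blast
      obtain q where q: "\<And>y. u q \<le> u y" using zn_periodic_attains_min[OF u(2,1)] by blast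
      have "v p \<le> 0" "0 \<le> v q" using p q by (auto simp: v_def)
      then have "\<bar>v y\<bar> \<le> C * F * (?N + 1)" for y using osc[of y p] osc[of q y] by (simp add: abs_le_iff)
      then have "V \<le> C * F * (?N + 1)" by (simp add: V_def)
      also have "\<dots> = P * (l * w1 * V + c * norm k)" by (simp add: F_def P_def)
      also have "\<dots> = P * (l * w1) * V + P * c * norm k" by (simp add: algebra_simps)
      also have "\<dots> \<le> 1/2 * V + P * c * norm k" using lw V by (intro add_right_mono mult_right_mono) auto
      finally have V2: "V \<le> 2 * P * c * norm k" by simp
      have "l * w1 * V \<le> l * w1 * (2 * P * c * norm k)" using V2 l w1 by (intro mult_left_mono) auto
      also have "\<dots> = (P * (l * w1)) * (2 * c * norm k)" by simp
      also have "\<dots> \<le> 1/2 * (2 * c * norm k)" using lw c by (intro mult_right_mono) auto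
      finally have "F \<le> 2 / \<kappa> * (2 * c * norm k)"
        unfolding F_def using \<kappa> by (intro mult_left_mono) auto
      then have F2: "C * F * t \<le> C * (2 / \<kappa> * (2 * c)) * norm k * t" if "0 \<le> t" for t
        using C that mult_left_mono[of F "2 / \<kappa> * (2 * c * norm k)" C] by (intro mult_right_mono) (auto simp: mult.assoc)
      have "v x - v y \<le> C * (2 / \<kappa> * (2 * c)) * norm k * ((norm (x - y))\<^sup>2 + h\<^sup>2) powr (\<alpha> / 2)"
        "v y - v x \<le> C * (2 / \<kappa> * (2 * c)) * norm k * ((norm (x - y))\<^sup>2 + h\<^sup>2) powr (\<alpha> / 2)"
        using hol[of x y] hol[of y x] F2[of "((norm (x - y))\<^sup>2 + h\<^sup>2) powr (\<alpha> / 2)"]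
        by (auto simp: norm_minus_commute)
      then show ?thesis using V(1)[of x] V2 by (auto simp: v_def abs_le_iff)
    qed
    show ?thesis
    proof (intro exI[of _ u] conjI allI u sol scheme_solution_bound[OF u sol h(1) l(1)])
      fix k x y :: "real^'n"
      have "2 * P * c * norm k \<le> K * norm k" using K1 by (intro mult_right_mono) auto
      then show "\<bar>u (x + k) - u x\<bar> \<le> K * norm k" using both[of x k x] by linarith
      have "C * (2 / \<kappa> * (2 * c)) * norm k * ((norm (x - y))\<^sup>2 + h\<^sup>2) powr (\<alpha> / 2) \<le> K * norm k * ((norm (x - y))\<^sup>2 + h\<^sup>2) powr (\<alpha> / 2)"
        using K1 by (intro mult_right_mono) auto
      then show "\<bar>(u (x + k) - u x) - (u (y + k) - u y)\<bar> \<le> K * norm k * ((norm (x - y))\<^sup>2 + h\<^sup>2) powr (\<alpha> / 2)"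
        using both[of x k y] by linarith
    qed
  qed
  then show ?thesis using \<alpha> K1(3) l0 by blast
qed

end

section \<open>From increments to a gradient, and the limit of the scheme\<close>

text \<open>The defect g(t) = D(t x) - t D(x) is additive and vanishes at the integers, so it is
  determined by the fractional part of t and bounded. A bounded additive function is zero, since g(n
  t) = n g(t).\<close>

lemma bounded_additive_homogeneous:
  fixes D :: "'a::real_normed_vector \<Rightarrow> real"
  assumes add: "\<And>x y. D (x + y) = D x + D y" and bd: "\<And>x. \<bar>D x\<bar> \<le> K * norm x"
  shows "D (t *\<^sub>R x) = t * D x"
proof -
  define g where "g t = D (t *\<^sub>R x) - t * D x" for t
  have gadd: "g (s + t) = g s + g t" for s t
    by (simp add: g_def scaleR_left_distrib add algebra_simps)
  have g1: "g 1 = 0" by (simp add: g_def)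
  have g0: "g 0 = 0" using gadd[of 0 0] by simp
  have gn: "g (real n * t) = real n * g t" for n t
    by (induction n) (auto simp: g0 gadd algebra_simps)
  have gm: "g (- t) = - g t" for t using gadd[of t "- t"] g0 by simp
  have gi: "g (of_int i) = 0" for i
    using gn[of "nat \<bar>i\<bar>" 1] gm[of "of_int i"] g1 by (cases "i \<ge> 0") (auto simp: abs_if)
  define C where "C = \<bar>K\<bar> * norm x + \<bar>D x\<bar>"
  have gb: "\<bar>g t\<bar> \<le> C" for t
  proof -
    have "g t = g (frac t) + g (of_int \<lfloor>t\<rfloor>)" using gadd[of "frac t" "of_int \<lfloor>t\<rfloor>"] by (simp add: frac_def)
    then have "g t = g (frac t)" using gi by simp
    moreover have "\<bar>D (frac t *\<^sub>R x)\<bar> \<le> \<bar>K\<bar> * norm x"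
    proof -
      have f: "\<bar>frac t\<bar> \<le> 1" using frac_lt_1[of t] frac_ge_0[of t] by simp
      have "\<bar>D (frac t *\<^sub>R x)\<bar> \<le> K * (\<bar>frac t\<bar> * norm x)" using bd[of "frac t *\<^sub>R x"] by simp
      also have "\<dots> \<le> \<bar>K\<bar> * (1 * norm x)" using f by (intro mult_mono) auto
      finally show ?thesis by simp
    qed
    moreover have "\<bar>frac t * D x\<bar> \<le> \<bar>D x\<bar>"
      using frac_lt_1[of t] frac_ge_0[of t] by (simp add: abs_mult mult_left_le_one_le)
    ultimately show ?thesis unfolding g_def C_def by linarith
  qed
  have "g t = 0"
  proof (rule ccontr)
    assume "g t \<noteq> 0"
    then obtain n :: nat where n: "C < real n * \<bar>g t\<bar>"
      using ex_less_of_nat_mult[of "\<bar>g t\<bar>" C] by auto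
    have "real n * \<bar>g t\<bar> = \<bar>g (real n * t)\<bar>" by (simp add: gn abs_mult)
    then show False using gb[of "real n * t"] n by linarith
  qed
  then show ?thesis by (simp add: g_def)
qed

text \<open>The derivative is built as a limit of dyadic difference quotients, which converge
  geometrically with ratio 2^(-\<alpha>); summing the errors gives the Taylor remainder of order 1 +
  \<alpha>. Additivity in the direction and the Hoelder bound in the base point both pass to the
  limit from the bound on double increments.\<close>

lemma holder_increments_C1:
  fixes u :: "real^'n \<Rightarrow> real"
  assumes per: "zn_periodic u" and K: "0 \<le> K" and \<alpha>: "0 < \<alpha>"
    and lip: "\<And>k x. \<bar>u (x + k) - u x\<bar> \<le> K * norm k"
    and inc: "\<And>k x y. \<bar>(u (x + k) - u x) - (u (y + k) - u y)\<bar> \<le> K * norm k * norm (x - y) powr \<alpha>"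
  shows "C1_holder_torus \<alpha> u"
proof -
  define r where "r = (1/2::real) powr \<alpha>"
  have r: "0 < r" "r < 1" unfolding r_def using \<alpha> powr_less_mono2[of \<alpha> "1/2" 1] by auto
  have rn: "((1/2::real)^n) powr \<alpha> = r ^ n" for n
    by (simp add: r_def powr_realpow[symmetric] powr_powr mult.commute)
  define a where "a x k n = 2 ^ n * (u (x + (1/2) ^ n *\<^sub>R k) - u x)" for x k n
  have step: "\<bar>a x k (Suc n) - a x k n\<bar> \<le> K * norm k powr (1 + \<alpha>) * r ^ n" for x k n
  proof -
    define j where "j = (1/2) ^ Suc n *\<^sub>R k"
    have jj: "(1/2) ^ n *\<^sub>R k = j + j" by (simp add: j_def scaleR_left_distrib[symmetric])
    have nj: "norm j = (1/2) ^ Suc n * norm k" by (simp add: j_def)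
    \<comment> \<open>The two halves of a dyadic step are one increment taken at x and at x + j, so
      consecutive quotients differ by the Hoelder modulus at scale j.\<close>
    have "\<bar>(u (x + j) - u x) - (u ((x + j) + j) - u (x + j))\<bar> \<le> K * norm j * norm (x - (x + j)) powr \<alpha>"
      by (rule inc)
    then have 1: "\<bar>2 * (u (x + j) - u x) - (u (x + (j + j)) - u x)\<bar> \<le> K * norm j * norm j powr \<alpha>"
      by (simp add: algebra_simps)
    have "a x k (Suc n) - a x k n = 2 ^ n * (2 * (u (x + j) - u x) - (u (x + (j + j)) - u x))"
      unfolding a_def jj j_def[symmetric] by (simp add: algebra_simps)
    then have "\<bar>a x k (Suc n) - a x k n\<bar> = 2 ^ n * \<bar>2 * (u (x + j) - u x) - (u (x + (j + j)) - u x)\<bar>"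
      by (simp add: abs_mult)
    also have "\<dots> \<le> 2 ^ n * (K * norm j * norm j powr \<alpha>)" using 1 by (intro mult_left_mono) auto
    also have "\<dots> = K * norm k * (norm k powr \<alpha> * r ^ Suc n) / 2"
    proof -
      have "norm j powr \<alpha> = norm k powr \<alpha> * r ^ Suc n" unfolding nj by (simp only: powr_mult rn mult.commute)
      moreover have "2 ^ n * norm j = norm k / 2" unfolding nj by (simp add: power_divide)
      ultimately show ?thesis by (simp add: algebra_simps)
    qed
    also have "\<dots> \<le> K * norm k * (norm k powr \<alpha> * r ^ n)"
    proof -
      have "r ^ Suc n / 2 \<le> r ^ n" using r by (simp add: mult_left_le_one_le order_trans[of _ "r ^ n"])
      then have "K * norm k * norm k powr \<alpha> * (r ^ Suc n / 2) \<le> K * norm k * norm k powr \<alpha> * r ^ n"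
        using K by (intro mult_left_mono) auto
      then show ?thesis by (simp add: mult.assoc)
    qed
    also have "\<dots> = K * norm k powr (1 + \<alpha>) * r ^ n"
      by (cases "k = 0") (auto simp: powr_add)
    finally show ?thesis .
  qed
  have sr: "summable (\<lambda>n. c * r ^ n)" for c using r by (intro summable_mult summable_geometric) auto
  have sa: "summable (\<lambda>n. norm (a x k (Suc n) - a x k n))" for x k
    by (rule summable_comparison_test'[OF sr[of "K * norm k powr (1 + \<alpha>)"], of 0]) (use step in auto)
  define D where "D x k = a x k 0 + (\<Sum>n. a x k (Suc n) - a x k n)" for x k
  have lim: "a x k \<longlonglongrightarrow> D x k" for x k
  proof -
    have "(\<lambda>n. a x k 0 + (\<Sum>i<n. a x k (Suc i) - a x k i)) \<longlonglongrightarrow> D x k"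
      unfolding D_def by (intro tendsto_intros summable_LIMSEQ summable_norm_cancel[OF sa])
    then show ?thesis by (simp add: sum_lessThan_telescope)
  qed
  define M where "M = K / (1 - r)"
  have E: "\<bar>u (x + k) - u x - D x k\<bar> \<le> M * norm k powr (1 + \<alpha>)" for x k
  proof -
    have "\<bar>\<Sum>n. a x k (Suc n) - a x k n\<bar> \<le> (\<Sum>n. \<bar>a x k (Suc n) - a x k n\<bar>)"
      using summable_norm[OF sa[of x k]] by simp
    also have "\<dots> \<le> (\<Sum>n. K * norm k powr (1 + \<alpha>) * r ^ n)"
      using sa[of x k] by (intro suminf_le step sr) auto
    also have "\<dots> = K * norm k powr (1 + \<alpha>) * (1 / (1 - r))"
      using r by (subst suminf_mult) (auto simp: suminf_geometric)
    finally show ?thesis by (simp add: D_def a_def M_def)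
  qed
  have addD: "D x (k + j) = D x k + D x j" for x k j
  proof -
    have "(\<lambda>n. a x (k + j) n - a x k n - a x j n) \<longlonglongrightarrow> D x (k + j) - D x k - D x j"
      by (intro tendsto_intros lim)
    moreover have "(\<lambda>n. a x (k + j) n - a x k n - a x j n) \<longlonglongrightarrow> 0"
    proof (rule Lim_null_comparison[OF always_eventually])
      show "\<forall>n. norm (a x (k + j) n - a x k n - a x j n) \<le> K * norm j * norm k powr \<alpha> * r ^ n"
      proof
        fix n
        let ?k = "(1/2) ^ n *\<^sub>R k" and ?j = "(1/2) ^ n *\<^sub>R j"
        have "\<bar>(u ((x + ?k) + ?j) - u (x + ?k)) - (u (x + ?j) - u x)\<bar> \<le> K * norm ?j * norm ((x + ?k) - x) powr \<alpha>"
          by (rule inc)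
        also have "\<dots> = K * norm ?j * (norm k powr \<alpha> * r ^ n)" using rn[of n] by (simp add: powr_mult mult.commute)
        finally have "2 ^ n * \<bar>(u ((x + ?k) + ?j) - u (x + ?k)) - (u (x + ?j) - u x)\<bar> \<le> 2 ^ n * (K * norm ?j * (norm k powr \<alpha> * r ^ n))"
          by (intro mult_left_mono) auto
        moreover have "2 ^ n * (K * norm ?j * (norm k powr \<alpha> * r ^ n)) = K * norm j * norm k powr \<alpha> * r ^ n"
          by (simp add: power_divide)
        moreover have eq: "a x (k + j) n - a x k n - a x j n = 2 ^ n * ((u ((x + ?k) + ?j) - u (x + ?k)) - (u (x + ?j) - u x))"
          by (simp add: a_def scaleR_right_distrib algebra_simps)
        have "norm (a x (k + j) n - a x k n - a x j n) = 2 ^ n * \<bar>(u ((x + ?k) + ?j) - u (x + ?k)) - (u (x + ?j) - u x)\<bar>"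
          unfolding eq by (simp add: abs_mult)
        ultimately show "norm (a x (k + j) n - a x k n - a x j n) \<le> K * norm j * norm k powr \<alpha> * r ^ n"
          by linarith
      qed
      show "(\<lambda>n. K * norm j * norm k powr \<alpha> * r ^ n) \<longlonglongrightarrow> 0"
        using r by (intro tendsto_mult_right_zero LIMSEQ_power_zero) auto
    qed
    ultimately have "D x (k + j) - D x k - D x j = 0" by (rule LIMSEQ_unique)
    then show ?thesis by simp
  qed
  have diffD: "\<bar>D x k - D y k\<bar> \<le> K * norm k * norm (x - y) powr \<alpha>" for x y k
  proof (rule tendsto_upperbound[OF _ always_eventually])
    show "(\<lambda>n. \<bar>a x k n - a y k n\<bar>) \<longlonglongrightarrow> \<bar>D x k - D y k\<bar>" by (intro tendsto_intros lim)
    show "\<forall>n. \<bar>a x k n - a y k n\<bar> \<le> K * norm k * norm (x - y) powr \<alpha>"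
    proof
      fix n
      have "2 ^ n * \<bar>(u (x + (1/2) ^ n *\<^sub>R k) - u x) - (u (y + (1/2) ^ n *\<^sub>R k) - u y)\<bar>
        \<le> 2 ^ n * (K * norm ((1/2) ^ n *\<^sub>R k) * norm (x - y) powr \<alpha>)"
        by (intro mult_left_mono inc) auto
      also have "\<dots> = K * norm k * norm (x - y) powr \<alpha>" by (simp add: power_divide)
      finally have "\<bar>2 ^ n * ((u (x + (1/2) ^ n *\<^sub>R k) - u x) - (u (y + (1/2) ^ n *\<^sub>R k) - u y))\<bar> \<le> K * norm k * norm (x - y) powr \<alpha>"
        by (simp add: abs_mult)
      then show "\<bar>a x k n - a y k n\<bar> \<le> K * norm k * norm (x - y) powr \<alpha>"
        unfolding a_def by (simp only: right_diff_distrib)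
    qed
  qed simp
  have bdD: "\<bar>D x k\<bar> \<le> K * norm k" for x k
  proof (rule tendsto_upperbound[OF _ always_eventually])
    show "(\<lambda>n. \<bar>a x k n\<bar>) \<longlonglongrightarrow> \<bar>D x k\<bar>" by (intro tendsto_intros lim)
    show "\<forall>n. \<bar>a x k n\<bar> \<le> K * norm k"
    proof
      fix n
      have "\<bar>a x k n\<bar> \<le> 2 ^ n * (K * norm ((1/2) ^ n *\<^sub>R k))"
        unfolding a_def abs_mult using lip[of x "(1/2) ^ n *\<^sub>R k"] by (intro mult_mono) auto
      then show "\<bar>a x k n\<bar> \<le> K * norm k" by (simp add: power_divide)
    qed
  qed simp
  have blD: "bounded_linear (D x)" for x
  proof (rule bounded_linear_intro[where K = K])
    show "D x (t *\<^sub>R k) = t *\<^sub>R D x k" for t k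
      unfolding real_scaleR_def by (rule bounded_additive_homogeneous[OF addD bdD])
    show "norm (D x k) \<le> norm k * K" for k using bdD[of x k] by (simp add: mult.commute)
  qed (rule addD)
  have der: "(u has_derivative D x) (at x)" for x
    unfolding has_derivative_at
  proof (rule conjI[OF blD], rule Lim_null_comparison[OF always_eventually])
    show "\<forall>k. norm (norm (u (x + k) - u x - D x k) / norm k) \<le> M * norm k powr \<alpha>"
    proof
      fix k :: "real^'n"
      show "norm (norm (u (x + k) - u x - D x k) / norm k) \<le> M * norm k powr \<alpha>"
        using E[of x k] by (cases "k = 0") (auto simp: powr_add field_simps)
    qed
    have "((\<lambda>k::real^'n. norm k powr \<alpha>) \<longlongrightarrow> norm (0::real^'n) powr \<alpha>) (at 0)"
      using \<alpha> by (intro tendsto_powr' tendsto_intros) auto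
    then show "((\<lambda>k::real^'n. M * norm k powr \<alpha>) \<longlongrightarrow> 0) (at 0)"
      by (intro tendsto_mult_right_zero) simp
  qed
  have gr: "D x k = k \<bullet> grad u x" for x k
  proof -
    have "GDERIV u x :> grad u x" by (rule gderiv_grad) (use der in \<open>auto simp: differentiable_def\<close>)
    then have "(\<lambda>h. h \<bullet> grad u x) = D x" unfolding gderiv_def by (rule has_derivative_unique[OF _ der])
    then show ?thesis by metis
  qed
  have "norm (grad u x - grad u y) \<le> K * norm (x - y) powr \<alpha>" for x y
  proof -
    let ?k = "grad u x - grad u y"
    have "norm ?k * norm ?k = ?k \<bullet> ?k" by (simp add: power2_norm_eq_inner[symmetric] power2_eq_square)
    also have "\<dots> = D x ?k - D y ?k" by (simp add: gr inner_diff_right)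
    also have "\<dots> \<le> K * norm ?k * norm (x - y) powr \<alpha>" using diffD[of x ?k y] by simp
    finally have "norm ?k * norm ?k \<le> norm ?k * (K * norm (x - y) powr \<alpha>)" by (simp add: ac_simps)
    then show ?thesis by (cases "?k = 0") (use K in auto)
  qed
  then show ?thesis
    unfolding C1_holder_torus_def using per der by (auto simp: differentiable_def)
qed

context lipschitz_cell_data
begin

text \<open>Pointwise convergence controls quotients with a fixed step t only. The quotient with the
  mesh step differs from it by at most 2 K t^\<alpha>, uniformly in n: t consists of an integer
  number of mesh steps, whose increments differ little. Letting n grow first and t shrink afterwards
  gives the claim; meshes are powers of 1/2 for this divisibility.\<close>

lemma discrete_derivative_converges:
  fixes U :: "nat \<Rightarrow> real^'n \<Rightarrow> real" and e :: "real^'n"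
  assumes \<alpha>: "0 < \<alpha>" "\<alpha> < 1" and K: "0 \<le> K" and e: "norm e = 1"
    and \<rho>: "strict_mono \<rho>"
    and inc: "\<And>n k x y. \<bar>(U n (x + k) - U n x) - (U n (y + k) - U n y)\<bar>
        \<le> K * norm k * ((norm (x - y))\<^sup>2 + ((1/2) ^ \<rho> n)\<^sup>2) powr (\<alpha> / 2)"
    and conv: "\<And>x y. (\<lambda>n. U n x - U n y) \<longlonglongrightarrow> \<psi> x - \<psi> y"
    and C1: "C1_holder_torus \<alpha> \<psi>"
  shows "(\<lambda>n. (U n (y + (1/2) ^ \<rho> n *\<^sub>R e) - U n y) / (1/2) ^ \<rho> n) \<longlonglongrightarrow> grad \<psi> y \<bullet> e"
proof -
  obtain M where M: "0 \<le> M" "\<And>x z. \<bar>\<psi> (x + z) - \<psi> x - grad \<psi> x \<bullet> z\<bar> \<le> M * norm z powr (1 + \<alpha>)"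
    using C1_holder_torus_taylor[OF C1 \<alpha>(1)] by auto
  let ?h = "\<lambda>n. (1/2::real) ^ \<rho> n"
  have discrete: "\<bar>(U n (y + t *\<^sub>R e) - U n y) / t - (U n (y + ?h n *\<^sub>R e) - U n y) / ?h n\<bar> \<le> 2 * K * t powr \<alpha>"
    if i: "i \<le> \<rho> n" and t: "t = (1/2) ^ i" for n i t
  proof -
    let ?k = "?h n *\<^sub>R e"
    define j where "j = (2::nat) ^ (\<rho> n - i)"
    have jt: "real j * ?h n = t"
    proof -
      have "?h n = (1/2) ^ (\<rho> n - i) * (1/2) ^ i" using i by (simp flip: power_add)
      then show ?thesis by (simp add: j_def t power_divide)
    qed
    have t0: "0 < t" by (simp add: t)
    have hle: "?h n \<le> t" unfolding t using i by (intro power_decreasing) auto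
    have tel: "U n (y + real m *\<^sub>R ?k) - U n y = (\<Sum>l<m. U n (y + real l *\<^sub>R ?k + ?k) - U n (y + real l *\<^sub>R ?k))" for m
      by (induction m) (auto simp: algebra_simps)
    have summand: "\<bar>(U n (y + real l *\<^sub>R ?k + ?k) - U n (y + real l *\<^sub>R ?k)) - (U n (y + ?k) - U n y)\<bar> \<le> K * ?h n * (2 * t powr \<alpha>)"
      if l: "l < j" for l
    proof -
      have "real l * ?h n \<le> real j * ?h n" using l by (intro mult_right_mono) auto
      then have "(real l * ?h n)\<^sup>2 \<le> t\<^sup>2" unfolding jt by (intro power_mono) auto
      moreover have "(?h n)\<^sup>2 \<le> t\<^sup>2" using hle by (intro power_mono) auto
      ultimately have le: "(real l * ?h n)\<^sup>2 + (?h n)\<^sup>2 \<le> 2 * t\<^sup>2" by simp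
      have "((real l * ?h n)\<^sup>2 + (?h n)\<^sup>2) powr (\<alpha> / 2) \<le> (2 * t\<^sup>2) powr (\<alpha> / 2)"
        using le \<alpha> by (intro powr_mono2) auto
      also have "\<dots> = 2 powr (\<alpha> / 2) * t powr \<alpha>"
      proof -
        have "t\<^sup>2 = t powr 2" using t0 powr_realpow[of t 2] by simp
        then have "t\<^sup>2 powr (\<alpha> / 2) = t powr \<alpha>" using powr_powr[of t 2 "\<alpha> / 2"] by simp
        then show ?thesis using t0 by (simp add: powr_mult)
      qed
      also have "\<dots> \<le> 2 powr 1 * t powr \<alpha>" using \<alpha> by (intro mult_right_mono powr_mono) auto
      finally have "((real l * ?h n)\<^sup>2 + (?h n)\<^sup>2) powr (\<alpha> / 2) \<le> 2 * t powr \<alpha>" by simp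
      then have "K * norm ?k * ((norm (y + real l *\<^sub>R ?k - y))\<^sup>2 + (?h n)\<^sup>2) powr (\<alpha> / 2) \<le> K * ?h n * (2 * t powr \<alpha>)"
        using K e by (intro mult_mono) auto
      then show ?thesis using inc[of n "y + real l *\<^sub>R ?k" ?k y] by linarith
    qed
    have sumeq: "U n (y + t *\<^sub>R e) - U n y - real j * (U n (y + ?k) - U n y)
       = (\<Sum>l<j. (U n (y + real l *\<^sub>R ?k + ?k) - U n (y + real l *\<^sub>R ?k)) - (U n (y + ?k) - U n y))"
      using tel[of j] jt by (simp add: sum_subtractf)
    have "\<bar>U n (y + t *\<^sub>R e) - U n y - real j * (U n (y + ?k) - U n y)\<bar> \<le> (\<Sum>l<j. K * ?h n * (2 * t powr \<alpha>))"
      unfolding sumeq by (rule order_trans[OF sum_abs], rule sum_mono) (use summand in auto)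
    also have "\<dots> = (real j * ?h n) * K * (2 * t powr \<alpha>)" by simp
    finally have "\<bar>U n (y + t *\<^sub>R e) - U n y - real j * (U n (y + ?k) - U n y)\<bar> \<le> t * K * (2 * t powr \<alpha>)"
      unfolding jt .
    then have "\<bar>U n (y + t *\<^sub>R e) - U n y - real j * (U n (y + ?k) - U n y)\<bar> / t \<le> 2 * K * t powr \<alpha>"
      using t0 by (simp add: field_simps)
    moreover have "(U n (y + t *\<^sub>R e) - U n y - real j * (U n (y + ?k) - U n y)) / t
       = (U n (y + t *\<^sub>R e) - U n y) / t - (U n (y + ?k) - U n y) / ?h n"
    proof -
      have "real j / t = 1 / ?h n" using jt[symmetric] t0 by (simp add: j_def)
      then have "real j * A / t = A / ?h n" for A
        by (metis mult_1 times_divide_eq_left)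
      then show ?thesis by (simp only: diff_divide_distrib)
    qed
    ultimately show ?thesis using t0 by (metis abs_divide abs_of_pos)
  qed
  show ?thesis
  proof (rule LIMSEQ_I)
    fix \<epsilon> :: real assume \<epsilon>: "0 < \<epsilon>"
    define r where "r = (1/2::real) powr \<alpha>"
    have r: "0 < r" "r < 1" unfolding r_def using \<alpha> powr_less_mono2[of \<alpha> "1/2" 1] by auto
    have "(\<lambda>i. (2 * K + M) * r ^ i) \<longlonglongrightarrow> 0"
      using r by (intro tendsto_mult_right_zero LIMSEQ_power_zero) auto
    then obtain i where "\<bar>(2 * K + M) * r ^ i\<bar> < \<epsilon> / 2"
      using LIMSEQ_D[of _ 0 "\<epsilon> / 2"] \<epsilon> by (metis diff_zero half_gt_zero_iff order_refl real_norm_def)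
    define t where "t = (1/2::real) ^ i"
    have t0: "0 < t" by (simp add: t_def)
    have "t powr \<alpha> = r ^ i" by (simp add: t_def r_def powr_realpow[symmetric] powr_powr mult.commute)
    then have small: "2 * K * t powr \<alpha> + M * t powr \<alpha> < \<epsilon> / 2"
      using abs_ge_self[of "(2 * K + M) * r ^ i"] \<open>\<bar>(2 * K + M) * r ^ i\<bar> < \<epsilon> / 2\<close>
      by (simp add: distrib_right)
    have "(\<lambda>n. (U n (y + t *\<^sub>R e) - U n y) / t) \<longlonglongrightarrow> (\<psi> (y + t *\<^sub>R e) - \<psi> y) / t"
      using t0 by (intro tendsto_intros conv) auto
    from LIMSEQ_D[OF this, of "\<epsilon> / 2"] \<epsilon>
    have "\<exists>n0. \<forall>n\<ge>n0. \<bar>(U n (y + t *\<^sub>R e) - U n y) / t - (\<psi> (y + t *\<^sub>R e) - \<psi> y) / t\<bar> < \<epsilon> / 2" by simp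
    then obtain n0 where n0: "\<And>n. n \<ge> n0 \<Longrightarrow> \<bar>(U n (y + t *\<^sub>R e) - U n y) / t - (\<psi> (y + t *\<^sub>R e) - \<psi> y) / t\<bar> < \<epsilon> / 2" by blast
    have psi: "\<bar>(\<psi> (y + t *\<^sub>R e) - \<psi> y) / t - grad \<psi> y \<bullet> e\<bar> \<le> M * t powr \<alpha>"
    proof -
      have "\<bar>\<psi> (y + t *\<^sub>R e) - \<psi> y - t * (grad \<psi> y \<bullet> e)\<bar> \<le> M * (t * t powr \<alpha>)"
        using M(2)[of y "t *\<^sub>R e"] e t0 by (simp add: powr_add)
      moreover have "(\<psi> (y + t *\<^sub>R e) - \<psi> y) / t - grad \<psi> y \<bullet> e = (\<psi> (y + t *\<^sub>R e) - \<psi> y - t * (grad \<psi> y \<bullet> e)) / t"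
        using t0 by (simp add: field_simps)
      ultimately show ?thesis using t0 by (simp add: field_simps)
    qed
    show "\<exists>no. \<forall>n\<ge>no. norm ((U n (y + ?h n *\<^sub>R e) - U n y) / ?h n - grad \<psi> y \<bullet> e) < \<epsilon>"
    proof (intro exI[of _ "max n0 i"] allI impI)
      fix n assume n: "max n0 i \<le> n"
      then have "i \<le> \<rho> n" using strict_mono_imp_increasing[OF \<rho>, of n] by linarith
      then have 1: "\<bar>(U n (y + t *\<^sub>R e) - U n y) / t - (U n (y + ?h n *\<^sub>R e) - U n y) / ?h n\<bar> \<le> 2 * K * t powr \<alpha>"
        by (rule discrete[OF _ t_def])
      have arith: "\<bar>q - g\<bar> < \<epsilon>" if "\<bar>p - q\<bar> \<le> A" "\<bar>p - r\<bar> < \<epsilon> / 2" "\<bar>r - g\<bar> \<le> B" "A + B < \<epsilon> / 2"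
        for p q r g A B :: real using that by linarith
      show "norm ((U n (y + ?h n *\<^sub>R e) - U n y) / ?h n - grad \<psi> y \<bullet> e) < \<epsilon>"
        unfolding real_norm_def by (rule arith[OF 1 n0 psi small]) (use n in simp)
    qed
  qed
qed

text \<open>Mesh size and discount tend to 0 together. Differences of u and the product l u are
  compact by the uniform bounds; the limit of l u is constant in y because u has bounded
  oscillation, and its negative is the ergodic constant.\<close>

theorem lipschitz_cell_solution:
  "\<exists>\<alpha> c \<psi>. 0 < \<alpha> \<and> \<alpha> < 1 \<and> C1_holder_torus \<alpha> \<psi> \<and>
     (\<forall>y. - (\<kappa> / 2) * jump_integral \<psi> y + G y (grad \<psi> y) = c * w y)"
proof -
  let ?N = "real CARD('n)"
  obtain \<alpha> K l0 where \<alpha>: "0 < \<alpha>" "\<alpha> \<le> 1/2" and K: "0 < K" and l0: "0 < l0"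
    and est: "\<And>h l. 0 < h \<Longrightarrow> h \<le> 1 \<Longrightarrow> 0 < l \<Longrightarrow> l \<le> l0 \<Longrightarrow>
      (\<exists>u. continuous_on UNIV u \<and> zn_periodic u \<and> (\<forall>y. scheme h l u y = 0) \<and> (\<forall>y. \<bar>l * u y\<bar> \<le> G0 / w0) \<and>
         (\<forall>k x. \<bar>u (x + k) - u x\<bar> \<le> K * norm k) \<and>
         (\<forall>k x y. \<bar>(u (x + k) - u x) - (u (y + k) - u y)\<bar> \<le> K * norm k * ((norm (x - y))\<^sup>2 + h\<^sup>2) powr (\<alpha> / 2)))"
    using scheme_uniform_estimates by auto
  define h where "h n = (1/2::real) ^ n" for n :: nat
  have h: "0 < h n" "h n \<le> 1" for n by (auto simp: h_def power_le_one)
  have "\<exists>u. continuous_on UNIV u \<and> zn_periodic u \<and> (\<forall>y. scheme (h n) (l0 * h n) u y = 0) \<and> (\<forall>y. \<bar>(l0 * h n) * u y\<bar> \<le> G0 / w0) \<and>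
         (\<forall>k x. \<bar>u (x + k) - u x\<bar> \<le> K * norm k) \<and>
         (\<forall>k x y. \<bar>(u (x + k) - u x) - (u (y + k) - u y)\<bar> \<le> K * norm k * ((norm (x - y))\<^sup>2 + (h n)\<^sup>2) powr (\<alpha> / 2))" for n
    by (rule est) (use h l0 in auto)
  then obtain u where ucont: "\<And>n. continuous_on UNIV (u n)" and uper: "\<And>n. zn_periodic (u n)"
    and sol: "\<And>n y. scheme (h n) (l0 * h n) (u n) y = 0" and ub: "\<And>n y. \<bar>(l0 * h n) * u n y\<bar> \<le> G0 / w0"
    and ulip: "\<And>n k x. \<bar>u n (x + k) - u n x\<bar> \<le> K * norm k"
    and uinc: "\<And>n k x y. \<bar>(u n (x + k) - u n x) - (u n (y + k) - u n y)\<bar> \<le> K * norm k * ((norm (x - y))\<^sup>2 + (h n)\<^sup>2) powr (\<alpha> / 2)"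
    by metis
  have ulip': "\<bar>u n x - u n y\<bar> \<le> K * norm (x - y)" for n x y using ulip[of n y "x - y"] by simp
  \<comment> \<open>The constant second component lets a single compactness argument select one
    subsequence for the normalized functions and for the constant.\<close>
  define \<F> where "\<F> n y = (u n y - u n 0, l0 * h n * u n 0)" for n y
  obtain g \<rho> where \<rho>: "strict_mono (\<rho> :: nat \<Rightarrow> nat)"
    and g: "\<And>e. 0 < e \<Longrightarrow> \<exists>N. \<forall>n x. n \<ge> N \<and> x \<in> cbox 0 1 \<longrightarrow> norm (\<F> (\<rho> n) x - g x) < e"
  proof (rule Arzela_Ascoli[of "cbox (0::real^'n) 1" \<F> "K * ?N + G0 / w0"])
    show "norm (\<F> n x) \<le> K * ?N + G0 / w0" if "x \<in> cbox 0 1" for n x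
    proof -
      have "norm (\<F> n x) \<le> \<bar>u n x - u n 0\<bar> + \<bar>l0 * h n * u n 0\<bar>"
        unfolding \<F>_def using norm_Pair_le by (metis real_norm_def)
      also have "\<dots> \<le> K * norm x + G0 / w0" using ulip'[of n x 0] ub[of n 0] by simp
      also have "\<dots> \<le> K * ?N + G0 / w0" using norm_unit_cube_le[OF that] K by simp
      finally show ?thesis .
    qed
    show "\<exists>d>0. \<forall>n y. y \<in> cbox 0 1 \<and> norm (x - y) < d \<longrightarrow> norm (\<F> n x - \<F> n y) < e" if "0 < e" for x e
    proof (intro exI[of _ "e / K"] conjI allI impI)
      fix n y assume y: "y \<in> cbox 0 1 \<and> norm (x - y) < e / K"
      have "norm (\<F> n x - \<F> n y) = \<bar>u n x - u n y\<bar>" by (simp add: \<F>_def)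
      also have "\<dots> \<le> K * norm (x - y)" by (rule ulip')
      also have "\<dots> < e" using y K by (simp add: field_simps)
      finally show "norm (\<F> n x - \<F> n y) < e" .
    qed (use that K in simp)
  qed auto
  have \<F>lim: "(\<lambda>n. \<F> (\<rho> n) y) \<longlonglongrightarrow> g y" if "y \<in> cbox 0 1" for y
    using g that by (intro LIMSEQ_I) blast
  define U where "U n = u (\<rho> n)" for n
  define hh where "hh n = h (\<rho> n)" for n
  have hh0: "hh \<longlonglongrightarrow> 0"
  proof -
    have "h \<longlonglongrightarrow> 0" unfolding h_def by (rule LIMSEQ_power_zero) simp
    then show ?thesis unfolding hh_def using LIMSEQ_subseq_LIMSEQ[OF _ \<rho>] by (simp add: o_def)
  qed
  have hhp: "0 < hh n" "hh n \<le> 1" for n using h by (auto simp: hh_def)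
  have "\<exists>c. (\<lambda>n. U n y - U n 0) \<longlonglongrightarrow> c" for y
  proof -
    obtain k where k: "\<forall>i. k $ i \<in> \<int>" "y + k \<in> cbox 0 1" by (rule zn_periodic_representative)
    have "U n (y + k) = U n y" for n using uper k(1) unfolding U_def zn_periodic_def by blast
    then show ?thesis using tendsto_fst[OF \<F>lim[OF k(2)]] by (auto simp: \<F>_def U_def)
  qed
  then obtain \<psi> where \<psi>: "\<And>y. (\<lambda>n. U n y - U n 0) \<longlonglongrightarrow> \<psi> y" by metis
  have conv: "(\<lambda>n. U n x - U n y) \<longlonglongrightarrow> \<psi> x - \<psi> y" for x y
    using tendsto_diff[OF \<psi>[of x] \<psi>[of y]] by simp
  obtain \<gamma> where \<gamma>: "(\<lambda>n. l0 * hh n * U n 0) \<longlonglongrightarrow> \<gamma>"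
  proof -
    obtain k where k: "0 + k \<in> cbox 0 (1::real^'n)" by (rule zn_periodic_representative)
    show thesis using tendsto_snd[OF \<F>lim[OF k]] that by (auto simp: \<F>_def U_def hh_def)
  qed
  have \<gamma>': "(\<lambda>n. l0 * hh n * U n y) \<longlonglongrightarrow> \<gamma>" for y
  proof -
    have "(\<lambda>n. l0 * hh n * U n 0 + l0 * hh n * (U n y - U n 0)) \<longlonglongrightarrow> \<gamma> + l0 * 0 * \<psi> y"
      by (intro tendsto_intros \<gamma> hh0 \<psi>)
    then show ?thesis by (simp add: algebra_simps)
  qed
  have Uinc: "\<bar>(U n (x + k) - U n x) - (U n (y + k) - U n y)\<bar> \<le> K * norm k * ((norm (x - y))\<^sup>2 + (hh n)\<^sup>2) powr (\<alpha> / 2)" for n k x y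
    unfolding U_def hh_def by (rule uinc)
  have \<psi>per: "zn_periodic \<psi>"
    unfolding zn_periodic_def
  proof (intro allI impI)
    fix y k :: "real^'n" assume "\<forall>i. k $ i \<in> \<int>"
    then have "U n (y + k) = U n y" for n using uper unfolding U_def zn_periodic_def by blast
    then show "\<psi> (y + k) = \<psi> y" using \<psi>[of "y + k"] \<psi>[of y] by (simp add: LIMSEQ_unique)
  qed
  have \<psi>C1: "C1_holder_torus \<alpha> \<psi>"
  proof (rule holder_increments_C1[OF \<psi>per less_imp_le[OF K] \<alpha>(1)])
    fix k x y
    show "\<bar>\<psi> (x + k) - \<psi> x\<bar> \<le> K * norm k"
      by (rule tendsto_upperbound[OF tendsto_rabs[OF conv] always_eventually]) (use ulip in \<open>auto simp: U_def\<close>)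
    have lim1: "(\<lambda>n. \<bar>(U n (x + k) - U n x) - (U n (y + k) - U n y)\<bar>) \<longlonglongrightarrow> \<bar>(\<psi> (x + k) - \<psi> x) - (\<psi> (y + k) - \<psi> y)\<bar>"
      by (intro tendsto_intros conv)
    have "(\<lambda>n. K * norm k * ((norm (x - y))\<^sup>2 + (hh n)\<^sup>2) powr (\<alpha> / 2)) \<longlonglongrightarrow> K * norm k * ((norm (x - y))\<^sup>2 + 0\<^sup>2) powr (\<alpha> / 2)"
      using \<alpha> by (intro tendsto_intros tendsto_powr' hh0) auto
    moreover have "((norm (x - y))\<^sup>2 + 0\<^sup>2) powr (\<alpha> / 2) = norm (x - y) powr \<alpha>"
    proof (cases "x = y")
      case False
      then have "(norm (x - y))\<^sup>2 = norm (x - y) powr 2" using powr_realpow[of "norm (x - y)" 2] by simp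
      then show ?thesis using powr_powr[of "norm (x - y)" 2 "\<alpha> / 2"] by simp
    qed simp
    ultimately have lim2: "(\<lambda>n. K * norm k * ((norm (x - y))\<^sup>2 + (hh n)\<^sup>2) powr (\<alpha> / 2)) \<longlonglongrightarrow> K * norm k * norm (x - y) powr \<alpha>" by simp
    show "\<bar>(\<psi> (x + k) - \<psi> x) - (\<psi> (y + k) - \<psi> y)\<bar> \<le> K * norm k * norm (x - y) powr \<alpha>"
      by (rule LIMSEQ_le[OF lim1 lim2]) (use Uinc in blast)
  qed
  have \<alpha>1: "\<alpha> < 1" using \<alpha> by simp
  have der: "(\<lambda>n. (U n (y + hh n *\<^sub>R e) - U n y) / hh n) \<longlonglongrightarrow> grad \<psi> y \<bullet> e" if "norm e = 1" for y e
    unfolding hh_def h_def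
    by (rule discrete_derivative_converges[OF \<alpha>(1) \<alpha>1 less_imp_le[OF K] that \<rho> Uinc[unfolded hh_def h_def] conv \<psi>C1])
  have derp: "(\<lambda>n. (U n (y + hh n *\<^sub>R axis i 1) - U n y) / hh n) \<longlonglongrightarrow> grad \<psi> y $ i" for y i
    using der[of "axis i 1" y] by (simp add: inner_axis)
  have derm: "(\<lambda>n. (U n (y - hh n *\<^sub>R axis i 1) - U n y) / hh n) \<longlonglongrightarrow> - grad \<psi> y $ i" for y i
    using der[of "- axis i 1" y] by (simp add: inner_axis)
  have grad_lim: "(\<lambda>n. central_grad (hh n) (U n) y) \<longlonglongrightarrow> grad \<psi> y" for y
  proof (rule vec_tendstoI)
    fix i
    have "(\<lambda>n. ((U n (y + hh n *\<^sub>R axis i 1) - U n y) / hh n - (U n (y - hh n *\<^sub>R axis i 1) - U n y) / hh n) / 2)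
        \<longlonglongrightarrow> (grad \<psi> y $ i - - grad \<psi> y $ i) / 2"
      by (intro tendsto_intros derp derm) auto
    moreover have "((U n (y + hh n *\<^sub>R axis i 1) - U n y) / hh n - (U n (y - hh n *\<^sub>R axis i 1) - U n y) / hh n) / 2
        = central_grad (hh n) (U n) y $ i" for n
      by (simp add: central_grad_def diff_divide_distrib)
    ultimately show "(\<lambda>n. central_grad (hh n) (U n) y $ i) \<longlonglongrightarrow> grad \<psi> y $ i" by simp
  qed
  \<comment> \<open>The viscosity is -L times the sum of the one-sided quotients in opposite
    directions, whose limits cancel.\<close>
  have visc_lim: "(\<lambda>n. viscosity (hh n) (U n) y) \<longlonglongrightarrow> 0" for y
  proof -
    have "(\<lambda>n. \<Sum>i\<in>UNIV. - L * ((U n (y + hh n *\<^sub>R axis i 1) - U n y) / hh n + (U n (y - hh n *\<^sub>R axis i 1) - U n y) / hh n))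
       \<longlonglongrightarrow> (\<Sum>i\<in>(UNIV::'n set). - L * (grad \<psi> y $ i + - grad \<psi> y $ i))"
      by (intro tendsto_intros derp derm)
    moreover have "- L * ((U n (y + hh n *\<^sub>R axis i 1) - U n y) / hh n + (U n (y - hh n *\<^sub>R axis i 1) - U n y) / hh n)
       = L / hh n * (2 * U n y - U n (y + hh n *\<^sub>R axis i 1) - U n (y - hh n *\<^sub>R axis i 1))" for n i
      using hhp[of n] by (simp add: field_simps)
    ultimately show ?thesis by (simp add: viscosity_def)
  qed
  have jump_lim: "(\<lambda>n. truncated_jump_integral (hh n) (U n) y) \<longlonglongrightarrow> jump_integral \<psi> y" for y
    unfolding truncated_jump_integral_def jump_integral_def
  proof (rule integral_dominated_convergence)
    \<comment> \<open>The first summand serves |z| \<le> 1: a second difference is the difference of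
      two increments by z based at y and y - z, and on the support of the truncated kernel h may be
      replaced by |z| in its bound. The second serves |z| > 1, where periodicity bounds the
      oscillation by K N.\<close>
    let ?C = "2 * K + 2 * K * ?N"
    have [measurable]: "second_diff (U n) y \<in> borel_measurable borel" for n unfolding U_def by (rule second_diff_measurable[OF ucont])
    have [measurable]: "second_diff \<psi> y \<in> borel_measurable borel" by (rule second_diff_measurable[OF C1_holder_torus_continuous[OF \<psi>C1]])
    show "(\<lambda>z. second_diff (U n) y z * indicat_real {z. hh n < norm z} z * jump_kernel z) \<in> borel_measurable lborel" for n by measurable
    show "(\<lambda>z. second_diff \<psi> y z * jump_kernel z) \<in> borel_measurable lborel" by measurable
    show "integrable lborel (\<lambda>z::real^'n. ?C * (jump_weight \<alpha> z * jump_kernel z))"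
      by (intro integrable_mult_right jump_weight_integrable \<alpha>)
    show "AE z in lborel. (\<lambda>n. second_diff (U n) y z * indicat_real {z. hh n < norm z} z * jump_kernel z) \<longlonglongrightarrow> second_diff \<psi> y z * jump_kernel z"
    proof (rule AE_I2)
      fix z :: "real^'n"
      show "(\<lambda>n. second_diff (U n) y z * indicat_real {z. hh n < norm z} z * jump_kernel z) \<longlonglongrightarrow> second_diff \<psi> y z * jump_kernel z"
      proof (cases "z = 0")
        case False
        have sd: "second_diff f y z = (f (y + z) - f y) + (f (y - z) - f y)" for f by (simp add: second_diff_def)
        have "(\<lambda>n. second_diff (U n) y z) \<longlonglongrightarrow> second_diff \<psi> y z" unfolding sd by (intro tendsto_intros conv)
        moreover have "(\<lambda>n. indicat_real {z. hh n < norm z} z) \<longlonglongrightarrow> 1"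
        proof (rule tendsto_eventually)
          have "\<forall>\<^sub>F n in sequentially. hh n < norm z" using order_tendstoD(2)[OF hh0, of "norm z"] False by simp
          then show "\<forall>\<^sub>F n in sequentially. indicat_real {z. hh n < norm z} z = 1" by eventually_elim simp
        qed
        ultimately have "(\<lambda>n. second_diff (U n) y z * indicat_real {z. hh n < norm z} z * jump_kernel z) \<longlonglongrightarrow> second_diff \<psi> y z * 1 * jump_kernel z"
          by (intro tendsto_intros)
        then show ?thesis by simp
      qed simp
    qed
    show "AE z in lborel. norm (second_diff (U n) y z * indicat_real {z. hh n < norm z} z * jump_kernel z) \<le> ?C * (jump_weight \<alpha> z * jump_kernel z)" for n
    proof (rule AE_I2)
      fix z :: "real^'n"
      have sd: "second_diff (U n) y z = (U n (y + z) - U n y) - (U n ((y - z) + z) - U n (y - z))" by (simp add: second_diff_def)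
      have "\<bar>second_diff (U n) y z\<bar> \<le> ?C * jump_weight \<alpha> z" if z: "hh n < norm z"
      proof (cases "norm z \<le> 1")
        case True
        then have w: "jump_weight \<alpha> z = norm z powr (1 + \<alpha>)"
          unfolding jump_weight_def using \<alpha> by (intro powr_ge_sqrt_iff) auto
        have z0: "0 < norm z" using z hhp[of n] by linarith
        have "\<bar>second_diff (U n) y z\<bar> \<le> K * norm z * ((norm (y - (y - z)))\<^sup>2 + (hh n)\<^sup>2) powr (\<alpha> / 2)"
          unfolding sd by (rule Uinc)
        also have "\<dots> \<le> K * norm z * (2 * norm z powr \<alpha>)"
        proof (rule mult_left_mono)
          have "(hh n)\<^sup>2 \<le> (norm z)\<^sup>2" using z hhp[of n] by (intro power_mono) auto
          then have "((norm (y - (y - z)))\<^sup>2 + (hh n)\<^sup>2) powr (\<alpha> / 2) \<le> (2 * (norm z)\<^sup>2) powr (\<alpha> / 2)"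
            using \<alpha> by (intro powr_mono2) auto
          also have "\<dots> = 2 powr (\<alpha> / 2) * norm z powr \<alpha>"
          proof -
            have "(norm z)\<^sup>2 = norm z powr 2" using z0 powr_realpow[of "norm z" 2] by simp
            then have "(norm z)\<^sup>2 powr (\<alpha> / 2) = norm z powr \<alpha>" using powr_powr[of "norm z" 2 "\<alpha> / 2"] by simp
            then show ?thesis by (simp add: powr_mult)
          qed
          also have "\<dots> \<le> 2 powr 1 * norm z powr \<alpha>" using \<alpha> by (intro mult_right_mono powr_mono) auto
          finally show "((norm (y - (y - z)))\<^sup>2 + (hh n)\<^sup>2) powr (\<alpha> / 2) \<le> 2 * norm z powr \<alpha>" by simp
        qed (use K in simp)
        also have "\<dots> = 2 * K * jump_weight \<alpha> z" using z0 by (simp add: w powr_add)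
        also have "\<dots> \<le> ?C * jump_weight \<alpha> z" using K by (intro mult_right_mono) auto
        finally show ?thesis .
      next
        case False
        then have w: "jump_weight \<alpha> z = sqrt (norm z)"
          unfolding jump_weight_def using \<alpha> by (intro powr_ge_sqrt_iff) auto
        have bd: "\<bar>U n a - U n b\<bar> \<le> K * ?N" for a b
        proof -
          have "zn_periodic (U n)" using uper by (simp add: U_def)
          then obtain b' where b': "U n b' = U n b" "norm (a - b') \<le> ?N" using zn_periodic_nearby by blast
          have "\<bar>U n a - U n b'\<bar> \<le> K * norm (a - b')" unfolding U_def by (rule ulip')
          also have "\<dots> \<le> K * ?N" using b' K by (intro mult_left_mono) auto
          finally show ?thesis using b' by simp
        qed
        have "\<bar>second_diff (U n) y z\<bar> \<le> 2 * K * ?N"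
          unfolding sd using bd[of "y + z" y] bd[of "(y - z) + z" "y - z"] by linarith
        also have "\<dots> \<le> ?C * 1" using K by simp
        also have "\<dots> \<le> ?C * jump_weight \<alpha> z" using False K by (intro mult_left_mono) (auto simp: w)
        finally show ?thesis .
      qed
      then have "\<bar>second_diff (U n) y z\<bar> * indicat_real {z. hh n < norm z} z \<le> ?C * jump_weight \<alpha> z"
        using K by (cases "hh n < norm z") auto
      then have "\<bar>second_diff (U n) y z\<bar> * indicat_real {z. hh n < norm z} z * jump_kernel z \<le> ?C * jump_weight \<alpha> z * jump_kernel z"
        by (intro mult_right_mono) auto
      then show "norm (second_diff (U n) y z * indicat_real {z. hh n < norm z} z * jump_kernel z) \<le> ?C * (jump_weight \<alpha> z * jump_kernel z)"
        by (simp add: abs_mult mult.assoc)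
    qed
  qed
  have eq: "\<gamma> * w y - \<kappa> / 2 * jump_integral \<psi> y + 0 + G y (grad \<psi> y) = 0" for y
  proof (rule LIMSEQ_unique)
    show "(\<lambda>n. (l0 * hh n * U n y) * w y - \<kappa> / 2 * truncated_jump_integral (hh n) (U n) y + viscosity (hh n) (U n) y + G y (central_grad (hh n) (U n) y))
       \<longlonglongrightarrow> \<gamma> * w y - \<kappa> / 2 * jump_integral \<psi> y + 0 + G y (grad \<psi> y)"
      by (intro tendsto_intros \<gamma>' jump_lim visc_lim G_continuous_compose[OF tendsto_const grad_lim])
    have "(l0 * hh n * U n y) * w y - \<kappa> / 2 * truncated_jump_integral (hh n) (U n) y + viscosity (hh n) (U n) y + G y (central_grad (hh n) (U n) y) = 0" for n
      using sol[of "\<rho> n" y] unfolding scheme_def U_def hh_def by (simp add: ac_simps)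
    then show "(\<lambda>n. (l0 * hh n * U n y) * w y - \<kappa> / 2 * truncated_jump_integral (hh n) (U n) y + viscosity (hh n) (U n) y + G y (central_grad (hh n) (U n) y)) \<longlonglongrightarrow> 0"
      by simp
  qed
  have "- (\<kappa> / 2) * jump_integral \<psi> y + G y (grad \<psi> y) = (- \<gamma>) * w y" for y
    using eq[of y] by (simp add: algebra_simps)
  then show ?thesis using \<alpha> \<alpha>1 \<psi>C1 by blast
qed

end

subsection \<open>Comparison and uniqueness\<close>

text \<open>The kernel is positive off the origin, so the integrand can only vanish almost
  everywhere if f does; by continuity a nonzero value would persist on a ball of positive
  measure.\<close>

lemma second_diff_nonneg_integral_zero:
  fixes f :: "real^'n \<Rightarrow> real"
  assumes cont: "continuous_on UNIV f" and nonneg: "\<And>z. 0 \<le> f z"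
    and int: "integrable lborel (\<lambda>z. f z * jump_kernel z)" and zero: "(LINT z|lborel. f z * jump_kernel z) = 0"
  shows "z \<noteq> 0 \<Longrightarrow> f z = 0"
proof (rule ccontr)
  assume z: "z \<noteq> 0" "f z \<noteq> 0"
  have "AE z in lborel. f z * jump_kernel z = 0"
    using integral_nonneg_eq_0_iff_AE[OF int] nonneg zero by simp
  moreover have "AE z in lborel. z \<noteq> (0::real^'n)" by (rule AE_lborel_singleton)
  ultimately have ae: "AE z in lborel. f z = 0"
    by eventually_elim (auto simp: jump_kernel_def)
  have "open {z. f z \<noteq> 0}" by (intro open_Collect_neq cont continuous_on_const)
  then obtain e where e: "0 < e" "ball z e \<subseteq> {z. f z \<noteq> 0}" using z open_contains_ball by blast
  have "AE x in lborel. x \<notin> ball z e" using ae by eventually_elim (use e in auto)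
  then have "emeasure lborel (ball z e) = 0"
    by (subst (asm) AE_iff_measurable[of "ball z e"]) auto
  then show False using e(1) content_ball_gt_0_iff[of z e] by (simp add: measure_def)
qed

text \<open>The same jump z is applied at x and at y, and the hypothesis says that the resulting
  difference is minimal at z = 0. The first-order condition identifies the gradients; adding the
  inequalities for z and -z orders the jump integrals. In the case of equality both of these
  nonnegative terms vanish. It serves with \<mu> = 1 for comparison and with \<mu> < 1 for the
  gradient bound.\<close>

lemma synchronous_coupling:
  fixes u v :: "real^'n \<Rightarrow> real"
  assumes u: "C1_holder_torus \<alpha> u" "0 < \<alpha>" "\<alpha> < 1" and v: "C1_holder_torus \<beta> v" "0 < \<beta>" "\<beta> < 1"
    and le: "\<And>z. \<mu> * (u (x + z) - u x) \<le> v (y + z) - v y"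
  shows "\<mu> *\<^sub>R grad u x = grad v y" "\<mu> * jump_integral u x \<le> jump_integral v y"
    "\<mu> * jump_integral u x = jump_integral v y \<Longrightarrow> \<mu> * (u (x + z) - u x) = v (y + z) - v y"
proof -
  let ?f = "\<lambda>z. (v (y + z) - v y) - \<mu> * (u (x + z) - u x)"
  have "GDERIV ?f 0 :> grad v y - \<mu> *\<^sub>R grad u x"
  proof -
    have shift: "((\<lambda>z. f (a + z)) has_derivative (\<lambda>h. h \<bullet> D)) (at 0)" if "GDERIV f a :> D" for f :: "real^'n \<Rightarrow> real" and a D
    proof -
      have "((\<lambda>z. a + z) has_derivative (\<lambda>h. h)) (at 0)" by (auto intro!: derivative_eq_intros)
      from has_derivative_compose[OF this, of f "\<lambda>h. h \<bullet> D"] show ?thesis using that unfolding gderiv_def by simp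
    qed
    note du = shift[OF C1_holder_torus_gderiv[OF u(1), of x]] and dv = shift[OF C1_holder_torus_gderiv[OF v(1), of y]]
    show ?thesis unfolding gderiv_def
      by (auto intro!: derivative_eq_intros du dv simp: inner_diff_right)
  qed
  then have "(\<lambda>h. h \<bullet> (grad v y - \<mu> *\<^sub>R grad u x)) = (\<lambda>h. 0)"
    unfolding gderiv_def
    by (rule differential_zero_maxmin[of 0 UNIV, rotated 2]) (use le in auto)
  then have "(grad v y - \<mu> *\<^sub>R grad u x) \<bullet> (grad v y - \<mu> *\<^sub>R grad u x) = 0" by metis
  then show "\<mu> *\<^sub>R grad u x = grad v y" by simp
  let ?s = "\<lambda>z. second_diff v y z - \<mu> * second_diff u x z"
  have s0: "0 \<le> ?s z" for z using le[of z] le[of "- z"] by (simp add: second_diff_def algebra_simps)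
  note iu = second_diff_integrable[OF u, of x] and iv = second_diff_integrable[OF v, of y]
  have eq: "?s z * jump_kernel z = second_diff v y z * jump_kernel z - \<mu> * (second_diff u x z * jump_kernel z)" for z
    by (simp add: algebra_simps)
  have ints: "integrable lborel (\<lambda>z. ?s z * jump_kernel z)" unfolding eq using iu iv by (intro Bochner_Integration.integrable_diff integrable_mult_right)
  have lints: "(LINT z|lborel. ?s z * jump_kernel z) = jump_integral v y - \<mu> * jump_integral u x"
    unfolding eq jump_integral_def using iu iv by (subst Bochner_Integration.integral_diff) auto
  have "0 \<le> (LINT z|lborel. ?s z * jump_kernel z)" using s0 by (intro integral_nonneg_AE) simp
  then show "\<mu> * jump_integral u x \<le> jump_integral v y" using lints by simp
  assume "\<mu> * jump_integral u x = jump_integral v y"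
  then have z0: "(LINT z|lborel. ?s z * jump_kernel z) = 0" using lints by simp
  have cs: "continuous_on UNIV ?s"
    unfolding second_diff_def
    by (intro continuous_intros continuous_on_translate C1_holder_torus_continuous[OF u(1)] C1_holder_torus_continuous[OF v(1)])
  have "?s z = 0"
  proof (cases "z = 0")
    case False
    then show ?thesis by (rule second_diff_nonneg_integral_zero[OF cs s0 ints z0])
  qed (simp add: second_diff_def)
  then show "\<mu> * (u (x + z) - u x) = v (y + z) - v y"
    using le[of z] le[of "- z"] by (simp add: second_diff_def algebra_simps)
qed

text \<open>At a maximum of the difference the first-order parts coincide, so only the jump terms
  decide the sign of c - d. One inequality suffices, since the roles of the two solutions can be
  exchanged; equal constants give the equality case of the coupling.\<close>

lemma cell_equation_unique:
  fixes \<psi> \<phi> :: "real^'n \<Rightarrow> real"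
  assumes \<psi>: "C1_holder_torus \<alpha> \<psi>" "0 < \<alpha>" "\<alpha> < 1" and \<phi>: "C1_holder_torus \<beta> \<phi>" "0 < \<beta>" "\<beta> < 1"
    and \<kappa>: "0 < \<kappa>" and w: "\<And>y. 0 < w y"
    and eq1: "\<And>y. - (\<kappa> / 2) * jump_integral \<psi> y + G y (grad \<psi> y) = c * w y"
    and eq2: "\<And>y. - (\<kappa> / 2) * jump_integral \<phi> y + G y (grad \<phi> y) = d * w y"
  shows "d \<le> c" "c = d \<Longrightarrow> \<exists>k. \<forall>y. \<psi> y = \<phi> y + k"
proof -
  have "zn_periodic (\<lambda>y. \<psi> y - \<phi> y)" using \<psi>(1) \<phi>(1) by (auto simp: C1_holder_torus_def zn_periodic_def)
  moreover have "continuous_on UNIV (\<lambda>y. \<psi> y - \<phi> y)"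
    by (intro continuous_intros C1_holder_torus_continuous[OF \<psi>(1)] C1_holder_torus_continuous[OF \<phi>(1)])
  ultimately obtain x where x: "\<And>y. \<psi> y - \<phi> y \<le> \<psi> x - \<phi> x" using zn_periodic_attains_max by blast
  have le: "1 * (\<psi> (x + z) - \<psi> x) \<le> \<phi> (x + z) - \<phi> x" for z using x[of "x + z"] by simp
  note sc = synchronous_coupling[OF \<psi> \<phi> le]
  have g: "grad \<psi> x = grad \<phi> x" using sc(1) by simp
  have J: "jump_integral \<psi> x \<le> jump_integral \<phi> x" using sc(2) by simp
  have diff: "(c - d) * w x = \<kappa> / 2 * (jump_integral \<phi> x - jump_integral \<psi> x)"
    using eq1[of x] eq2[of x] unfolding g by (simp add: algebra_simps)
  moreover have "0 \<le> \<kappa> / 2 * (jump_integral \<phi> x - jump_integral \<psi> x)" using J \<kappa> by simp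
  ultimately have "0 \<le> (c - d) * w x" by (simp only:)
  then show "d \<le> c" using w[of x] by (auto simp: zero_le_mult_iff)
  assume "c = d"
  then have "1 * jump_integral \<psi> x = jump_integral \<phi> x" using diff \<kappa> by simp
  from sc(3)[OF this] have d: "\<psi> (x + z) - \<psi> x = \<phi> (x + z) - \<phi> x" for z by simp
  have "\<psi> y = \<phi> y + (\<psi> x - \<phi> x)" for y using d[of "y - x"] by (simp add: algebra_simps)
  then show "\<exists>k. \<forall>y. \<psi> y = \<phi> y + k" by blast
qed

subsection \<open>A priori gradient bound\<close>

text \<open>Turns a one-sided comparison along a segment starting at a contact point into an
  inequality for the gradient.\<close>

lemma right_derivative_mono:
  fixes f g :: "real \<Rightarrow> real"
  assumes f: "(f has_real_derivative D) (at 0)" and g: "(g has_real_derivative E) (at 0)"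
    and eq: "f 0 = g 0" and le: "\<And>t. 0 < t \<Longrightarrow> t < d \<Longrightarrow> f t \<le> g t" and d: "0 < d"
  shows "D \<le> E"
proof (rule ccontr)
  assume "\<not> D \<le> E"
  then have "0 < D - E" by simp
  moreover have "((\<lambda>t. f t - g t) has_real_derivative D - E) (at 0)" using f g by (auto intro!: derivative_eq_intros)
  ultimately obtain e where e: "0 < e" "\<And>h. 0 < h \<Longrightarrow> h < e \<Longrightarrow> f 0 - g 0 < f (0 + h) - g (0 + h)"
    using DERIV_pos_inc_right by blast
  obtain h where h: "0 < h" "h < e" "h < d" using field_lbound_gt_zero[OF e(1) d] by blast
  have "f 0 - g 0 < f (0 + h) - g (0 + h)" using h by (intro e(2)) auto
  then show False using le[of h] h eq by simp
qed

text \<open>The structure of the first-order part used for the gradient bound, with the gradient variable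
  cut off at \<open>R\<close>. The parameter \<open>\<rho>\<close> carries the size of the data.\<close>

definition coercive_structure ::
  "real \<Rightarrow> real \<Rightarrow> real \<Rightarrow> real \<Rightarrow> real \<Rightarrow> real \<Rightarrow> real \<Rightarrow> (real^'n \<Rightarrow> real^'n \<Rightarrow> real) \<Rightarrow> bool" where
  "coercive_structure m b1 C1 C2 C4 \<rho> R F \<longleftrightarrow>
    (\<forall>\<mu> y q. 0 < \<mu> \<longrightarrow> \<mu> < 1 \<longrightarrow>
       (1 - \<mu>) * (b1 * min (norm q) R powr m - C1 * \<rho> powr m) \<le> \<mu> * F y ((1 / \<mu>) *\<^sub>R q) - F y q) \<and>
    (\<forall>y y' q. \<bar>F y q - F y' q\<bar> \<le> C2 * (\<rho> powr m + min (norm q) R powr m) * norm (y - y')) \<and>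
    (\<forall>y q. norm q \<le> 2 * \<rho> \<longrightarrow> \<bar>F y q\<bar> \<le> C4 * \<rho> powr m)"

text \<open>At the doubling maximum the two equations give \<mu> F(a, q/\<mu>) \<le> F(b, q).
  Subtracting F(a, q), coercivity bounds the left side below by (1 - \<mu>) (b1/2) \<tau>^m, and
  regularity in space bounds the right side above by 2 C2 \<tau>^m r, with \<tau> = min |q| R. The
  factor \<tau>^m cancels, so R does not enter the result, and L r < 2 (1 - \<mu>) contradicts the
  choice of L.\<close>

lemma gradient_bound_by_oscillation:
  fixes u :: "real^'n \<Rightarrow> real"
  assumes b1: "0 < b1" and C1: "0 \<le> C1" and C2: "0 \<le> C2" and m: "1 < m" and \<rho>: "1 \<le> \<rho>"
    and T0: "1 \<le> T0" "2 * C1 \<le> b1 * T0 powr m" and R: "T0 * \<rho> \<le> R"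
    and str: "coercive_structure m b1 C1 C2 C4 \<rho> R F"
    and u: "C1_holder_torus \<alpha> u" "0 < \<alpha>" "\<alpha> < 1" and \<kappa>: "0 < \<kappa>"
    and eq: "\<And>y. - (\<kappa> / 2) * jump_integral u y + F y (grad u y) = 0"
    and osc: "0 < \<omega>" "\<And>x y. u x - u y \<le> \<omega>"
  shows "norm (grad u y) \<le> 2 * max ((8 * C2 / b1 + 1) * \<omega>) (T0 * \<rho>)"
proof -
  \<comment> \<open>The first entry defeats b1 (1 - \<mu>) \<le> 4 C2 r. The second gives L \<omega>
    \<ge> T0 \<rho>, so the gradient at contact is large enough for \<tau>^m to absorb C1
    \<rho>^m.\<close>
  define L where "L = max (8 * C2 / b1 + 1) (T0 * \<rho> / \<omega>)"
  have L: "8 * C2 / b1 + 1 \<le> L" "T0 * \<rho> \<le> L * \<omega>" "0 < L"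
  proof -
    have "T0 * \<rho> / \<omega> \<le> L" by (simp add: L_def)
    then show "T0 * \<rho> \<le> L * \<omega>" using osc(1) by (simp add: field_simps)
    show "8 * C2 / b1 + 1 \<le> L" by (simp add: L_def)
    moreover have "0 < 8 * C2 / b1 + 1" using b1 C2 by (simp add: add_nonneg_pos)
    ultimately show "0 < L" by linarith
  qed
  have ucont: "continuous_on UNIV u" by (rule C1_holder_torus_continuous[OF u(1)])
  have uper: "zn_periodic u" using u(1) by (simp add: C1_holder_torus_def)
  obtain x0 where x0: "\<And>y. u x0 \<le> u y" using zn_periodic_attains_min[OF uper ucont] by blast
  \<comment> \<open>The shift puts U between \<omega> and 2\<omega>, so the quotient \<mu> stays
    above 1/2.\<close>
  define U where "U y = u y - u x0 + \<omega>" for y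
  have U: "\<omega> \<le> U y" "U y \<le> 2 * \<omega>" "0 < U y" for y using x0[of y] osc(2)[of y x0] osc(1) by (auto simp: U_def)
  define v where "v y = ln (U y)" for y
  have vper: "zn_periodic v" using uper by (simp add: zn_periodic_def v_def U_def)
  have vcont: "continuous_on UNIV v" unfolding v_def
    by (intro continuous_on_ln) (use U(3) in \<open>auto simp: U_def intro!: continuous_intros ucont less_imp_neq[THEN not_sym]\<close>)
  have vlip: "v x - v y \<le> L * norm (x - y)" for x y
  proof (rule ccontr)
    assume "\<not> v x - v y \<le> L * norm (x - y)"
    then have pos0: "0 < v x - v y - L * norm (x - y)" by simp
    have "\<exists>a b. norm (a - b) \<le> real CARD('n) \<and> (\<forall>x y. v x - v y - L * norm (x - y) \<le> v a - v b - L * norm (a - b))"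
      using L(3) by (intro periodic_doubling_attains_max[OF vper vcont, of "\<lambda>r. L * r"]) (auto intro!: continuous_intros)
    then obtain a b where ab: "\<And>x y. v x - v y - L * norm (x - y) \<le> v a - v b - L * norm (a - b)" by blast
    define r where "r = norm (a - b)"
    have pos: "L * r < v a - v b" using ab[of x y] pos0 unfolding r_def by linarith
    have r: "0 < r" unfolding r_def using pos r_def by (cases "a = b") auto
    define \<mu> where "\<mu> = U b / U a"
    have vab: "v a - v b = ln (1 / \<mu>)" using U(3)[of a] U(3)[of b] by (simp add: v_def \<mu>_def ln_div)
    have \<mu>0: "0 < \<mu>" using U(3) by (simp add: \<mu>_def)
    have "0 < v a - v b" using pos L(3) r by (smt (verit) mult_pos_pos)
    then have \<mu>1: "\<mu> < 1" unfolding vab using \<mu>0 by (simp add: ln_div)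
    have \<mu>2: "1 / 2 \<le> \<mu>" using U(2)[of a] U(1)[of b] U(3)[of a] by (simp add: \<mu>_def field_simps)
    have sync: "\<mu> * (u (a + z) - u a) \<le> u (b + z) - u b" for z
    proof -
      have "v (a + z) - v (b + z) \<le> v a - v b" using ab[of "a + z" "b + z"] by simp
      then have "exp (v (a + z) + v b) \<le> exp (v a + v (b + z))" by simp
      then have "U (a + z) * U b \<le> U a * U (b + z)" using U(3) by (simp add: exp_add v_def)
      then have 1: "\<mu> * U (a + z) \<le> U (b + z)" using U(3)[of a] by (simp add: \<mu>_def field_simps)
      have "\<mu> * U a = U b" using U(3)[of a] by (simp add: \<mu>_def)
      then have "\<mu> * (U (a + z) - U a) \<le> U (b + z) - U b" using 1 by (simp add: right_diff_distrib)
      then show ?thesis by (simp add: U_def)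
    qed
    define q where "q = grad u b"
    have ga: "grad u a = (1 / \<mu>) *\<^sub>R q" using synchronous_coupling(1)[OF u u sync] \<mu>0 unfolding q_def by (metis divide_self_if less_irrefl scaleR_one scaleR_scaleR times_divide_eq_left mult_1)
    have J: "\<mu> * jump_integral u a \<le> jump_integral u b" by (rule synchronous_coupling(2)[OF u u sync])
    have "\<mu> * F a ((1 / \<mu>) *\<^sub>R q) = \<kappa> / 2 * (\<mu> * jump_integral u a)" using eq[of a] by (simp add: ga)
    also have "\<dots> \<le> \<kappa> / 2 * jump_integral u b" using J \<kappa> by (intro mult_left_mono) auto
    also have "\<dots> = F b q" using eq[of b] by (simp add: q_def)
    finally have Fab: "\<mu> * F a ((1 / \<mu>) *\<^sub>R q) \<le> F b q" .
    \<comment> \<open>On the segment from b towards a the penalty decreases at rate L, so ln U must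
      rise from b with slope at least L; hence the gradient is at least L U(b) \<ge> L
      \<omega>.\<close>
    have nq: "T0 * \<rho> \<le> norm q"
    proof -
      define e where "e = (1 / r) *\<^sub>R (a - b)"
      have e: "norm e = 1" using r by (simp add: e_def r_def)
      have "L * U b \<le> q \<bullet> e"
      proof (rule right_derivative_mono[where d = r])
        show "((\<lambda>t. u b + U b * (exp (L * t) - 1)) has_real_derivative L * U b) (at 0)"
          by (auto intro!: derivative_eq_intros)
        show "((\<lambda>t. u (b + t *\<^sub>R e)) has_real_derivative q \<bullet> e) (at 0)"
          unfolding q_def by (rule gderiv_along_line) (use C1_holder_torus_gderiv[OF u(1)] in simp)
        show "u b + U b * (exp (L * t) - 1) \<le> u (b + t *\<^sub>R e)" if t: "0 < t" "t < r" for t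
        proof -
          have "a - b = r *\<^sub>R e" using r by (simp add: e_def)
          then have "a - (b + t *\<^sub>R e) = (r - t) *\<^sub>R e" by (simp add: scaleR_left_diff_distrib algebra_simps)
          then have "norm (a - (b + t *\<^sub>R e)) = r - t" using e t by simp
          then have "v b + L * t \<le> v (b + t *\<^sub>R e)"
            using ab[of a "b + t *\<^sub>R e"] right_diff_distrib[of L r t] unfolding r_def[symmetric] by simp
          then have "exp (v b + L * t) \<le> exp (v (b + t *\<^sub>R e))" by simp
          then have "U b * exp (L * t) \<le> U (b + t *\<^sub>R e)" using U(3) by (simp add: exp_add v_def)
          then show ?thesis by (simp add: U_def algebra_simps)
        qed
      qed (use r in auto)
      moreover have "q \<bullet> e \<le> norm q" using norm_cauchy_schwarz[of q e] e by simp
      moreover have "L * \<omega> \<le> L * U b" using L U by (intro mult_left_mono) auto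
      ultimately show ?thesis using L(2) by linarith
    qed
    define \<tau> where "\<tau> = min (norm q) R"
    have \<tau>: "T0 * \<rho> \<le> \<tau>" using nq R by (simp add: \<tau>_def)
    have pw: "T0 powr m * \<rho> powr m \<le> \<tau> powr m"
      using powr_mono2[OF _ _ \<tau>, of m] m T0 \<rho> by (simp add: powr_mult)
    have "1 \<le> T0 powr m" using T0 m by (simp add: ge_one_powr_ge_zero)
    then have pw1: "\<rho> powr m \<le> \<tau> powr m" using pw mult_right_mono[of 1 "T0 powr m" "\<rho> powr m"] by simp
    have "2 * C1 * \<rho> powr m \<le> b1 * T0 powr m * \<rho> powr m" using T0 by (intro mult_right_mono) auto
    also have "\<dots> \<le> b1 * \<tau> powr m" using pw b1 by (simp add: mult.assoc)
    finally have pw2: "b1 / 2 * \<tau> powr m \<le> b1 * \<tau> powr m - C1 * \<rho> powr m" by simp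
    have \<tau>p: "0 < \<tau> powr m" using \<tau> T0 \<rho> by (smt (verit) powr_gt_zero mult_pos_pos)
    have "(1 - \<mu>) * (b1 / 2 * \<tau> powr m) \<le> (1 - \<mu>) * (b1 * \<tau> powr m - C1 * \<rho> powr m)"
      using pw2 \<mu>1 by (intro mult_left_mono) auto
    also have "\<dots> \<le> \<mu> * F a ((1 / \<mu>) *\<^sub>R q) - F a q"
      using str \<mu>0 \<mu>1 unfolding coercive_structure_def \<tau>_def by blast
    also have "\<dots> \<le> F b q - F a q" using Fab by simp
    also have "\<dots> \<le> C2 * (\<rho> powr m + \<tau> powr m) * r"
    proof -
      have "\<bar>F b q - F a q\<bar> \<le> C2 * (\<rho> powr m + min (norm q) R powr m) * norm (b - a)"
        using str unfolding coercive_structure_def by blast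
      then show ?thesis by (simp add: \<tau>_def r_def norm_minus_commute)
    qed
    also have "\<dots> \<le> C2 * (\<tau> powr m + \<tau> powr m) * r"
      using C2 pw1 r by (intro mult_right_mono mult_left_mono) auto
    finally have "\<tau> powr m * ((1 - \<mu>) * (b1 / 2)) \<le> \<tau> powr m * (2 * C2 * r)" by (simp add: algebra_simps)
    then have 1: "(1 - \<mu>) * (b1 / 2) \<le> 2 * C2 * r" using \<tau>p by simp
    have "L * r < ln (1 / \<mu>)" using pos vab by simp
    also have "\<dots> \<le> 1 / \<mu> - 1" using \<mu>0 by (intro ln_le_minus_one) auto
    also have "\<dots> = (1 - \<mu>) / \<mu>" using \<mu>0 by (simp add: field_simps)
    also have "\<dots> \<le> (1 - \<mu>) / (1 / 2)" using \<mu>0 \<mu>1 \<mu>2 by (intro divide_left_mono) auto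
    finally have 2: "L * r < 2 * (1 - \<mu>)" by simp
    have "(8 * C2 / b1 + 1) * r \<le> L * r" using L r by (intro mult_right_mono) auto
    then have "b1 * ((8 * C2 / b1 + 1) * r) < b1 * (2 * (1 - \<mu>))" using 2 b1 by (intro mult_strict_left_mono) auto
    then have "8 * C2 * r + b1 * r < 2 * b1 * (1 - \<mu>)" using b1 by (simp add: algebra_simps)
    moreover have "2 * b1 * (1 - \<mu>) \<le> 8 * C2 * r" using 1 by (simp add: algebra_simps)
    moreover have "0 < b1 * r" using b1 r by simp
    ultimately show False by linarith
  qed
  have "norm (grad u y) \<le> L * U y"
  proof (cases "grad u y = 0")
    case False
    define e where "e = (1 / norm (grad u y)) *\<^sub>R grad u y"
    have e: "norm e = 1" using False by (simp add: e_def)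
    have "grad u y \<bullet> e \<le> L * U y"
    proof (rule right_derivative_mono[where d = 1])
      show "((\<lambda>t. u y + U y * (exp (L * t) - 1)) has_real_derivative L * U y) (at 0)"
        by (auto intro!: derivative_eq_intros)
      show "((\<lambda>t. u (y + t *\<^sub>R e)) has_real_derivative grad u y \<bullet> e) (at 0)"
        by (rule gderiv_along_line) (use C1_holder_torus_gderiv[OF u(1)] in simp)
      show "u (y + t *\<^sub>R e) \<le> u y + U y * (exp (L * t) - 1)" if t: "0 < t" for t
      proof -
        have "v (y + t *\<^sub>R e) \<le> v y + L * t" using vlip[of "y + t *\<^sub>R e" y] e t by simp
        then have "exp (v (y + t *\<^sub>R e)) \<le> exp (v y + L * t)" by simp
        then have "U (y + t *\<^sub>R e) \<le> U y * exp (L * t)" using U(3) by (simp add: exp_add v_def)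
        then show ?thesis by (simp add: U_def algebra_simps)
      qed
    qed auto
    moreover have "grad u y \<bullet> e = norm (grad u y)"
      using False by (simp add: e_def power2_norm_eq_inner[symmetric] power2_eq_square)
    ultimately show ?thesis by simp
  qed (use L(3) U(3)[of y] in simp)
  also have "\<dots> \<le> L * (2 * \<omega>)" using L U by (intro mult_left_mono) auto
  also have "\<dots> = 2 * max ((8 * C2 / b1 + 1) * \<omega>) (T0 * \<rho>)"
    unfolding L_def using osc(1) by (simp add: max_mult_distrib_right)
  finally show ?thesis .
qed

text \<open>Iterating the structure condition with \<open>\<mu> = 1/2\<close> upgrades it to superlinear growth.\<close>

lemma coercive_structure_superlinear:
  assumes b1: "0 < b1" and C1: "0 \<le> C1" and C4: "0 \<le> C4" and m: "1 < m" and A: "0 \<le> A"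
  shows "\<exists>T\<ge>1. \<forall>(F::real^'n \<Rightarrow> real^'n \<Rightarrow> real) \<rho> R C2 y q. 1 \<le> \<rho> \<longrightarrow> T * \<rho> \<le> R \<longrightarrow>
    coercive_structure m b1 C1 C2 C4 \<rho> R F \<longrightarrow> T * \<rho> \<le> norm q \<longrightarrow> A * norm q \<le> F y q"
proof -
  \<comment> \<open>After n0 doublings the coercive gain, divided by 2^n0, has grown by the factor
    2^((m-1) n0); since m > 1 this exceeds any prescribed constant.\<close>
  have "1 < 2 powr (m - 1)" using powr_less_mono[of 0 "m - 1" 2] m by simp
  then obtain n0 where "(C4 + C1 + 2 * A) * 2 / b1 < (2 powr (m - 1)) ^ n0" using real_arch_pow by blast
  then have n0: "(C4 + C1 + 2 * A) * 2 / b1 \<le> (2 powr (m - 1)) ^ n0" by simp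
  have n0': "C4 + C1 + 2 * A \<le> b1 * (2 ^ n0) powr m / 2 ^ (n0 + 1)"
  proof -
    have "(2 powr (m - 1)) ^ n0 = (2 ^ n0) powr (m - 1)"
      by (simp add: powr_realpow[symmetric] powr_powr mult.commute)
    also have "\<dots> = (2 ^ n0) powr m / 2 ^ n0" by (simp add: powr_diff)
    finally have e: "(2 powr (m - 1)) ^ n0 = (2 ^ n0) powr m / 2 ^ n0" .
    have "(C4 + C1 + 2 * A) * 2 \<le> b1 * (2 powr (m - 1)) ^ n0" using n0 b1 by (simp add: field_simps)
    then have "C4 + C1 + 2 * A \<le> b1 * ((2 ^ n0) powr m / 2 ^ n0) / 2"
      unfolding e by (simp only: pos_le_divide_eq zero_less_numeral)
    then show ?thesis by simp
  qed
  define T where "T = (2::real) ^ (n0 + 2)"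
  have T1: "1 \<le> T" unfolding T_def by (rule one_le_power) simp
  have "A * norm q \<le> F y q"
    if \<rho>: "1 \<le> \<rho>" and R: "T * \<rho> \<le> R" and str: "coercive_structure m b1 C1 C2 C4 \<rho> R F" and q: "T * \<rho> \<le> norm q"
    for F :: "real^'n \<Rightarrow> real^'n \<Rightarrow> real" and \<rho> R C2 y q
  proof -
    define x where "x = norm q / \<rho>"
    have xT: "T \<le> x" using q \<rho> by (simp add: x_def field_simps)
    then have "1 \<le> nat \<lfloor>x\<rfloor>" using T1 by (simp add: le_nat_floor)
    then have "\<exists>n. 2 ^ n \<le> nat \<lfloor>x\<rfloor> \<and> nat \<lfloor>x\<rfloor> < 2 ^ (n + 1)" by (rule ex_power_ivl1[OF order_refl])
    then obtain n where n: "2 ^ n \<le> nat \<lfloor>x\<rfloor>" "nat \<lfloor>x\<rfloor> < 2 ^ (n + 1)" by blast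
    have x0: "0 \<le> x" using xT T1 by linarith
    have xn: "2 ^ n \<le> x" "x < 2 ^ (n + 1)"
    proof -
      have "real (2 ^ n) \<le> real (nat \<lfloor>x\<rfloor>)" using n(1) by (simp only: of_nat_le_iff)
      from order_trans[OF this of_nat_floor[OF x0]] show "2 ^ n \<le> x" by simp
      have "real (nat \<lfloor>x\<rfloor> + 1) \<le> real (2 ^ (n + 1))" using n(2) by (simp only: of_nat_le_iff Suc_eq_plus1[symmetric] Suc_le_eq)
      then show "x < 2 ^ (n + 1)" using x0 by simp linarith
    qed
    have nn: "n0 < n"
    proof (rule ccontr)
      assume "\<not> n0 < n"
      then have "(2::real) ^ (n + 1) \<le> 2 ^ (n0 + 2)" by (intro power_increasing) auto
      then show False using xn(2) xT by (simp add: T_def)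
    qed
    \<comment> \<open>Halving q until its norm lies between \<rho> and 2\<rho> reaches the region
      where the third clause of the structure bounds F.\<close>
    define p where "p = (1 / 2 ^ n) *\<^sub>R q"
    have np: "norm p = norm q / 2 ^ n" by (simp add: p_def)
    have p: "\<rho> \<le> norm p" "norm p \<le> 2 * \<rho>"
      using xn \<rho> by (auto simp: np x_def field_simps)
    define f where "f j = F y (2 ^ j *\<^sub>R p) / 2 ^ j" for j
    have step: "f j + (b1 * min (norm (2 ^ j *\<^sub>R p)) R powr m - C1 * \<rho> powr m) / 2 ^ (j + 1) \<le> f (Suc j)" for j
    proof -
      have "(1 - 1/2) * (b1 * min (norm (2 ^ j *\<^sub>R p)) R powr m - C1 * \<rho> powr m) \<le> 1/2 * F y ((1 / (1/2)) *\<^sub>R (2 ^ j *\<^sub>R p)) - F y (2 ^ j *\<^sub>R p)"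
      proof -
        have H: "\<And>\<mu> y q. 0 < \<mu> \<Longrightarrow> \<mu> < 1 \<Longrightarrow>
          (1 - \<mu>) * (b1 * min (norm q) R powr m - C1 * \<rho> powr m) \<le> \<mu> * F y ((1 / \<mu>) *\<^sub>R q) - F y q"
          using str unfolding coercive_structure_def by blast
        show ?thesis by (rule H) auto
      qed
      then have "(b1 * min (norm (2 ^ j *\<^sub>R p)) R powr m - C1 * \<rho> powr m) / 2 \<le> F y (2 ^ Suc j *\<^sub>R p) / 2 - F y (2 ^ j *\<^sub>R p)" by simp
      then have "((b1 * min (norm (2 ^ j *\<^sub>R p)) R powr m - C1 * \<rho> powr m) / 2) / 2 ^ j \<le> (F y (2 ^ Suc j *\<^sub>R p) / 2 - F y (2 ^ j *\<^sub>R p)) / 2 ^ j"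
        by (intro divide_right_mono) auto
      then show ?thesis by (simp add: f_def diff_divide_distrib)
    qed
    \<comment> \<open>The losses sum geometrically to at most C1 \<rho>^m. Of the gains only that of
      the step j = n0 is kept: there the cut-off R \<ge> T \<rho> still lies above 2^n0
      \<rho>.\<close>
    have lower: "f j \<ge> - C4 * \<rho> powr m - C1 * \<rho> powr m * (1 - 1 / 2 ^ j)
        + (if n0 < j then b1 * (2 ^ n0 * \<rho>) powr m / 2 ^ (n0 + 1) else 0)" for j
    proof (induction j)
      case 0
      have "\<bar>F y p\<bar> \<le> C4 * \<rho> powr m" using str p(2) unfolding coercive_structure_def by blast
      then show ?case by (simp add: f_def)
    next
      case (Suc j)
      have c: "C1 * \<rho> powr m * (1 - 1 / 2 ^ Suc j) = C1 * \<rho> powr m * (1 - 1 / 2 ^ j) + C1 * \<rho> powr m / 2 ^ (j + 1)"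
        by (simp add: algebra_simps)
      have nonneg: "0 \<le> b1 * min (norm (2 ^ j *\<^sub>R p)) R powr m / 2 ^ (j + 1)" using b1 by simp
      have "b1 * (2 ^ n0 * \<rho>) powr m / 2 ^ (n0 + 1) \<le> b1 * min (norm (2 ^ j *\<^sub>R p)) R powr m / 2 ^ (j + 1)" if "j = n0"
      proof -
        have "2 ^ n0 * \<rho> \<le> min (norm (2 ^ j *\<^sub>R p)) R"
        proof (rule min.boundedI)
          show "2 ^ n0 * \<rho> \<le> norm (2 ^ j *\<^sub>R p)" using p(1) that by simp
          have "2 ^ n0 * \<rho> \<le> T * \<rho>" unfolding T_def using \<rho> by (intro mult_right_mono power_increasing) auto
          then show "2 ^ n0 * \<rho> \<le> R" using R by simp
        qed
        then have "(2 ^ n0 * \<rho>) powr m \<le> min (norm (2 ^ j *\<^sub>R p)) R powr m" using m \<rho> by (intro powr_mono2) auto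
        then show ?thesis unfolding that using b1 by (intro divide_right_mono mult_left_mono) auto
      qed
      then have ind: "(if n0 < Suc j then b1 * (2 ^ n0 * \<rho>) powr m / 2 ^ (n0 + 1) else 0)
         \<le> (if n0 < j then b1 * (2 ^ n0 * \<rho>) powr m / 2 ^ (n0 + 1) else 0) + b1 * min (norm (2 ^ j *\<^sub>R p)) R powr m / 2 ^ (j + 1)"
        using nonneg by (cases "j = n0") (auto simp: less_Suc_eq)
      have "(b1 * min (norm (2 ^ j *\<^sub>R p)) R powr m - C1 * \<rho> powr m) / 2 ^ (j + 1)
        = b1 * min (norm (2 ^ j *\<^sub>R p)) R powr m / 2 ^ (j + 1) - C1 * \<rho> powr m / 2 ^ (j + 1)" by (rule diff_divide_distrib)
      then show ?case using Suc.IH step[of j] c ind by linarith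
    qed
    have rm: "0 < \<rho> powr m" using \<rho> by simp
    have "f n \<ge> - C4 * \<rho> powr m - C1 * \<rho> powr m * (1 - 1 / 2 ^ n) + b1 * (2 ^ n0 * \<rho>) powr m / 2 ^ (n0 + 1)"
      using lower[of n] nn by simp
    moreover have "C1 * \<rho> powr m * (1 - 1 / 2 ^ n) \<le> C1 * \<rho> powr m * 1" using C1 by (intro mult_left_mono) auto
    moreover have "b1 * (2 ^ n0 * \<rho>) powr m / 2 ^ (n0 + 1) = (b1 * (2 ^ n0) powr m / 2 ^ (n0 + 1)) * \<rho> powr m"
      using \<rho> by (simp add: powr_mult)
    moreover have "(C4 + C1 + 2 * A) * \<rho> powr m \<le> (b1 * (2 ^ n0) powr m / 2 ^ (n0 + 1)) * \<rho> powr m"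
      using n0' by (intro mult_right_mono) auto
    moreover have "(C4 + C1 + 2 * A) * \<rho> powr m = C4 * \<rho> powr m + C1 * \<rho> powr m + 2 * A * \<rho> powr m"
      by (simp only: distrib_right)
    ultimately have "f n \<ge> 2 * A * \<rho> powr m" by linarith
    moreover have "\<rho> powr 1 \<le> \<rho> powr m" using \<rho> m by (intro powr_mono) auto
    then have "2 * A * \<rho> \<le> 2 * A * \<rho> powr m" using A \<rho> by (intro mult_left_mono) auto
    ultimately have "2 * A * \<rho> \<le> f n" by linarith
    then have "2 ^ n * (2 * A * \<rho>) \<le> 2 ^ n * f n" by (intro mult_left_mono) auto
    also have "2 ^ n * f n = F y q" by (simp add: f_def p_def)
    finally have "A * (2 ^ n * (2 * \<rho>)) \<le> F y q" by (simp add: ac_simps)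
    moreover have "norm q \<le> 2 ^ n * (2 * \<rho>)" using p(2) by (simp add: np field_simps)
    then have "A * norm q \<le> A * (2 ^ n * (2 * \<rho>))" using A by (intro mult_left_mono) auto
    ultimately show ?thesis by linarith
  qed
  then show ?thesis using T1 by blast
qed

text \<open>It remains to bound the oscillation \<omega> by a multiple of \<rho>. Doubling with a
  concave profile of height comparable to \<omega> yields a contact point where the jump integral is
  at most a multiple of \<omega>, while the gradient is at least \<open>c2 * \<omega>\<close>.
  Superlinear growth makes F larger there than the equation permits, unless the gradient is below T1
  \<rho>; in that case \<omega> \<le> (T1/c2) \<rho>.\<close>

theorem apriori_gradient_bound:
  assumes b1: "0 < b1" and C1: "0 \<le> C1" and C2: "0 \<le> C2" and C4: "0 \<le> C4" and m: "1 < m" and \<kappa>: "0 < \<kappa>"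
  shows "\<exists>T K. 0 < T \<and> 0 < K \<and> (\<forall>(F::real^'n \<Rightarrow> real^'n \<Rightarrow> real) \<rho> R \<alpha> u y. 1 \<le> \<rho> \<longrightarrow> T * \<rho> \<le> R \<longrightarrow>
    coercive_structure m b1 C1 C2 C4 \<rho> R F \<longrightarrow> C1_holder_torus \<alpha> u \<longrightarrow> 0 < \<alpha> \<longrightarrow> \<alpha> < 1 \<longrightarrow>
    (\<forall>y. - (\<kappa> / 2) * jump_integral u y + F y (grad u y) = 0) \<longrightarrow> norm (grad u y) \<le> K * \<rho>)"
proof -
  let ?N = "real CARD('n)"
  define T0 where "T0 = max 1 ((2 * C1 / b1) powr (1 / m))"
  have T0: "1 \<le> T0" "2 * C1 \<le> b1 * T0 powr m"
  proof -
    have "((2 * C1 / b1) powr (1 / m)) powr m \<le> T0 powr m" using m by (intro powr_mono2) (auto simp: T0_def)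
    moreover have "((2 * C1 / b1) powr (1 / m)) powr m = 2 * C1 / b1" using m C1 b1 by (simp add: powr_powr)
    ultimately have "2 * C1 / b1 \<le> T0 powr m" by (simp only:)
    then show "2 * C1 \<le> b1 * T0 powr m" using b1 by (simp add: field_simps)
  qed (simp add: T0_def)
  define B where "B = 8 * C2 / b1 + 1"
  have B: "1 \<le> B" using b1 C2 by (simp add: B_def)
  define K1 where "K1 = 2 * max B T0"
  have K1: "0 < K1" using B by (simp add: K1_def)
  \<comment> \<open>The largest value of the profile with \<alpha> = 1/2 and h = 1 over distances up
    to N.\<close>
  define \<Phi> where "\<Phi> = (?N\<^sup>2 + 1) powr (1/4)"
  have \<Phi>: "1 \<le> \<Phi>" unfolding \<Phi>_def by (rule ge_one_powr_ge_zero) auto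
  define J1 where "J1 = (LINT z|lborel. jump_weight 1 z * jump_kernel (z::real^'n))"
  have J1: "0 \<le> J1" unfolding J1_def by (rule integral_nonneg_AE) simp
  \<comment> \<open>The factors are L/\<omega>, the least distance of the contact points, and the
    largest value of 2 s^2.\<close>
  define c2 where "c2 = (1 / (2 * \<Phi>)) * (1 / (2 * \<Phi> * K1)) / (2 * (?N\<^sup>2 + 1))"
  have c2: "0 < c2" unfolding c2_def using \<Phi> K1 by (intro divide_pos_pos mult_pos_pos) (auto intro: add_nonneg_pos)
  \<comment> \<open>Chosen so that A c2 \<omega> exceeds (\<kappa>/2) J1 \<omega>, the upper bound
    for F at the contact point.\<close>
  define A where "A = \<kappa> * J1 / c2 + 1"
  have A: "0 \<le> A" unfolding A_def using \<kappa> J1 c2 by simp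
  obtain T1 where T1: "1 \<le> T1" and superlin: "\<And>(F::real^'n \<Rightarrow> real^'n \<Rightarrow> real) \<rho> R C2 y q. 1 \<le> \<rho> \<Longrightarrow> T1 * \<rho> \<le> R \<Longrightarrow>
    coercive_structure m b1 C1 C2 C4 \<rho> R F \<Longrightarrow> T1 * \<rho> \<le> norm q \<Longrightarrow> A * norm q \<le> F y q"
    using coercive_structure_superlinear[OF b1 C1 C4 m A] by blast
  define D where "D = max 1 (T1 / c2)"
  define K where "K = 2 * max (B * D) T0"
  have K: "0 < K" using T0 by (simp add: K_def max_def)
  have "norm (grad u y) \<le> K * \<rho>"
    if \<rho>: "1 \<le> \<rho>" and R: "max T0 T1 * \<rho> \<le> R" and str: "coercive_structure m b1 C1 C2 C4 \<rho> R F"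
      and u: "C1_holder_torus \<alpha> u" "0 < \<alpha>" "\<alpha> < 1"
      and eq: "\<And>y. - (\<kappa> / 2) * jump_integral u y + F y (grad u y) = 0"
    for F :: "real^'n \<Rightarrow> real^'n \<Rightarrow> real" and \<rho> R \<alpha> u y
  proof -
    have R0: "T0 * \<rho> \<le> R" "T1 * \<rho> \<le> R"
      using R \<rho> mult_right_mono[of T0 "max T0 T1" \<rho>] mult_right_mono[of T1 "max T0 T1" \<rho>] by linarith+
    have ucont: "continuous_on UNIV u" by (rule C1_holder_torus_continuous[OF u(1)])
    have uper: "zn_periodic u" using u(1) by (simp add: C1_holder_torus_def)
    obtain x0 where x0: "\<And>y. u x0 \<le> u y" using zn_periodic_attains_min[OF uper ucont] by blast
    obtain x1 where x1: "\<And>y. u y \<le> u x1" using zn_periodic_attains_max[OF uper ucont] by blast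
    define \<omega> where "\<omega> = max (u x1 - u x0) \<rho>"
    have \<omega>: "0 < \<omega>" "\<rho> \<le> \<omega>" using \<rho> by (auto simp: \<omega>_def)
    have osc: "u x - u y \<le> \<omega>" for x y using x0[of y] x1[of x] by (simp add: \<omega>_def)
    have grad_le: "norm (grad u y) \<le> 2 * max (B * \<omega>) (T0 * \<rho>)" for y
      unfolding B_def by (rule gradient_bound_by_oscillation[OF b1 C1 C2 m \<rho> T0 R0(1) str u \<kappa> eq \<omega>(1) osc])
    have "\<omega> \<le> D * \<rho>"
    proof (cases "u x1 - u x0 \<le> \<rho>")
      case True
      then have "\<omega> = \<rho>" by (simp add: \<omega>_def)
      moreover have "1 * \<rho> \<le> D * \<rho>" using \<rho> by (intro mult_right_mono) (auto simp: D_def)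
      ultimately show ?thesis by simp
    next
      case False
      then have om: "\<omega> = u x1 - u x0" by (simp add: \<omega>_def)
      have lipK: "norm (grad u y) \<le> K1 * \<omega>" for y
      proof -
        have "max (B * \<omega>) (T0 * \<rho>) \<le> max B T0 * \<omega>"
        proof (rule max.boundedI)
          show "B * \<omega> \<le> max B T0 * \<omega>" using \<omega> by (intro mult_right_mono) auto
          show "T0 * \<rho> \<le> max B T0 * \<omega>" using \<omega> T0 \<rho> B by (intro mult_mono) auto
        qed
        then have "2 * max (B * \<omega>) (T0 * \<rho>) \<le> K1 * \<omega>" by (simp only: K1_def mult.assoc)
        then show ?thesis using grad_le[of y] by linarith
      qed
      have ulip: "u x - u y \<le> K1 * \<omega> * norm (x - y)" for x y
      proof -
        have "\<exists>t. 0 < t \<and> t < 1 \<and> u (y + 1 *\<^sub>R (x - y)) - u (y + 0 *\<^sub>R (x - y)) = (1 - 0) * (grad u (y + t *\<^sub>R (x - y)) \<bullet> (x - y))"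
          by (rule MVT2) (auto intro!: gderiv_along_line C1_holder_torus_gderiv[OF u(1)])
        then obtain t where "u x - u y = grad u (y + t *\<^sub>R (x - y)) \<bullet> (x - y)" by auto
        also have "\<dots> \<le> norm (grad u (y + t *\<^sub>R (x - y))) * norm (x - y)" by (rule norm_cauchy_schwarz)
        also have "\<dots> \<le> K1 * \<omega> * norm (x - y)" by (intro mult_right_mono lipK) auto
        finally show ?thesis .
      qed
      define L where "L = \<omega> / (2 * \<Phi>)"
      have L: "0 < L" using \<omega> \<Phi> by (simp add: L_def)
      define \<phi> where "\<phi> = (\<lambda>z::real^'n. ((norm z)\<^sup>2 + 1\<^sup>2) powr ((1/2) / 2))"
      have \<phi>1: "1 \<le> \<phi> z" for z unfolding \<phi>_def by (rule ge_one_powr_ge_zero) auto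
      have \<phi>N: "\<phi> z \<le> \<Phi>" if "norm z \<le> ?N" for z
        unfolding \<phi>_def \<Phi>_def using that by (auto intro!: powr_mono2 power_mono)
      have "\<exists>a b. norm (a - b) \<le> ?N \<and> (\<forall>x y. u x - u y - L * ((norm (x - y))\<^sup>2 + 1\<^sup>2) powr ((1/2) / 2)
           \<le> u a - u b - L * ((norm (a - b))\<^sup>2 + 1\<^sup>2) powr ((1/2) / 2))"
      proof (rule periodic_doubling_attains_max[OF uper ucont, of "\<lambda>r. L * (r\<^sup>2 + 1\<^sup>2) powr ((1/2) / 2)"])
        have "r\<^sup>2 + 1 \<noteq> (0::real)" for r using zero_le_power2[of r] by linarith
        then show "continuous_on {0..} (\<lambda>r. L * (r\<^sup>2 + 1\<^sup>2) powr ((1/2) / 2))"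
          by (intro continuous_intros) auto
        show "L * (r\<^sup>2 + 1\<^sup>2) powr ((1/2) / 2) \<le> L * (s\<^sup>2 + 1\<^sup>2) powr ((1/2) / 2)" if "0 \<le> r" "r \<le> s" for r s
          using that L by (intro mult_left_mono powr_mono2 add_right_mono power_mono) auto
      qed
      then obtain a b where abN: "norm (a - b) \<le> ?N" and ab: "\<And>x y. u x - u y - L * \<phi> (x - y) \<le> u a - u b - L * \<phi> (a - b)"
        unfolding \<phi>_def by blast
      \<comment> \<open>The pair formed by a maximum and a minimum of u, moved within distance N of
        each other, pays a penalty of at most L \<Phi> = \<omega>/2.\<close>
      have gap: "L \<le> u a - u b"
      proof -
        obtain y' where y': "u y' = u x0" "norm (x1 - y') \<le> ?N" using zn_periodic_nearby[OF uper] by blast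
        have "L * \<phi> (x1 - y') \<le> L * \<Phi>" using L y' by (intro mult_left_mono \<phi>N) auto
        also have "\<dots> = \<omega> / 2" using \<Phi> by (simp add: L_def)
        finally have "0 \<le> u x1 - u y' - L * \<phi> (x1 - y')" using y' om \<omega> by simp
        then have "L * \<phi> (a - b) \<le> u a - u b" using ab[of x1 y'] by linarith
        moreover have "L * 1 \<le> L * \<phi> (a - b)" using L \<phi>1 by (intro mult_left_mono) auto
        ultimately show ?thesis by simp
      qed
      let ?\<xi> = "a - b"
      define s where "s = sqrt ((norm ?\<xi>)\<^sup>2 + 1\<^sup>2)"
      have s: "1 \<le> s" "s\<^sup>2 \<le> ?N\<^sup>2 + 1" using power_mono[OF abN norm_ge_zero, of 2] by (auto simp: s_def)
      \<comment> \<open>The values at a and b differ by a fixed fraction of \<omega>, while u is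
        Lipschitz with constant K1 \<omega>, so the points cannot be close and the slope of the
        profile between them cannot degenerate.\<close>
      have r: "1 / (2 * \<Phi> * K1) \<le> norm ?\<xi>"
      proof -
        have "\<omega> / (2 * \<Phi>) \<le> K1 * \<omega> * norm ?\<xi>" using gap ulip[of a b] by (simp add: L_def)
        then have "\<omega> * (1 / (2 * \<Phi>)) \<le> \<omega> * (K1 * norm ?\<xi>)" by (simp add: ac_simps)
        then have "1 / (2 * \<Phi>) \<le> K1 * norm ?\<xi>" using \<omega>(1) by (simp only: mult_le_cancel_left_pos)
        then have "1 / (2 * \<Phi>) / K1 \<le> norm ?\<xi>" using pos_divide_le_eq[OF K1] by (metis mult.commute)
        then show ?thesis by simp
      qed
      have r0: "0 < norm ?\<xi>" using r \<Phi> K1 by (smt (verit) divide_pos_pos mult_pos_pos)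
      have inc: "u (a + z) - u a \<le> L * (\<phi> (?\<xi> + z) - \<phi> ?\<xi>)" for z
        using ab[of "a + z" b] by (simp add: algebra_simps)
      have J: "jump_integral u a \<le> \<omega> * J1"
      proof -
        have sd: "\<phi> (?\<xi> + z) + \<phi> (?\<xi> - z) - 2 * \<phi> ?\<xi> \<le> 4 * (1/2) * \<phi> ?\<xi> * jump_weight 1 ((1 / s) *\<^sub>R z)" for z
          unfolding \<phi>_def s_def by (rule smoothed_power_second_diff) auto
        have "second_diff u a z \<le> L * (2 * \<phi> ?\<xi>) * jump_weight 1 ((1 / s) *\<^sub>R z)" for z
        proof -
          have "second_diff u a z \<le> L * (\<phi> (?\<xi> + z) + \<phi> (?\<xi> - z) - 2 * \<phi> ?\<xi>)"
            using inc[of z] inc[of "- z"] by (simp add: second_diff_def algebra_simps)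
          also have "\<dots> \<le> L * (4 * (1/2) * \<phi> ?\<xi> * jump_weight 1 ((1 / s) *\<^sub>R z))" using L by (intro mult_left_mono sd) auto
          finally show ?thesis by simp
        qed
        then have sdk: "second_diff u a z * jump_kernel z \<le> L * (2 * \<phi> ?\<xi>) * (jump_weight 1 ((1 / s) *\<^sub>R z) * jump_kernel z)" for z
          using mult_right_mono[of "second_diff u a z" "L * (2 * \<phi> ?\<xi>) * jump_weight 1 ((1 / s) *\<^sub>R z)" "jump_kernel z"] by (simp add: mult.assoc)
        have intg: "integrable lborel (\<lambda>z::real^'n. L * (2 * \<phi> ?\<xi>) * (jump_weight 1 ((1 / s) *\<^sub>R z) * jump_kernel z))"
          by (intro integrable_mult_right jump_weight_scaled(1)) (use s in auto)
        have "jump_integral u a \<le> (LINT z|lborel. L * (2 * \<phi> ?\<xi>) * (jump_weight 1 ((1 / s) *\<^sub>R z) * jump_kernel (z::real^'n)))"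
          unfolding jump_integral_def
        proof (rule integral_mono[OF _ intg])
          show "integrable lborel (\<lambda>z. second_diff u a z * jump_kernel z)" by (rule second_diff_integrable[OF u])
          show "second_diff u a z * jump_kernel z \<le> L * (2 * \<phi> ?\<xi>) * (jump_weight 1 ((1 / s) *\<^sub>R z) * jump_kernel z)" for z
            by (rule sdk)
        qed
        also have "\<dots> = L * (2 * \<phi> ?\<xi>) * (J1 / s)" using s by (subst integral_mult_right_zero, subst jump_weight_scaled(2)) (auto simp: J1_def)
        also have "\<dots> \<le> L * (2 * \<Phi>) * (J1 / 1)"
          using L \<phi>N[OF abN] \<phi>1[of ?\<xi>] s J1 by (intro mult_mono divide_left_mono) auto
        also have "\<dots> = \<omega> * J1" using \<Phi> by (simp add: L_def)
        finally show ?thesis .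
      qed
      have Fle: "F a (grad u a) \<le> \<kappa> / 2 * (\<omega> * J1)"
      proof -
        have "F a (grad u a) = \<kappa> / 2 * jump_integral u a" using eq[of a] by simp
        also have "\<dots> \<le> \<kappa> / 2 * (\<omega> * J1)" using J \<kappa> by (intro mult_left_mono) auto
        finally show ?thesis .
      qed
      \<comment> \<open>Moving a towards b lowers the penalty at a definite rate, and contact forces
        u to decrease at least as fast.\<close>
      have glow: "c2 * \<omega> \<le> norm (grad u a)"
      proof -
        let ?c = "L * (1 / 2 / 2 * \<phi> ?\<xi>)"
        have "grad u a \<bullet> (- ?\<xi>) \<le> ?c * (- 2 * (norm ?\<xi>)\<^sup>2 / s\<^sup>2)"
        proof (rule right_derivative_mono[where d = 1])
          show "((\<lambda>t. u (a + t *\<^sub>R (- ?\<xi>))) has_real_derivative grad u a \<bullet> (- ?\<xi>)) (at 0)"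
            by (rule gderiv_along_line) (use C1_holder_torus_gderiv[OF u(1)] in simp)
          show "((\<lambda>t. u a + ?c * ((- 2 * t + t\<^sup>2) * (norm ?\<xi>)\<^sup>2 / s\<^sup>2)) has_real_derivative ?c * (- 2 * (norm ?\<xi>)\<^sup>2 / s\<^sup>2)) (at 0)"
          proof -
            have "((\<lambda>t. u a + ?c * ((- 2 * t + t\<^sup>2) * C)) has_real_derivative ?c * (- 2 * C)) (at 0)" for C
              by (auto intro!: derivative_eq_intros)
            from this[of "(norm ?\<xi>)\<^sup>2 / s\<^sup>2"] show ?thesis by simp
          qed
          show "u (a + t *\<^sub>R (- ?\<xi>)) \<le> u a + ?c * ((- 2 * t + t\<^sup>2) * (norm ?\<xi>)\<^sup>2 / s\<^sup>2)" for t
          proof -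
            have "\<phi> (?\<xi> + t *\<^sub>R (- ?\<xi>)) - \<phi> ?\<xi> \<le> 1 / 2 / 2 * \<phi> ?\<xi> * ((2 * (?\<xi> \<bullet> (t *\<^sub>R (- ?\<xi>))) + (norm (t *\<^sub>R (- ?\<xi>)))\<^sup>2) / s\<^sup>2)"
              unfolding \<phi>_def s_def by (rule smoothed_power_tangent) auto
            moreover have "2 * (?\<xi> \<bullet> (t *\<^sub>R (- ?\<xi>))) + (norm (t *\<^sub>R (- ?\<xi>)))\<^sup>2 = (- 2 * t + t\<^sup>2) * (norm ?\<xi>)\<^sup>2"
            proof -
              have "?\<xi> \<bullet> (t *\<^sub>R (- ?\<xi>)) = - t * (norm ?\<xi>)\<^sup>2" by (simp only: inner_scaleR_right inner_minus_right power2_norm_eq_inner mult_minus_left mult_minus_right)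
              moreover have "(norm (t *\<^sub>R (- ?\<xi>)))\<^sup>2 = t\<^sup>2 * (norm ?\<xi>)\<^sup>2" by (simp only: norm_scaleR norm_minus_cancel power_mult_distrib power2_abs)
              ultimately show ?thesis by (simp only: distrib_right)
            qed
            ultimately have "\<phi> (?\<xi> + t *\<^sub>R (- ?\<xi>)) - \<phi> ?\<xi> \<le> 1 / 2 / 2 * \<phi> ?\<xi> * ((- 2 * t + t\<^sup>2) * (norm ?\<xi>)\<^sup>2 / s\<^sup>2)" by simp
            then have "L * (\<phi> (?\<xi> + t *\<^sub>R (- ?\<xi>)) - \<phi> ?\<xi>) \<le> L * (1 / 2 / 2 * \<phi> ?\<xi> * ((- 2 * t + t\<^sup>2) * (norm ?\<xi>)\<^sup>2 / s\<^sup>2))"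
              using L by (intro mult_left_mono) auto
            then show ?thesis using inc[of "t *\<^sub>R (- ?\<xi>)"] by (simp only: mult.assoc)
          qed
        qed auto
        then have "?c * (2 * (norm ?\<xi>)\<^sup>2 / s\<^sup>2) \<le> grad u a \<bullet> ?\<xi>"
          unfolding inner_minus_right by simp
        also have "\<dots> \<le> norm (grad u a) * norm ?\<xi>" by (rule norm_cauchy_schwarz)
        finally have "norm ?\<xi> * (L * \<phi> ?\<xi> * norm ?\<xi> / (2 * s\<^sup>2)) \<le> norm ?\<xi> * norm (grad u a)"
          by (simp add: power2_eq_square field_simps)
        then have 1: "L * \<phi> ?\<xi> * norm ?\<xi> / (2 * s\<^sup>2) \<le> norm (grad u a)" by (simp only: mult_le_cancel_left_pos[OF r0])
        have "c2 * \<omega> = L * 1 * (1 / (2 * \<Phi> * K1)) / (2 * (?N\<^sup>2 + 1))" unfolding c2_def L_def by simp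
        also have "\<dots> \<le> L * \<phi> ?\<xi> * norm ?\<xi> / (2 * s\<^sup>2)"
          using L \<phi>1[of ?\<xi>] r s K1 \<Phi> by (intro frac_le mult_mono) auto
        finally show ?thesis using 1 by linarith
      qed
      have "norm (grad u a) < T1 * \<rho>"
      proof (rule ccontr)
        assume "\<not> ?thesis"
        then have "A * norm (grad u a) \<le> F a (grad u a)" by (intro superlin[OF \<rho> R0(2) str]) simp
        then have "A * (c2 * \<omega>) \<le> \<kappa> / 2 * (\<omega> * J1)" using Fle mult_left_mono[OF glow A] by linarith
        moreover have "A * (c2 * \<omega>) = \<kappa> * J1 * \<omega> + c2 * \<omega>" using c2 by (simp add: A_def field_simps)
        moreover have "0 < c2 * \<omega>" "0 \<le> \<kappa> * J1 * \<omega>" using c2 \<omega> \<kappa> J1 by auto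
        ultimately show False by (simp add: ac_simps)
      qed
      then have "c2 * \<omega> \<le> T1 * \<rho>" using glow by linarith
      then have "\<omega> \<le> T1 / c2 * \<rho>" using c2 by (simp add: field_simps)
      also have "\<dots> \<le> D * \<rho>" using \<rho> by (intro mult_right_mono) (auto simp: D_def)
      finally show ?thesis .
    qed
    then have "B * \<omega> \<le> B * D * \<rho>" using B mult_left_mono[of \<omega> "D * \<rho>" B] by (simp add: mult.assoc)
    then have "max (B * \<omega>) (T0 * \<rho>) \<le> max (B * D) T0 * \<rho>"
      using \<rho> by (auto simp: max_mult_distrib_right max.coboundedI1 max.coboundedI2)
    then have "2 * max (B * \<omega>) (T0 * \<rho>) \<le> K * \<rho>" by (simp only: K_def mult.assoc)
    then show ?thesis using grad_le[of y] by linarith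
  qed
  moreover have "0 < max T0 T1" using T0 by auto
  ultimately show ?thesis using K by blast
qed

subsection \<open>Coercive first-order part\<close>

lemma C1_holder_torus_const: "0 < \<alpha> \<Longrightarrow> C1_holder_torus \<alpha> (\<lambda>_::real^'n. k)"
proof -
  have "grad (\<lambda>_::real^'n. k) x = 0" for x by (rule grad_eqI) (rule GDERIV_const)
  then show ?thesis by (auto simp: C1_holder_torus_def zn_periodic_def intro!: exI[of _ 0])
qed

lemma jump_integral_const: "jump_integral (\<lambda>_. k) x = 0"
  by (simp add: jump_integral_def second_diff_def)

lemma C1_holder_torus_grad_bounded:
  fixes u :: "real^'n \<Rightarrow> real"
  assumes u: "C1_holder_torus \<alpha> u" "0 < \<alpha>"
  shows "\<exists>B\<ge>0. \<forall>y. norm (grad u y) \<le> B"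
proof -
  have per: "grad u (y + k) = grad u y" if k: "\<forall>i. k $ i \<in> \<int>" for y k
  proof (rule grad_eqI[symmetric])
    have "((\<lambda>z. z + k) has_derivative (\<lambda>h. h)) (at y)" by (auto intro!: derivative_eq_intros)
    from has_derivative_compose[OF this, of u "\<lambda>h. h \<bullet> grad u (y + k)"]
    have "((\<lambda>z. u (z + k)) has_derivative (\<lambda>h. h \<bullet> grad u (y + k))) (at y)"
      using C1_holder_torus_gderiv[OF u(1), of "y + k"] unfolding gderiv_def by simp
    moreover have "(\<lambda>z. u (z + k)) = u" using u(1) k by (auto simp: C1_holder_torus_def zn_periodic_def)
    ultimately show "GDERIV u y :> grad u (y + k)" unfolding gderiv_def by simp
  qed
  have "zn_periodic (\<lambda>y. norm (grad u y))" by (simp add: zn_periodic_def per)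
  moreover have "continuous_on UNIV (\<lambda>y. norm (grad u y))"
    by (intro continuous_intros C1_holder_torus_grad_continuous[OF u])
  ultimately show ?thesis using zn_periodic_bounded by fastforce
qed

text \<open>The size of p and l is to enter through \<rho> alone, so the remaining constants can be
  the same for all x, p and l. The Lipschitz bound in the gradient is only local and its constant is
  used qualitatively.\<close>

locale coercive_cell =
  fixes \<kappa> m b1 C1 C2 C5 a0 Lw \<rho> :: real and G :: "real^'n \<Rightarrow> real^'n \<Rightarrow> real" and w :: "real^'n \<Rightarrow> real"
  assumes \<kappa>: "0 < \<kappa>" and m: "1 < m" and b1: "0 < b1" and C1: "0 \<le> C1" and C2: "0 \<le> C2" and C5: "0 \<le> C5"
    and a0: "0 < a0" and Lw: "0 \<le> Lw" and \<rho>: "1 \<le> \<rho>"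
    and w_bounds: "\<And>y. a0 \<le> w y" "\<And>y. w y \<le> 1 / a0"
    and w_lipschitz: "\<And>y y'. \<bar>w y - w y'\<bar> \<le> Lw * norm (y - y')"
    and w_periodic: "zn_periodic w" and G_periodic: "\<And>q. zn_periodic (\<lambda>y. G y q)"
    and G_scaling: "\<And>\<mu> y q. 0 < \<mu> \<Longrightarrow> \<mu> < 1 \<Longrightarrow>
       (1 - \<mu>) * (b1 * norm q powr m - C1 * \<rho> powr m) \<le> \<mu> * G y ((1 / \<mu>) *\<^sub>R q) - G y q"
    and G_lipschitz_space: "\<And>y y' q. \<bar>G y q - G y' q\<bar> \<le> C2 * (\<rho> powr m + norm q powr m) * norm (y - y')"
    and G_growth: "\<And>y q. \<bar>G y q\<bar> \<le> C5 * (\<rho> powr m + norm q powr m)"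
    and G_lipschitz_gradient: "\<And>R. \<exists>Lq. \<forall>y q q'. norm q \<le> R \<longrightarrow> norm q' \<le> R \<longrightarrow>
       \<bar>G y q - G y q'\<bar> \<le> Lq * norm (q - q')"
begin

text \<open>Beyond radius \<open>R\<close> the gradient variable is projected and a linear term is added whose slope is large
  enough to keep the scaling condition.\<close>

definition proj :: "real \<Rightarrow> real^'n \<Rightarrow> real^'n" where
  "proj R q = closest_point (cball 0 R) q"

definition slope :: "real \<Rightarrow> real" where
  "slope R = (C5 * (\<rho> powr m + R powr m) + b1 * R powr m) / R"

definition trunc :: "real \<Rightarrow> real^'n \<Rightarrow> real^'n \<Rightarrow> real" where
  "trunc R y q = G y (proj R q) + slope R * norm (q - proj R q)"

lemma proj_inside: "norm q \<le> R \<Longrightarrow> proj R q = q"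
  unfolding proj_def by (rule closest_point_self) simp

lemma proj_outside:
  assumes "0 < R" "R \<le> norm q" shows "proj R q = (R / norm q) *\<^sub>R q"
proof -
  have n: "0 < norm q" using assms by linarith
  have "(R / norm q) *\<^sub>R q = closest_point (cball 0 R) q"
  proof (rule closest_point_unique)
    show "(R / norm q) *\<^sub>R q \<in> cball 0 R" using assms n by simp
    show "\<forall>z\<in>cball 0 R. dist q ((R / norm q) *\<^sub>R q) \<le> dist q z"
    proof
      fix z :: "real^'n" assume z: "z \<in> cball 0 R"
      have "q - (R / norm q) *\<^sub>R q = ((norm q - R) / norm q) *\<^sub>R q"
        using n by (simp add: diff_divide_distrib scaleR_left_diff_distrib)
      then have "dist q ((R / norm q) *\<^sub>R q) = norm q - R" using n assms by (simp add: dist_norm)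
      also have "\<dots> \<le> norm q - norm z" using z by simp
      also have "\<dots> \<le> dist q z" by (simp add: dist_norm norm_triangle_ineq2)
      finally show "dist q ((R / norm q) *\<^sub>R q) \<le> dist q z" .
    qed
  qed (auto intro: convex_cball)
  then show ?thesis by (simp add: proj_def)
qed

lemma norm_proj: "0 < R \<Longrightarrow> norm (proj R q) = min (norm q) R"
proof (cases "norm q \<le> R")
  case False
  assume R: "0 < R"
  then have "0 < norm q" using False by linarith
  then show ?thesis using False R proj_outside[of R q] by (simp add: min_def)
qed (simp add: proj_inside)

lemma proj_nonexpansive: "0 < R \<Longrightarrow> norm (proj R q - proj R q') \<le> norm (q - q')"
  unfolding proj_def using closest_point_lipschitz[of "cball (0::real^'n) R" q q']
  by (simp add: dist_norm)

lemma trunc_inside: "norm q \<le> R \<Longrightarrow> trunc R y q = G y q"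
  by (simp add: trunc_def proj_inside)

text \<open>On a ray beyond R the projection Q is constant, so \<open>trunc\<close> is affine in the
  norm and the scaling defect equals (1 - \<mu>) (slope R * R - G y Q). By the growth bound on G,
  the chosen slope leaves at least b1 R^m in the bracket.\<close>

lemma trunc_scaling_outside:
  assumes R: "0 < R" and \<mu>: "0 < \<mu>" "\<mu> < 1" and q: "R \<le> norm q"
  shows "(1 - \<mu>) * (b1 * R powr m - C1 * \<rho> powr m) \<le> \<mu> * trunc R y ((1 / \<mu>) *\<^sub>R q) - trunc R y q"
proof -
  let ?Q = "(R / norm q) *\<^sub>R q"
  have n: "0 < norm q" using R q by linarith
  have "norm q \<le> norm q / \<mu>" using \<mu> n by (simp add: field_simps)
  then have q': "R \<le> norm ((1 / \<mu>) *\<^sub>R q)" using q \<mu> by simp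
  have P: "proj R q = ?Q" "proj R ((1 / \<mu>) *\<^sub>R q) = ?Q"
    using proj_outside[OF R q] proj_outside[OF R q'] \<mu> by auto
  have d: "norm (t *\<^sub>R q - ?Q) = t * norm q - R" if "1 \<le> t" for t
  proof -
    have "t *\<^sub>R q - ?Q = (t - R / norm q) *\<^sub>R q" by (simp add: scaleR_left_diff_distrib)
    moreover have "R / norm q \<le> 1" using n q by simp
    then have "\<bar>t - R / norm q\<bar> = t - R / norm q" using that by simp
    ultimately show ?thesis using n by (simp add: left_diff_distrib)
  qed
  have d1: "norm (q - ?Q) = norm q - R" using d[of 1] by simp
  have d2: "norm ((1 / \<mu>) *\<^sub>R q - ?Q) = norm q / \<mu> - R" using d[of "1 / \<mu>"] \<mu> by simp
  have "\<mu> * trunc R y ((1 / \<mu>) *\<^sub>R q) - trunc R y q = (1 - \<mu>) * (slope R * R - G y ?Q)"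
    unfolding trunc_def P d1 d2 using \<mu> by (simp add: field_simps)
  moreover have "slope R * R = C5 * (\<rho> powr m + R powr m) + b1 * R powr m" using R by (simp add: slope_def)
  moreover have "\<bar>G y ?Q\<bar> \<le> C5 * (\<rho> powr m + R powr m)" using G_growth[of y ?Q] n R by simp
  moreover have "0 \<le> C1 * \<rho> powr m" using C1 by simp
  ultimately show ?thesis using \<mu> by (auto intro!: mult_left_mono)
qed

text \<open>When q is inside and q/\<mu> outside the ball, \<mu> is factored as \<mu>1 \<mu>2 with
  q/\<mu>1 on the sphere. The inner and outer inequalities then combine through (1 - \<mu>1) +
  \<mu>1 (1 - \<mu>2) = 1 - \<mu>.\<close>

lemma trunc_scaling:
  assumes R: "0 < R" and \<mu>: "0 < \<mu>" "\<mu> < 1"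
  shows "(1 - \<mu>) * (b1 * min (norm q) R powr m - C1 * \<rho> powr m) \<le> \<mu> * trunc R y ((1 / \<mu>) *\<^sub>R q) - trunc R y q"
proof -
  have inside: "(1 - \<nu>) * (b1 * norm q powr m - C1 * \<rho> powr m) \<le> \<nu> * trunc R y ((1 / \<nu>) *\<^sub>R q) - trunc R y q"
    if \<nu>: "0 < \<nu>" "\<nu> < 1" "norm q / \<nu> \<le> R" for \<nu>
  proof -
    have "norm q \<le> norm q / \<nu>" using \<nu> by (simp add: field_simps mult_left_le_one_le)
    then have "norm q \<le> R" using \<nu> by linarith
    then have "trunc R y q = G y q" "trunc R y ((1 / \<nu>) *\<^sub>R q) = G y ((1 / \<nu>) *\<^sub>R q)"
      using \<nu> by (auto intro!: trunc_inside)
    then show ?thesis using G_scaling[OF \<nu>(1,2), of q y] by simp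
  qed
  consider "norm q / \<mu> \<le> R" | "R \<le> norm q" | "norm q < R" "R < norm q / \<mu>" by linarith
  then show ?thesis
  proof cases
    case 1
    have "norm q \<le> norm q / \<mu>" using \<mu> by (simp add: field_simps mult_left_le_one_le)
    then have "min (norm q) R = norm q" using 1 by simp
    then show ?thesis using inside[OF \<mu> 1] by simp
  next
    case 2
    then have "min (norm q) R = R" by simp
    then show ?thesis using trunc_scaling_outside[OF R \<mu> 2] by simp
  next
    case 3
    have n: "0 < norm q" using 3 \<mu> R by (smt (verit) divide_nonneg_pos norm_ge_zero div_0)
    define \<mu>1 where "\<mu>1 = norm q / R"
    define \<mu>2 where "\<mu>2 = \<mu> / \<mu>1"
    define Q where "Q = (1 / \<mu>1) *\<^sub>R q"
    have \<mu>1: "0 < \<mu>1" "\<mu>1 < 1" "norm q / \<mu>1 \<le> R" using n R 3 by (auto simp: \<mu>1_def field_simps)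
    have "\<mu> < \<mu>1" using 3 R \<mu> by (simp add: \<mu>1_def field_simps)
    then have \<mu>2: "0 < \<mu>2" "\<mu>2 < 1" using \<mu> \<mu>1 by (simp_all add: \<mu>2_def)
    have mm: "\<mu> = \<mu>1 * \<mu>2" using \<mu>1 by (simp add: \<mu>2_def)
    have nQ: "norm Q = R" using n R by (simp add: Q_def \<mu>1_def)
    have qQ: "(1 / \<mu>) *\<^sub>R q = (1 / \<mu>2) *\<^sub>R Q" using \<mu>1 \<mu>2 by (simp add: Q_def mm)
    let ?X = "b1 * norm q powr m - C1 * \<rho> powr m"
    have "?X \<le> b1 * R powr m - C1 * \<rho> powr m"
      using b1 3 m by (intro diff_right_mono mult_left_mono powr_mono2) auto
    then have "(1 - \<mu>2) * ?X \<le> (1 - \<mu>2) * (b1 * R powr m - C1 * \<rho> powr m)" using \<mu>2 by (intro mult_left_mono) auto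
    also have "\<dots> \<le> \<mu>2 * trunc R y ((1 / \<mu>2) *\<^sub>R Q) - trunc R y Q"
      by (rule trunc_scaling_outside[OF R \<mu>2]) (simp add: nQ)
    finally have "\<mu>1 * ((1 - \<mu>2) * ?X) \<le> \<mu>1 * (\<mu>2 * trunc R y ((1 / \<mu>2) *\<^sub>R Q) - trunc R y Q)"
      using \<mu>1 by (intro mult_left_mono) auto
    moreover have "(1 - \<mu>1) * ?X \<le> \<mu>1 * trunc R y Q - trunc R y q" unfolding Q_def by (rule inside[OF \<mu>1])
    ultimately have "\<mu>1 * ((1 - \<mu>2) * ?X) + (1 - \<mu>1) * ?X \<le> \<mu>1 * \<mu>2 * trunc R y ((1 / \<mu>2) *\<^sub>R Q) - trunc R y q"
      by (simp add: algebra_simps)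
    moreover have "\<mu>1 * ((1 - \<mu>2) * ?X) + (1 - \<mu>1) * ?X = (1 - \<mu>) * ?X" unfolding mm by (simp add: algebra_simps)
    ultimately show ?thesis using 3 by (simp add: qQ mm[symmetric])
  qed
qed

text \<open>The term c w, moved to the left side, adds (1 - \<mu>) c w to the scaling defect and is
  of order \<rho>^m like the other lower-order terms. The condition R \<ge> 2\<rho> makes the third
  clause see only G itself.\<close>

lemma trunc_coercive_structure:
  assumes R: "2 * \<rho> \<le> R" and c: "\<bar>c\<bar> \<le> Cc * \<rho> powr m" and Cc: "0 \<le> Cc"
  shows "coercive_structure m b1 (C1 + Cc / a0) (C2 + Cc * Lw) (C5 * (1 + 2 powr m) + Cc / a0) \<rho> R
    (\<lambda>y q. trunc R y q - c * w y)"
proof -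
  have R0: "0 < R" using R \<rho> by linarith
  have cw: "\<bar>c * w y\<bar> \<le> Cc / a0 * \<rho> powr m" for y
  proof -
    have "\<bar>c * w y\<bar> \<le> (Cc * \<rho> powr m) * (1 / a0)"
      unfolding abs_mult using c w_bounds[of y] a0 Cc by (intro mult_mono) auto
    then show ?thesis by simp
  qed
  show ?thesis
    unfolding coercive_structure_def
  proof (intro conjI allI impI)
    fix \<mu> :: real and y q :: "real^'n" assume \<mu>: "0 < \<mu>" "\<mu> < 1"
    have "(1 - \<mu>) * (- (Cc / a0 * \<rho> powr m)) \<le> (1 - \<mu>) * (c * w y)"
      using \<mu> cw[of y] by (intro mult_left_mono) (auto simp: abs_le_iff)
    then show "(1 - \<mu>) * (b1 * min (norm q) R powr m - (C1 + Cc / a0) * \<rho> powr m)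
       \<le> \<mu> * (trunc R y ((1 / \<mu>) *\<^sub>R q) - c * w y) - (trunc R y q - c * w y)"
      using trunc_scaling[OF R0 \<mu>, of q y] by (simp add: algebra_simps)
  next
    fix y y' q :: "real^'n"
    have "\<bar>G y (proj R q) - G y' (proj R q)\<bar> \<le> C2 * (\<rho> powr m + min (norm q) R powr m) * norm (y - y')"
      using G_lipschitz_space[of y "proj R q" y'] by (simp add: norm_proj[OF R0])
    moreover have "\<bar>c * (w y - w y')\<bar> \<le> (Cc * \<rho> powr m) * (Lw * norm (y - y'))"
      unfolding abs_mult using c Cc w_lipschitz[of y y'] by (intro mult_mono) auto
    moreover have "(Cc * \<rho> powr m) * (Lw * norm (y - y')) \<le> Cc * Lw * (\<rho> powr m + min (norm q) R powr m) * norm (y - y')"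
    proof -
      have "Cc * Lw * \<rho> powr m * norm (y - y') \<le> Cc * Lw * (\<rho> powr m + min (norm q) R powr m) * norm (y - y')"
        using Cc Lw by (intro mult_right_mono mult_left_mono) auto
      then show ?thesis by (simp add: ac_simps)
    qed
    moreover have "trunc R y q - c * w y - (trunc R y' q - c * w y') = (G y (proj R q) - G y' (proj R q)) - c * (w y - w y')"
      by (simp add: trunc_def algebra_simps)
    ultimately have "\<bar>trunc R y q - c * w y - (trunc R y' q - c * w y')\<bar> \<le> C2 * (\<rho> powr m + min (norm q) R powr m) * norm (y - y')
        + Cc * Lw * (\<rho> powr m + min (norm q) R powr m) * norm (y - y')" by linarith
    then show "\<bar>trunc R y q - c * w y - (trunc R y' q - c * w y')\<bar> \<le> (C2 + Cc * Lw) * (\<rho> powr m + min (norm q) R powr m) * norm (y - y')"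
      by (simp only: distrib_right)
  next
    fix y q :: "real^'n" assume q: "norm q \<le> 2 * \<rho>"
    then have "trunc R y q = G y q" using R by (intro trunc_inside) simp
    moreover have "norm q powr m \<le> (2 * \<rho>) powr m" using q m by (intro powr_mono2) auto
    then have "C5 * (\<rho> powr m + norm q powr m) \<le> C5 * (\<rho> powr m + 2 powr m * \<rho> powr m)"
      using C5 \<rho> by (intro mult_left_mono) (auto simp: powr_mult)
    then have "\<bar>G y q\<bar> \<le> C5 * (1 + 2 powr m) * \<rho> powr m" using G_growth[of y q] by (simp add: algebra_simps)
    ultimately have "\<bar>trunc R y q - c * w y\<bar> \<le> C5 * (1 + 2 powr m) * \<rho> powr m + Cc / a0 * \<rho> powr m"
      using cw[of y] by linarith
    then show "\<bar>trunc R y q - c * w y\<bar> \<le> (C5 * (1 + 2 powr m) + Cc / a0) * \<rho> powr m"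
      by (simp only: distrib_right)
  qed
qed

lemma trunc_lipschitz:
  assumes R: "0 < R"
  shows "\<exists>L>0. \<forall>y y' q q'. \<bar>trunc R y q - trunc R y' q'\<bar> \<le> L * norm (y - y') + L * norm (q - q')"
proof -
  obtain Lq where Lq: "\<And>y q q'. norm q \<le> R \<Longrightarrow> norm q' \<le> R \<Longrightarrow> \<bar>G y q - G y q'\<bar> \<le> Lq * norm (q - q')"
    using G_lipschitz_gradient[of R] by blast
  define Ls where "Ls = C2 * (\<rho> powr m + R powr m)"
  have sl: "0 \<le> slope R" unfolding slope_def using C5 b1 R by (intro divide_nonneg_pos add_nonneg_nonneg mult_nonneg_nonneg) auto
  define L where "L = 1 + Ls + \<bar>Lq\<bar> + 2 * slope R"
  have Ls0: "0 \<le> Ls" using C2 by (simp add: Ls_def)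
  have L: "0 < L" "Ls \<le> L" "\<bar>Lq\<bar> + 2 * slope R \<le> L" using Ls0 sl by (auto simp: L_def)
  have "\<bar>trunc R y q - trunc R y' q'\<bar> \<le> L * norm (y - y') + L * norm (q - q')" for y y' q q'
  proof -
    let ?p = "proj R q" and ?p' = "proj R q'"
    have np: "norm ?p \<le> R" "norm ?p' \<le> R" using norm_proj[OF R] by auto
    have "\<bar>G y ?p - G y' ?p\<bar> \<le> Ls * norm (y - y')"
    proof -
      have "C2 * (\<rho> powr m + norm ?p powr m) * norm (y - y') \<le> Ls * norm (y - y')"
        unfolding Ls_def using C2 np m by (intro mult_right_mono mult_left_mono add_left_mono powr_mono2) auto
      then show ?thesis using G_lipschitz_space[of y ?p y'] by linarith
    qed
    moreover have "\<bar>G y' ?p - G y' ?p'\<bar> \<le> \<bar>Lq\<bar> * norm (q - q')"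
    proof -
      have "Lq * norm (?p - ?p') \<le> \<bar>Lq\<bar> * norm (q - q')" using proj_nonexpansive[OF R] by (intro mult_mono) auto
      then show ?thesis using Lq[OF np, of y'] by linarith
    qed
    moreover have "\<bar>slope R * norm (q - ?p) - slope R * norm (q' - ?p')\<bar> \<le> 2 * slope R * norm (q - q')"
    proof -
      have "\<bar>norm (q - ?p) - norm (q' - ?p')\<bar> \<le> norm ((q - ?p) - (q' - ?p'))" by (rule norm_triangle_ineq3)
      also have "\<dots> = norm ((q - q') - (?p - ?p'))" by (simp add: algebra_simps)
      also have "\<dots> \<le> norm (q - q') + norm (?p - ?p')" by (rule norm_triangle_ineq4)
      also have "\<dots> \<le> 2 * norm (q - q')" using proj_nonexpansive[OF R, of q q'] by simp
      finally have "slope R * \<bar>norm (q - ?p) - norm (q' - ?p')\<bar> \<le> slope R * (2 * norm (q - q'))"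
        using sl by (intro mult_left_mono)
      then show ?thesis using sl by (simp add: abs_mult flip: right_diff_distrib)
    qed
    moreover have "trunc R y q - trunc R y' q' = (G y ?p - G y' ?p) + (G y' ?p - G y' ?p') + (slope R * norm (q - ?p) - slope R * norm (q' - ?p'))"
      by (simp add: trunc_def)
    ultimately have "\<bar>trunc R y q - trunc R y' q'\<bar> \<le> Ls * norm (y - y') + (\<bar>Lq\<bar> + 2 * slope R) * norm (q - q')"
      unfolding distrib_right by linarith
    also have "\<dots> \<le> L * norm (y - y') + L * norm (q - q')" using L by (intro add_mono mult_right_mono) auto
    finally show ?thesis .
  qed
  then show ?thesis using L(1) by blast
qed

text \<open>Coupling with a constant function at a maximum and a minimum of \<psi> gives zero
  gradient and a sign of the jump term, so c w is compared with G at zero gradient. F is separate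
  from G so that truncated and original equation are both covered.\<close>

lemma ergodic_constant_bound:
  assumes \<psi>: "C1_holder_torus \<alpha> \<psi>" "0 < \<alpha>" "\<alpha> < 1"
    and F0: "\<And>y. F y 0 = G y 0"
    and eq: "\<And>y. - (\<kappa> / 2) * jump_integral \<psi> y + F y (grad \<psi> y) = c * w y"
  shows "\<bar>c\<bar> \<le> C5 / a0 * \<rho> powr m"
proof -
  have per: "zn_periodic \<psi>" using \<psi>(1) by (simp add: C1_holder_torus_def)
  note cont = C1_holder_torus_continuous[OF \<psi>(1)]
  have const: "C1_holder_torus \<alpha> (\<lambda>_::real^'n. 0)" using \<psi>(2) by (rule C1_holder_torus_const)
  have g0: "grad (\<lambda>_::real^'n. 0) x = 0" for x by (rule grad_eqI) (rule GDERIV_const)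
  have G0: "\<bar>G y 0\<bar> \<le> C5 * \<rho> powr m" for y using G_growth[of y 0] m by simp
  have scale: "z \<le> C5 / a0 * \<rho> powr m" if "z * w y \<le> C5 * \<rho> powr m" for z y
  proof (cases "z \<le> 0")
    case True
    then show ?thesis using C5 a0 by (smt (verit) divide_nonneg_pos mult_nonneg_nonneg powr_ge_zero)
  next
    case False
    then have "z * a0 \<le> z * w y" using w_bounds by (intro mult_left_mono) auto
    then have "z * a0 \<le> C5 * \<rho> powr m" using that by linarith
    then show ?thesis using a0 by (simp add: field_simps)
  qed
  obtain a where a: "\<And>y. \<psi> y \<le> \<psi> a" using zn_periodic_attains_max[OF per cont] by blast
  obtain b where b: "\<And>y. \<psi> b \<le> \<psi> y" using zn_periodic_attains_min[OF per cont] by blast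
  have "(- c) * w a \<le> C5 * \<rho> powr m"
  proof -
    have le: "1 * (\<psi> (a + z) - \<psi> a) \<le> 0 - 0" for z using a[of "a + z"] by simp
    have "grad \<psi> a = 0" using synchronous_coupling(1)[OF \<psi> const \<psi>(2,3), of 1 a 0] le g0 by simp
    moreover have "jump_integral \<psi> a \<le> 0" using synchronous_coupling(2)[OF \<psi> const \<psi>(2,3), of 1 a 0] le by (simp add: jump_integral_const)
    then have "0 \<le> - (\<kappa> / 2) * jump_integral \<psi> a" using \<kappa> by (simp add: mult_nonneg_nonpos)
    ultimately show ?thesis using eq[of a] G0[of a] F0[of a] by (simp add: abs_le_iff)
  qed
  moreover have "c * w b \<le> C5 * \<rho> powr m"
  proof -
    have le: "1 * (0 - 0) \<le> \<psi> (b + z) - \<psi> b" for z using b[of "b + z"] by simp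
    have "grad \<psi> b = 0" using synchronous_coupling(1)[OF const \<psi>(2,3) \<psi>, of 1 b "0 :: real^'n"] le g0 by simp
    moreover have "0 \<le> jump_integral \<psi> b" using synchronous_coupling(2)[OF const \<psi>(2,3) \<psi>, of 1 b "0 :: real^'n"] le by (simp add: jump_integral_const)
    then have "- (\<kappa> / 2) * jump_integral \<psi> b \<le> 0" using \<kappa> by simp
    ultimately show ?thesis using eq[of b] G0[of b] F0[of b] by (simp add: abs_le_iff)
  qed
  ultimately show ?thesis using scale[of "- c" a] scale[of c b] by (simp add: abs_le_iff)
qed

lemma trunc_solvable:
  assumes R: "0 < R"
  shows "\<exists>\<alpha> c \<psi>. 0 < \<alpha> \<and> \<alpha> < 1 \<and> C1_holder_torus \<alpha> \<psi> \<and>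
     (\<forall>y. - (\<kappa> / 2) * jump_integral \<psi> y + trunc R y (grad \<psi> y) = c * w y)"
proof -
  obtain L where L: "0 < L" "\<And>y y' q q'. \<bar>trunc R y q - trunc R y' q'\<bar> \<le> L * norm (y - y') + L * norm (q - q')"
    using trunc_lipschitz[OF R] by blast
  interpret lipschitz_cell_data \<kappa> "L + Lw" a0 "1 / a0" "C5 * \<rho> powr m" w "trunc R"
  proof
    show "\<bar>trunc R y q - trunc R y' q'\<bar> \<le> (L + Lw) * norm (y - y') + (L + Lw) * norm (q - q')" for y y' q q'
    proof -
      have "L * norm (y - y') + L * norm (q - q') \<le> (L + Lw) * norm (y - y') + (L + Lw) * norm (q - q')"
        using Lw by (intro add_mono mult_right_mono) auto
      then show ?thesis using L(2)[of y q y' q'] by linarith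
    qed
    show "\<bar>w y - w y'\<bar> \<le> (L + Lw) * norm (y - y')" for y y'
    proof -
      have "Lw * norm (y - y') \<le> (L + Lw) * norm (y - y')" using L(1) by (intro mult_right_mono) auto
      then show ?thesis using w_lipschitz[of y y'] by linarith
    qed
    show "zn_periodic (\<lambda>y. trunc R y q)" for q
      using G_periodic unfolding zn_periodic_def trunc_def by auto
    show "\<bar>trunc R y 0\<bar> \<le> C5 * \<rho> powr m" for y
      using G_growth[of y 0] m R by (simp add: trunc_inside)
  qed (use \<kappa> L Lw a0 w_bounds w_periodic in auto)
  show ?thesis by (rule lipschitz_cell_solution)
qed

end

text \<open>The gradient bound does not depend on the truncation radius, so R may be taken above it;
  the truncated solution then stays where \<open>trunc\<close> equals G. K is fixed before \<rho>, G
  and w, which is the uniformity in x, p and l.\<close>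

theorem coercive_cell_solvable:
  assumes \<kappa>: "0 < \<kappa>" and m: "1 < m" and b1: "0 < b1" and C1: "0 \<le> C1" and C2: "0 \<le> C2" and C5: "0 \<le> C5"
    and a0: "0 < a0" and Lw: "0 \<le> Lw"
  shows "\<exists>K>0. \<forall>\<rho> (G::real^'n \<Rightarrow> real^'n \<Rightarrow> real) w. coercive_cell \<kappa> m b1 C1 C2 C5 a0 Lw \<rho> G w \<longrightarrow>
     (\<exists>\<alpha> c \<psi>. 0 < \<alpha> \<and> \<alpha> < 1 \<and> C1_holder_torus \<alpha> \<psi> \<and>
        (\<forall>y. - (\<kappa> / 2) * jump_integral \<psi> y + G y (grad \<psi> y) = c * w y)) \<and>
     (\<forall>\<alpha> c \<psi>. 0 < \<alpha> \<longrightarrow> \<alpha> < 1 \<longrightarrow> C1_holder_torus \<alpha> \<psi> \<longrightarrow>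
        (\<forall>y. - (\<kappa> / 2) * jump_integral \<psi> y + G y (grad \<psi> y) = c * w y) \<longrightarrow>
        \<bar>c\<bar> \<le> C5 / a0 * \<rho> powr m \<and> (\<forall>y. norm (grad \<psi> y) \<le> K * \<rho>))"
proof -
  define Cc where "Cc = C5 / a0"
  have Cc: "0 \<le> Cc" using C5 a0 by (simp add: Cc_def)
  obtain T K where TK: "0 < T" "0 < K"
    and apriori: "\<And>(F::real^'n \<Rightarrow> real^'n \<Rightarrow> real) \<rho> R \<alpha> u y. 1 \<le> \<rho> \<Longrightarrow> T * \<rho> \<le> R \<Longrightarrow>
      coercive_structure m b1 (C1 + Cc / a0) (C2 + Cc * Lw) (C5 * (1 + 2 powr m) + Cc / a0) \<rho> R F \<Longrightarrow>
      C1_holder_torus \<alpha> u \<Longrightarrow> 0 < \<alpha> \<Longrightarrow> \<alpha> < 1 \<Longrightarrow>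
      (\<forall>y. - (\<kappa> / 2) * jump_integral u y + F y (grad u y) = 0) \<Longrightarrow> norm (grad u y) \<le> K * \<rho>"
    using apriori_gradient_bound[of b1 "C1 + Cc / a0" "C2 + Cc * Lw" "C5 * (1 + 2 powr m) + Cc / a0" m \<kappa>, where 'n = 'n]
      b1 C1 C2 C5 m \<kappa> a0 Cc Lw by (auto 0 3)
  have "(\<exists>\<alpha> c \<psi>. 0 < \<alpha> \<and> \<alpha> < 1 \<and> C1_holder_torus \<alpha> \<psi> \<and>
        (\<forall>y. - (\<kappa> / 2) * jump_integral \<psi> y + G y (grad \<psi> y) = c * w y)) \<and>
     (\<forall>\<alpha> c \<psi>. 0 < \<alpha> \<longrightarrow> \<alpha> < 1 \<longrightarrow> C1_holder_torus \<alpha> \<psi> \<longrightarrow>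
        (\<forall>y. - (\<kappa> / 2) * jump_integral \<psi> y + G y (grad \<psi> y) = c * w y) \<longrightarrow>
        \<bar>c\<bar> \<le> C5 / a0 * \<rho> powr m \<and> (\<forall>y. norm (grad \<psi> y) \<le> K * \<rho>))"
    if cell: "coercive_cell \<kappa> m b1 C1 C2 C5 a0 Lw \<rho> G w" for \<rho> w and G :: "real^'n \<Rightarrow> real^'n \<Rightarrow> real"
  proof -
    interpret coercive_cell \<kappa> m b1 C1 C2 C5 a0 Lw \<rho> G w by (rule cell)
    have bound: "norm (grad \<psi> y) \<le> K * \<rho>"
      if R: "2 * \<rho> \<le> R" "T * \<rho> \<le> R" and \<psi>: "C1_holder_torus \<alpha> \<psi>" "0 < \<alpha>" "\<alpha> < 1"
        and eq: "\<And>y. - (\<kappa> / 2) * jump_integral \<psi> y + trunc R y (grad \<psi> y) = c * w y" for R \<alpha> \<psi> c y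
    proof (rule apriori[OF \<rho> R(2) _ \<psi>])
      have "trunc R y 0 = G y 0" for y using R(1) \<rho> by (intro trunc_inside) simp
      then have "\<bar>c\<bar> \<le> C5 / a0 * \<rho> powr m" using eq by (rule ergodic_constant_bound[OF \<psi>])
      then show "coercive_structure m b1 (C1 + Cc / a0) (C2 + Cc * Lw) (C5 * (1 + 2 powr m) + Cc / a0) \<rho> R (\<lambda>y q. trunc R y q - c * w y)"
        using trunc_coercive_structure[OF R(1), of c Cc] Cc by (simp add: Cc_def)
      show "\<forall>y. - (\<kappa> / 2) * jump_integral \<psi> y + (trunc R y (grad \<psi> y) - c * w y) = 0" using eq by (simp add: algebra_simps)
    qed
    show ?thesis
    proof (intro conjI allI impI)
      define R where "R = max (max 2 T) K * \<rho>"
      have R: "2 * \<rho> \<le> R" "T * \<rho> \<le> R" "K * \<rho> \<le> R" unfolding R_def using \<rho> by (auto intro!: mult_right_mono)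
      then have "0 < R" using \<rho> by linarith
      then obtain \<alpha> c \<psi> where \<psi>: "C1_holder_torus \<alpha> \<psi>" "0 < \<alpha>" "\<alpha> < 1"
        and eq: "\<And>y. - (\<kappa> / 2) * jump_integral \<psi> y + trunc R y (grad \<psi> y) = c * w y"
        using trunc_solvable by blast
      have "norm (grad \<psi> y) \<le> R" for y using bound[OF R(1,2) \<psi> eq, of y] R(3) by linarith
      then have "trunc R y (grad \<psi> y) = G y (grad \<psi> y)" for y by (rule trunc_inside)
      then show "\<exists>\<alpha> c \<psi>. 0 < \<alpha> \<and> \<alpha> < 1 \<and> C1_holder_torus \<alpha> \<psi> \<and>
        (\<forall>y. - (\<kappa> / 2) * jump_integral \<psi> y + G y (grad \<psi> y) = c * w y)" using \<psi> eq by metis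
    next
      fix \<alpha> c \<psi> assume \<psi>: "0 < \<alpha>" "\<alpha> < 1" "C1_holder_torus \<alpha> \<psi>"
        and eq: "\<forall>y. - (\<kappa> / 2) * jump_integral \<psi> y + G y (grad \<psi> y) = c * w y"
      show "\<bar>c\<bar> \<le> C5 / a0 * \<rho> powr m" by (rule ergodic_constant_bound[OF \<psi>(3,1,2), of G]) (use eq in auto)
      obtain B where B: "\<And>y. norm (grad \<psi> y) \<le> B" using C1_holder_torus_grad_bounded[OF \<psi>(3,1)] by blast
      \<comment> \<open>A given solution has some bounded gradient; cutting off beyond B makes it a
        solution of a truncated equation, and the resulting bound no longer involves B.\<close>
      define R where "R = max (max 2 T * \<rho>) B"
      have "2 * \<rho> \<le> max 2 T * \<rho>" "T * \<rho> \<le> max 2 T * \<rho>" using \<rho> by (auto intro!: mult_right_mono)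
      then have R: "2 * \<rho> \<le> R" "T * \<rho> \<le> R" "B \<le> R" by (auto simp: R_def)
      have "trunc R y (grad \<psi> y) = G y (grad \<psi> y)" for y by (rule trunc_inside[OF order_trans[OF B R(3)]])
      then have "- (\<kappa> / 2) * jump_integral \<psi> y + trunc R y (grad \<psi> y) = c * w y" for y using eq by simp
      from bound[OF R(1,2) \<psi>(3,1,2) this] show "norm (grad \<psi> y) \<le> K * \<rho>" for y .
    qed
  qed
  then show ?thesis using TK(2) by blast
qed

subsection \<open>From the Hamiltonian to the coercive cell\<close>

lemma powr_add_le:
  fixes u v m :: real
  assumes "0 \<le> u" "0 \<le> v" "0 \<le> m"
  shows "(u + v) powr m \<le> 2 powr m * (u powr m + v powr m)"
proof -
  have "(u + v) powr m \<le> (2 * max u v) powr m" using assms by (intro powr_mono2) auto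
  also have "\<dots> = 2 powr m * max u v powr m" using assms by (simp add: powr_mult)
  also have "\<dots> \<le> 2 powr m * (u powr m + v powr m)"
    by (intro mult_left_mono) (auto simp: max_def)
  finally show ?thesis .
qed

text \<open>The shift by p disturbs the scaling: p + q/\<mu> equals P/\<mu> with P = \<mu> p + q,
  and replacing P by p + q costs (1 - \<mu>) L \<rho> (1 + (\<rho> + |q|)^(m-1)). This has lower
  order in q and is absorbed by b0 |P|^m for |q| \<ge> M \<rho>, and by a multiple of \<rho>^m
  otherwise. The drift is homogeneous and drops out of the defect; l leaves (1 - \<mu>) l, and |l|
  \<le> \<rho>^m.\<close>

lemma coercive_cell_of_hamiltonian:
  fixes a :: "real^'n \<Rightarrow> real" and H :: "real^'n \<Rightarrow> real^'n \<Rightarrow> real" and p b :: "real^'n" and l :: real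
  assumes \<kappa>: "0 < \<kappa>" and m: "1 < m" and a0: "0 < a0" and L: "0 < L" and h0: "0 \<le> h0" and b0: "0 < b0" and C0: "0 < C0"
    and a: "\<And>y. a0 \<le> a y" "\<And>y. a y \<le> 1 / a0" and a_lip: "\<And>y y'. \<bar>a y - a y'\<bar> \<le> L * norm (y - y')"
    and a_per: "zn_periodic a" and H_per: "\<And>q. zn_periodic (\<lambda>y. H y q)"
    and H0: "\<And>y. \<bar>H y 0\<bar> \<le> h0"
    and H_coer: "\<And>\<mu> y q. 0 < \<mu> \<Longrightarrow> \<mu> < 1 \<Longrightarrow> (1 - \<mu>) * (b0 * norm q powr m - C0) \<le> \<mu> * H y ((1 / \<mu>) *\<^sub>R q) - H y q"
    and H_lip: "\<And>R y y' q q'. 0 < R \<Longrightarrow> norm q \<le> R \<Longrightarrow> norm q' \<le> R \<Longrightarrow>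
       \<bar>H y q - H y' q'\<bar> \<le> L * (1 + R powr m) * norm (y - y') + L * (1 + R powr (m - 1)) * norm (q - q')"
  defines "M \<equiv> 2 + L * 4 powr m / b0" and "b1 \<equiv> a0 * b0 / 2 powr (m + 1)" and "Hc \<equiv> h0 + L + 2 * L * 2 powr m"
  defines "\<rho> \<equiv> 1 + norm p + \<bar>l\<bar> powr (1 / m)"
  shows "coercive_cell \<kappa> m b1 ((C0 + L * (1 + (1 + M) powr (m - 1))) / a0 + 1 + b1 * M powr m)
     (L / a0\<^sup>2 * Hc + L * (1 + 2 powr m) / a0) (Hc / a0 + norm b + 1) a0 (L / a0\<^sup>2) \<rho>
     (\<lambda>y q. H y (p + q) / a y + b \<bullet> q - l) (\<lambda>y. 1 / a y)"
proof -
  have \<rho>1: "1 \<le> \<rho>" "norm p \<le> \<rho>" by (auto simp: \<rho>_def)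
  have \<rho>m: "\<rho> \<le> \<rho> powr m" using powr_mono[of 1 m \<rho>] \<rho>1 m by simp
  have \<rho>m1: "1 \<le> \<rho> powr m" using \<rho>m \<rho>1 by linarith
  have lm: "\<bar>l\<bar> \<le> \<rho> powr m"
  proof -
    have "\<bar>l\<bar> = (\<bar>l\<bar> powr (1 / m)) powr m" using m by (simp add: powr_powr)
    also have "\<dots> \<le> \<rho> powr m" using m by (intro powr_mono2) (auto simp: \<rho>_def)
    finally show ?thesis .
  qed
  have M: "2 \<le> M" "L * 4 powr m / b0 \<le> M" using L b0 by (auto simp: M_def)
  have b1: "0 < b1" using a0 b0 by (simp add: b1_def)
  have Hc: "0 \<le> Hc" using h0 L by (simp add: Hc_def)
  have apos: "0 < a y" for y using a(1)[of y] a0 by linarith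
  have w: "a0 \<le> 1 / a y" "1 / a y \<le> 1 / a0" for y
    using a(1)[of y] a(2)[of y] a0 apos[of y] by (auto simp: field_simps)
  have wlip: "\<bar>1 / a y - 1 / a y'\<bar> \<le> L / a0\<^sup>2 * norm (y - y')" for y y'
  proof -
    have "\<bar>1 / a y - 1 / a y'\<bar> = \<bar>a y' - a y\<bar> / (a y * a y')"
      using apos[of y] apos[of y'] by (simp add: diff_frac_eq abs_mult)
    also have "\<dots> \<le> (L * norm (y - y')) / (a0 * a0)"
      using a_lip[of y' y] a a0 apos by (intro frac_le mult_mono mult_pos_pos) (auto simp: norm_minus_commute less_imp_le)
    finally show ?thesis by (simp add: power2_eq_square)
  qed
  have pq: "norm (p + q) \<le> \<rho> + norm q" for q using norm_triangle_ineq[of p q] \<rho>1 by linarith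
  have pqm: "(\<rho> + norm q) powr m \<le> 2 powr m * (\<rho> powr m + norm q powr m)" for q :: "real^'n"
    using powr_add_le[of \<rho> "norm q" m] \<rho>1 m by simp
  have Hgrow: "\<bar>H y (p + q)\<bar> \<le> Hc * (\<rho> powr m + norm q powr m)" for y q
  proof -
    let ?r = "\<rho> + norm q"
    have r: "0 < ?r" using \<rho>1 by (simp add: add_pos_nonneg)
    have "\<bar>H y (p + q) - H y 0\<bar> \<le> L * (1 + ?r powr m) * norm (y - y) + L * (1 + ?r powr (m - 1)) * norm (p + q - 0)"
      by (rule H_lip[OF r pq]) (use r in auto)
    also have "\<dots> \<le> L * (1 + ?r powr (m - 1)) * ?r"
      using L pq[of q] by (simp add: mult_left_mono)
    also have "\<dots> = L * (?r + ?r powr m)" using r by (simp add: powr_diff field_simps)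
    also have "\<dots> \<le> L * (2 * ?r powr m)"
    proof -
      have "1 \<le> ?r" using \<rho>1 norm_ge_zero[of q] by linarith
      then have "?r \<le> ?r powr m" using powr_mono[of 1 m ?r] m by simp
      then show ?thesis using L by simp
    qed
    also have "\<dots> \<le> L * (2 * (2 powr m * (\<rho> powr m + norm q powr m)))" using L pqm by (intro mult_left_mono) auto
    finally have 1: "\<bar>H y (p + q) - H y 0\<bar> \<le> 2 * L * 2 powr m * (\<rho> powr m + norm q powr m)" by simp
    have "(h0 + L) * 1 \<le> (h0 + L) * (\<rho> powr m + norm q powr m)" using h0 L \<rho>m1 by (intro mult_left_mono) (auto intro: add_increasing2)
    then have "h0 \<le> (h0 + L) * (\<rho> powr m + norm q powr m)" using L unfolding mult_1_right by linarith
    then show ?thesis using 1 H0[of y] unfolding Hc_def distrib_right[of "h0 + L"] by linarith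
  qed
  have b1': "b1 = a0 * (b0 / 2 powr (m + 1))" by (simp add: b1_def)
  let ?X = "C0 + L * (1 + (1 + M) powr (m - 1))"
  have X: "0 \<le> ?X" "C0 + L \<le> ?X" using C0 L by auto
  \<comment> \<open>M \<ge> 2 gives |P| \<ge> |q|/2 for large q, and M \<ge> L 4^m/b0 lets half of
    the coercive term absorb the shift. These losses and 1/a \<ge> a0 account for the factor
    a0/2^(m+1) in \<open>b1\<close>.\<close>
  have bracket: "b1 * norm q powr m - (?X / a0 + b1 * M powr m) * \<rho> powr m
      \<le> 1 / a y * (b0 * norm P powr m - C0 - L * \<rho> * (1 + (\<rho> + norm q) powr (m - 1)))"
    if P: "norm q - \<rho> \<le> norm P" for y and q P :: "real^'n"
  proof (cases "M * \<rho> \<le> norm q")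
    case True
    let ?s = "norm q"
    have s: "2 * \<rho> \<le> ?s" "0 < ?s" using True M(1) \<rho>1 mult_right_mono[of 2 M \<rho>] by linarith+
    have "(?s / 2) powr m \<le> norm P powr m" using P s m by (intro powr_mono2) auto
    then have "?s powr m / 2 powr m \<le> norm P powr m" by (simp add: powr_divide)
    then have 1: "b0 * (?s powr m / 2 powr m) \<le> b0 * norm P powr m" by (rule mult_left_mono) (use b0 in simp)
    have "L * \<rho> * (\<rho> + ?s) powr (m - 1) \<le> L * (?s / M) * (2 * ?s) powr (m - 1)"
    proof (intro mult_mono powr_mono2)
      show "\<rho> \<le> ?s / M" using True M(1) by (simp add: field_simps)
    qed (use L s \<rho>1 M m in auto)
    also have "\<dots> = (L * 2 powr m / (2 * M)) * ?s powr m" using s by (simp add: powr_mult powr_diff field_simps)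
    also have "\<dots> \<le> (b0 / (2 * 2 powr m)) * ?s powr m"
    proof (rule mult_right_mono)
      have four: "4 powr m = 2 powr m * 2 powr m" using powr_mult[of 2 2 m] by simp
      have "L * (2 powr m * 2 powr m) \<le> b0 * M" using M(2) b0 by (simp add: field_simps four)
      then show "L * 2 powr m / (2 * M) \<le> b0 / (2 * 2 powr m)" using M(1) by (simp add: field_simps)
    qed simp
    finally have 2: "L * \<rho> * (\<rho> + ?s) powr (m - 1) \<le> b0 / 2 * (?s powr m / 2 powr m)" by simp
    have 3: "C0 + L * \<rho> \<le> (C0 + L) * \<rho> powr m"
    proof -
      have "L * \<rho> \<le> L * \<rho> powr m" by (rule mult_left_mono[OF \<rho>m]) (use L in simp)
      moreover have "C0 * 1 \<le> C0 * \<rho> powr m" by (rule mult_left_mono[OF \<rho>m1]) (use C0 in simp)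
      ultimately show ?thesis by (simp add: distrib_right)
    qed
    have "b0 * norm P powr m - C0 - L * \<rho> * (1 + (\<rho> + ?s) powr (m - 1)) \<ge> b0 / 2 * (?s powr m / 2 powr m) - (C0 + L) * \<rho> powr m"
      using 1 2 3 by (simp add: distrib_left)
    then have "1 / a y * (b0 / 2 * (?s powr m / 2 powr m) - (C0 + L) * \<rho> powr m) \<le> 1 / a y * (b0 * norm P powr m - C0 - L * \<rho> * (1 + (\<rho> + ?s) powr (m - 1)))"
      using apos[of y] by (intro mult_left_mono) auto
    moreover have "a0 * (b0 / 2 * (?s powr m / 2 powr m)) \<le> 1 / a y * (b0 / 2 * (?s powr m / 2 powr m))"
      using w b0 by (intro mult_right_mono) auto
    moreover have "1 / a y * ((C0 + L) * \<rho> powr m) \<le> 1 / a0 * (?X * \<rho> powr m)"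
      using w(2)[of y] apos[of y] X C0 L a0 by (intro mult_mono mult_right_mono) auto
    moreover have "a0 * (b0 / 2 * (?s powr m / 2 powr m)) = b1 * ?s powr m" by (simp add: b1_def powr_add)
    moreover have "1 / a0 * (?X * \<rho> powr m) \<le> (?X / a0 + b1 * M powr m) * \<rho> powr m"
      using b1 by (simp add: distrib_right)
    ultimately show ?thesis unfolding right_diff_distrib[of "1 / a y" "b0 / 2 * (?s powr m / 2 powr m)"] by linarith
  next
    case False
    let ?s = "norm q"
    have s: "?s \<le> M * \<rho>" using False by simp
    have "L * \<rho> * (1 + (\<rho> + ?s) powr (m - 1)) \<le> L * \<rho> * (1 + ((1 + M) * \<rho>) powr (m - 1))"
      using L \<rho>1 s m by (intro mult_left_mono add_left_mono powr_mono2) (auto simp: distrib_right)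
    also have "\<dots> = L * (\<rho> + (1 + M) powr (m - 1) * \<rho> powr m)"
    proof -
      have "((1 + M) * \<rho>) powr (m - 1) = (1 + M) powr (m - 1) * \<rho> powr (m - 1)" by (rule powr_mult)
      moreover have "\<rho> * \<rho> powr (m - 1) = \<rho> powr m" using \<rho>1 by (simp add: powr_diff)
      then have "L * \<rho> * (1 + X * \<rho> powr (m - 1)) = L * (\<rho> + X * \<rho> powr m)" for X
        by (simp add: algebra_simps)
      ultimately show ?thesis by (simp only:)
    qed
    also have "\<dots> \<le> L * (\<rho> powr m + (1 + M) powr (m - 1) * \<rho> powr m)"
      using L \<rho>m by (intro mult_left_mono add_right_mono) auto
    also have "\<dots> = L * (1 + (1 + M) powr (m - 1)) * \<rho> powr m" by (simp add: algebra_simps)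
    finally have 1: "L * \<rho> * (1 + (\<rho> + ?s) powr (m - 1)) \<le> L * (1 + (1 + M) powr (m - 1)) * \<rho> powr m" .
    have "C0 * 1 \<le> C0 * \<rho> powr m" by (rule mult_left_mono[OF \<rho>m1]) (use C0 in simp)
    then have "C0 + L * \<rho> * (1 + (\<rho> + ?s) powr (m - 1)) \<le> ?X * \<rho> powr m"
      using 1 by (simp add: distrib_right)
    moreover have "0 \<le> b0 * norm P powr m" using b0 by simp
    ultimately have "- (?X * \<rho> powr m) \<le> b0 * norm P powr m - C0 - L * \<rho> * (1 + (\<rho> + ?s) powr (m - 1))" by linarith
    then have "1 / a y * (- (?X * \<rho> powr m)) \<le> 1 / a y * (b0 * norm P powr m - C0 - L * \<rho> * (1 + (\<rho> + ?s) powr (m - 1)))"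
      using apos[of y] by (intro mult_left_mono) auto
    moreover have "1 / a y * (?X * \<rho> powr m) \<le> 1 / a0 * (?X * \<rho> powr m)"
      using w(2)[of y] X by (intro mult_right_mono) auto
    moreover have "b1 * ?s powr m \<le> b1 * M powr m * \<rho> powr m"
    proof -
      have "?s powr m \<le> (M * \<rho>) powr m" using s m by (intro powr_mono2) auto
      then show ?thesis using b1 M \<rho>1 by (simp add: powr_mult)
    qed
    moreover have "1 / a y * (- (?X * \<rho> powr m)) = - (1 / a y * (?X * \<rho> powr m))" by (rule mult_minus_right)
    moreover have "(?X / a0 + b1 * M powr m) * \<rho> powr m = 1 / a0 * (?X * \<rho> powr m) + b1 * M powr m * \<rho> powr m"
      by (simp only: distrib_right times_divide_eq_left mult_1)
    ultimately show ?thesis by linarith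
  qed
  show ?thesis
  proof
    show "0 \<le> (C0 + L * (1 + (1 + M) powr (m - 1))) / a0 + 1 + b1 * M powr m" using X a0 b1 by simp
    show "0 \<le> L / a0\<^sup>2 * Hc + L * (1 + 2 powr m) / a0" using L Hc a0 by simp
    show "0 \<le> Hc / a0 + norm b + 1" using Hc a0 by simp
    show "0 \<le> L / a0\<^sup>2" using L by simp
    show "zn_periodic (\<lambda>y. 1 / a y)" using a_per by (simp add: zn_periodic_def)
    show "zn_periodic (\<lambda>y. H y (p + q) / a y + b \<bullet> q - l)" for q using a_per H_per[of "p + q"] by (simp add: zn_periodic_def)
  next
    fix \<mu> :: real and y q :: "real^'n" assume \<mu>: "0 < \<mu>" "\<mu> < 1"
    define P where "P = \<mu> *\<^sub>R p + q"
    have Pq: "p + (1 / \<mu>) *\<^sub>R q = (1 / \<mu>) *\<^sub>R P" using \<mu> by (simp add: P_def scaleR_right_distrib)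
    have nmp: "norm (\<mu> *\<^sub>R p) \<le> \<rho>" using \<mu> \<rho>1 mult_left_le_one_le[of "norm p" \<mu>] by simp
    have nP: "norm P \<le> \<rho> + norm q" "norm q - \<rho> \<le> norm P"
      using norm_triangle_ineq[of "\<mu> *\<^sub>R p" q] norm_diff_ineq[of q "\<mu> *\<^sub>R p"] nmp by (auto simp: P_def add.commute)
    have r: "0 < \<rho> + norm q" using \<rho>1 by (simp add: add_pos_nonneg)
    have "\<bar>H y P - H y (p + q)\<bar> \<le> L * (1 + (\<rho> + norm q) powr m) * norm (y - y) + L * (1 + (\<rho> + norm q) powr (m - 1)) * norm (P - (p + q))"
      by (rule H_lip[OF r nP(1) pq])
    moreover have "norm (P - (p + q)) \<le> (1 - \<mu>) * \<rho>"
    proof -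
      have "P - (p + q) = - ((1 - \<mu>) *\<^sub>R p)" by (simp add: P_def algebra_simps)
      then show ?thesis using \<mu> \<rho>1 by simp
    qed
    then have "L * (1 + (\<rho> + norm q) powr (m - 1)) * norm (P - (p + q)) \<le> L * (1 + (\<rho> + norm q) powr (m - 1)) * ((1 - \<mu>) * \<rho>)"
      using L by (intro mult_left_mono) auto
    ultimately have "- ((1 - \<mu>) * (L * \<rho> * (1 + (\<rho> + norm q) powr (m - 1)))) \<le> H y P - H y (p + q)" by (simp add: ac_simps)
    moreover have "(1 - \<mu>) * (b0 * norm P powr m - C0) \<le> \<mu> * H y ((1 / \<mu>) *\<^sub>R P) - H y P" by (rule H_coer[OF \<mu>])
    moreover have "(1 - \<mu>) * (b0 * norm P powr m - C0 - L * \<rho> * (1 + (\<rho> + norm q) powr (m - 1)))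
       = (1 - \<mu>) * (b0 * norm P powr m - C0) - (1 - \<mu>) * (L * \<rho> * (1 + (\<rho> + norm q) powr (m - 1)))"
      by (rule right_diff_distrib)
    ultimately have "(1 - \<mu>) * (b0 * norm P powr m - C0 - L * \<rho> * (1 + (\<rho> + norm q) powr (m - 1))) \<le> \<mu> * H y (p + (1 / \<mu>) *\<^sub>R q) - H y (p + q)"
      unfolding Pq by linarith
    then have "1 / a y * ((1 - \<mu>) * (b0 * norm P powr m - C0 - L * \<rho> * (1 + (\<rho> + norm q) powr (m - 1)))) \<le> 1 / a y * (\<mu> * H y (p + (1 / \<mu>) *\<^sub>R q) - H y (p + q))"
      using apos[of y] by (intro mult_left_mono) auto
    moreover have "(1 - \<mu>) * (b1 * norm q powr m - (?X / a0 + b1 * M powr m) * \<rho> powr m)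
        \<le> (1 - \<mu>) * (1 / a y * (b0 * norm P powr m - C0 - L * \<rho> * (1 + (\<rho> + norm q) powr (m - 1))))"
      using \<mu> by (intro mult_left_mono bracket nP(2)) auto
    moreover have "(1 - \<mu>) * (- (\<rho> powr m)) \<le> (1 - \<mu>) * l" using \<mu> lm by (intro mult_left_mono) (auto simp: abs_le_iff)
    moreover have "\<mu> * (H y (p + (1 / \<mu>) *\<^sub>R q) / a y + b \<bullet> ((1 / \<mu>) *\<^sub>R q) - l) - (H y (p + q) / a y + b \<bullet> q - l)
       = 1 / a y * (\<mu> * H y (p + (1 / \<mu>) *\<^sub>R q) - H y (p + q)) + (1 - \<mu>) * l"
      using \<mu> by (simp add: diff_divide_distrib algebra_simps)
    moreover have "(1 - \<mu>) * (b1 * norm q powr m - (?X / a0 + 1 + b1 * M powr m) * \<rho> powr m)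
       = (1 - \<mu>) * (b1 * norm q powr m - (?X / a0 + b1 * M powr m) * \<rho> powr m) + (1 - \<mu>) * (- (\<rho> powr m))"
      by (simp add: algebra_simps)
    ultimately show "(1 - \<mu>) * (b1 * norm q powr m - (?X / a0 + 1 + b1 * M powr m) * \<rho> powr m)
       \<le> \<mu> * (H y (p + (1 / \<mu>) *\<^sub>R q) / a y + b \<bullet> ((1 / \<mu>) *\<^sub>R q) - l) - (H y (p + q) / a y + b \<bullet> q - l)"
      by (simp only: mult.left_commute[of "1 / a y" "1 - \<mu>"])
  next
    fix y y' q :: "real^'n"
    let ?S = "\<rho> powr m + norm q powr m"
    have r: "0 < \<rho> + norm q" using \<rho>1 by (simp add: add_pos_nonneg)
    have "\<bar>H y (p + q) - H y' (p + q)\<bar> \<le> L * (1 + (\<rho> + norm q) powr m) * norm (y - y') + L * (1 + (\<rho> + norm q) powr (m - 1)) * norm (p + q - (p + q))"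
      by (rule H_lip[OF r pq pq])
    also have "\<dots> \<le> L * ((1 + 2 powr m) * ?S) * norm (y - y')"
    proof -
      have "1 + (\<rho> + norm q) powr m \<le> ?S + 2 powr m * ?S" using pqm[of q] \<rho>m1 by (intro add_mono) (auto intro: add_increasing2)
      then show ?thesis using L by (simp add: distrib_right mult_right_mono mult_left_mono)
    qed
    finally have 1: "\<bar>H y (p + q) - H y' (p + q)\<bar> \<le> L * ((1 + 2 powr m) * ?S) * norm (y - y')" .
    have "1 / a y * \<bar>H y (p + q) - H y' (p + q)\<bar> \<le> 1 / a0 * (L * ((1 + 2 powr m) * ?S) * norm (y - y'))"
      using 1 w(2)[of y] apos[of y] a0 by (intro mult_mono) auto
    moreover have "\<bar>1 / a y - 1 / a y'\<bar> * \<bar>H y' (p + q)\<bar> \<le> (L / a0\<^sup>2 * norm (y - y')) * (Hc * ?S)"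
      using L by (intro mult_mono wlip Hgrow) auto
    moreover have "\<bar>H y (p + q) / a y + b \<bullet> q - l - (H y' (p + q) / a y' + b \<bullet> q - l)\<bar>
       \<le> 1 / a y * \<bar>H y (p + q) - H y' (p + q)\<bar> + \<bar>1 / a y - 1 / a y'\<bar> * \<bar>H y' (p + q)\<bar>"
    proof -
      have "H y (p + q) / a y + b \<bullet> q - l - (H y' (p + q) / a y' + b \<bullet> q - l)
         = 1 / a y * (H y (p + q) - H y' (p + q)) + (1 / a y - 1 / a y') * H y' (p + q)"
        by (simp add: algebra_simps diff_divide_distrib)
      also have "\<bar>\<dots>\<bar> \<le> \<bar>1 / a y * (H y (p + q) - H y' (p + q))\<bar> + \<bar>(1 / a y - 1 / a y') * H y' (p + q)\<bar>"
        by (rule abs_triangle_ineq)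
      finally show ?thesis using apos[of y] unfolding abs_mult by simp
    qed
    ultimately have "\<bar>H y (p + q) / a y + b \<bullet> q - l - (H y' (p + q) / a y' + b \<bullet> q - l)\<bar>
       \<le> 1 / a0 * (L * ((1 + 2 powr m) * ?S) * norm (y - y')) + (L / a0\<^sup>2 * norm (y - y')) * (Hc * ?S)" by linarith
    also have "\<dots> = (L / a0\<^sup>2 * Hc + L * (1 + 2 powr m) / a0) * ?S * norm (y - y')"
    proof -
      have "1 / a0 * (L * (E * S) * n) + (c * n) * (Hc * S) = (c * Hc + L * E / a0) * S * n" for E S c n :: real
        by (simp add: algebra_simps)
      then show ?thesis .
    qed
    finally show "\<bar>H y (p + q) / a y + b \<bullet> q - l - (H y' (p + q) / a y' + b \<bullet> q - l)\<bar>
       \<le> (L / a0\<^sup>2 * Hc + L * (1 + 2 powr m) / a0) * ?S * norm (y - y')" .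
  next
    fix y q :: "real^'n"
    let ?S = "\<rho> powr m + norm q powr m"
    have "\<bar>H y (p + q) / a y\<bar> \<le> (Hc * ?S) * (1 / a0)"
    proof -
      have "\<bar>H y (p + q)\<bar> * (1 / a y) \<le> (Hc * ?S) * (1 / a0)"
        using Hgrow[of y q] w(2)[of y] apos[of y] Hc by (intro mult_mono) auto
      then show ?thesis using apos[of y] by (simp add: abs_divide)
    qed
    moreover have "\<bar>b \<bullet> q\<bar> \<le> norm b * ?S"
    proof -
      have "norm q \<le> ?S"
      proof (cases "norm q \<le> 1")
        case True
        then show ?thesis using \<rho>m1 by (simp add: add_increasing2)
      next
        case False
        then have "norm q \<le> norm q powr m" using powr_mono[of 1 m "norm q"] m by simp
        then show ?thesis by (simp add: add_increasing)
      qed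
      then have "norm b * norm q \<le> norm b * ?S" by (intro mult_left_mono) auto
      then show ?thesis using Cauchy_Schwarz_ineq2[of b q] by linarith
    qed
    moreover have "\<bar>l\<bar> \<le> ?S" using lm by (simp add: add_increasing2)
    ultimately have "\<bar>H y (p + q) / a y + b \<bullet> q - l\<bar> \<le> (Hc * ?S) * (1 / a0) + norm b * ?S + ?S" by linarith
    then show "\<bar>H y (p + q) / a y + b \<bullet> q - l\<bar> \<le> (Hc / a0 + norm b + 1) * ?S" by (simp add: distrib_right)
  next
    fix R :: real
    let ?r = "\<rho> + \<bar>R\<bar>"
    show "\<exists>Lq. \<forall>y q q'. norm q \<le> R \<longrightarrow> norm q' \<le> R \<longrightarrow>
       \<bar>(H y (p + q) / a y + b \<bullet> q - l) - (H y (p + q') / a y + b \<bullet> q' - l)\<bar> \<le> Lq * norm (q - q')"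
    proof (intro exI[of _ "L * (1 + ?r powr (m - 1)) / a0 + norm b"] allI impI)
      fix y q q' :: "real^'n" assume q: "norm q \<le> R" "norm q' \<le> R"
      have r: "0 < ?r" using \<rho>1 by (simp add: add_pos_nonneg)
      have n: "norm (p + q) \<le> ?r" "norm (p + q') \<le> ?r" using pq[of q] pq[of q'] q by linarith+
      have "\<bar>H y (p + q) - H y (p + q')\<bar> \<le> L * (1 + ?r powr (m - 1)) * norm (q - q')"
        using H_lip[OF r n, of y y] by simp
      then have "\<bar>H y (p + q) - H y (p + q')\<bar> * (1 / a y) \<le> (L * (1 + ?r powr (m - 1)) * norm (q - q')) * (1 / a0)"
        using w(2)[of y] apos[of y] L by (intro mult_mono) auto
      moreover have "\<bar>b \<bullet> (q - q')\<bar> \<le> norm b * norm (q - q')" by (rule Cauchy_Schwarz_ineq2)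
      moreover have "\<bar>(H y (p + q) / a y + b \<bullet> q - l) - (H y (p + q') / a y + b \<bullet> q' - l)\<bar>
         \<le> \<bar>H y (p + q) - H y (p + q')\<bar> * (1 / a y) + \<bar>b \<bullet> (q - q')\<bar>"
      proof -
        have "(H y (p + q) / a y + b \<bullet> q - l) - (H y (p + q') / a y + b \<bullet> q' - l) = (H y (p + q) - H y (p + q')) * (1 / a y) + b \<bullet> (q - q')"
          by (simp add: diff_divide_distrib inner_diff_right)
        also have "\<bar>\<dots>\<bar> \<le> \<bar>(H y (p + q) - H y (p + q')) * (1 / a y)\<bar> + \<bar>b \<bullet> (q - q')\<bar>" by (rule abs_triangle_ineq)
        finally show ?thesis using apos[of y] by (simp add: abs_mult)
      qed
      ultimately show "\<bar>(H y (p + q) / a y + b \<bullet> q - l) - (H y (p + q') / a y + b \<bullet> q' - l)\<bar>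
        \<le> (L * (1 + ?r powr (m - 1)) / a0 + norm b) * norm (q - q')" by (simp add: distrib_right)
    qed
  qed (use \<kappa> m b1 a0 \<rho>1 w wlip in auto)
qed

subsection \<open>The drift\<close>

text \<open>Reflection at the origin preserves the completed measure, so the integral equals its own
  negative.\<close>

lemma integral_lebesgue_odd:
  fixes f :: "'a::euclidean_space \<Rightarrow> 'b::euclidean_space"
  assumes [measurable]: "f \<in> borel_measurable lebesgue" and odd: "\<And>z. f (- z) = - f z"
  shows "(LINT z|lebesgue. f z) = 0"
proof -
  let ?T = "\<lambda>x::'a. 0 + (\<Sum>j\<in>Basis. (- 1 * (x \<bullet> j)) *\<^sub>R j)"
  have T: "?T = uminus" by (auto simp: sum_negf euclidean_representation)
  have eq: "lebesgue = distr lebesgue lebesgue (uminus :: 'a \<Rightarrow> 'a)" and [measurable]: "(uminus :: 'a \<Rightarrow> 'a) \<in> lebesgue \<rightarrow>\<^sub>M lebesgue"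
    using lebesgue_affine_euclidean[of "\<lambda>_. - 1" "0::'a"] lebesgue_affine_measurable[of "\<lambda>_. - 1" "0::'a"] unfolding T
    by (simp_all add: density_1)
  have "(LINT z|lebesgue. f z) = (LINT z|distr lebesgue lebesgue uminus. f z)" using eq by simp
  also have "\<dots> = (LINT z|lebesgue. f (- z))" by (rule integral_distr) measurable
  also have "\<dots> = - (LINT z|lebesgue. f z)" by (simp add: odd)
  finally have "2 *\<^sub>R (LINT z|lebesgue. f z) = 0" by (simp add: scaleR_2 eq_neg_iff_add_eq_0)
  then show ?thesis by simp
qed

text \<open>In the symmetric case every truncated integrand is odd and all truncations vanish.
  Otherwise the integrand is dominated by \<omega>(|z|)/|z|^N on the unit ball, whose integral in
  polar coordinates is a multiple of the Dini integral.\<close>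

lemma truncated_drift_converges:
  fixes K kbar :: "real^'n \<Rightarrow> real"
  assumes K_measurable: "K \<in> borel_measurable lebesgue"
    and kbar: "\<forall>z. z \<noteq> 0 \<longrightarrow> kbar z = K z * norm z ^ (CARD('n) + 1)"
    and kbar_bounded: "bounded (range kbar)"
    and kbar_dini: "\<not> (\<forall>z. K z = K (- z)) \<longrightarrow>
          (\<integral>\<^sup>+ r\<in>{0<..<1}. ennreal (kernel_modulus kbar r / r) \<partial>lborel) < \<infinity>"
  shows "\<exists>b. (truncated_drift kbar \<longlongrightarrow> b) (at_right 0) \<and> ((\<forall>z. K z = K (- z)) \<longrightarrow> b = 0)"
proof -
  let ?N = "CARD('n)"
  define f where "f z = ((kbar z - kbar 0) / norm z ^ (?N + 1)) *\<^sub>R z" for z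
  have f0: "f 0 = 0" by (simp add: f_def)
  have kb: "kbar = (\<lambda>z. if z = 0 then kbar 0 else K z * norm z ^ (?N + 1))" using kbar by auto
  have bl: "borel_measurable borel \<subseteq> borel_measurable (lebesgue :: (real^'n) measure)"
    using measurable_completion[of _ lborel] by auto
  have [measurable]: "(\<lambda>z::real^'n. norm z) \<in> borel_measurable lebesgue" "(\<lambda>z::real^'n. z) \<in> borel_measurable lebesgue"
    using bl by (auto intro!: measurable_completion)
  have km: "kbar \<in> borel_measurable lebesgue"
  proof -
    have "(\<lambda>z. if z \<in> {0} then kbar 0 else K z * norm z ^ (?N + 1)) \<in> borel_measurable lebesgue"
      by (intro measurable_If_set borel_measurable_times K_measurable borel_measurable_power) auto
    then show ?thesis using kb by simp
  qed
  have fm: "f \<in> borel_measurable lebesgue"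
    unfolding f_def [abs_def]
    by (intro borel_measurable_scaleR borel_measurable_divide borel_measurable_diff borel_measurable_const borel_measurable_power km) auto
  have td: "truncated_drift kbar \<rho> = (LINT z|lebesgue. indicat_real (ball 0 1 - ball 0 \<rho>) z *\<^sub>R f z)" for \<rho>
    unfolding truncated_drift_def set_lebesgue_integral_def f_def ..
  have indm: "(\<lambda>z. indicat_real S z *\<^sub>R f z) \<in> borel_measurable lebesgue" if "S \<in> sets borel" for S
    using that by (intro borel_measurable_scaleR borel_measurable_indicator fm) auto
  show ?thesis
  proof (cases "\<forall>z. K z = K (- z)")
    case True
    have even: "kbar (- z) = kbar z" for z using kbar True by (cases "z = 0") auto
    have "truncated_drift kbar \<rho> = 0" for \<rho>
      unfolding td by (rule integral_lebesgue_odd[OF indm]) (auto simp: f_def even indicator_def)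
    then have "truncated_drift kbar = (\<lambda>_. 0)" by (rule ext)
    then show ?thesis by (intro exI[of _ 0]) simp
  next
    case False
    have dini: "(\<integral>\<^sup>+ r\<in>{0<..<1}. ennreal (kernel_modulus kbar r / r) \<partial>lborel) < \<infinity>" using kbar_dini False by blast
    obtain B where B: "\<And>z. \<bar>kbar z\<bar> \<le> B" using kbar_bounded by (auto simp: bounded_iff)
    \<comment> \<open>Clamping the radius at 0 makes the modulus monotone on the whole line, hence
      Borel; at negative radii \<open>kernel_modulus\<close> is a supremum over the empty
      set.\<close>
    define \<omega> where "\<omega> r = kernel_modulus kbar (max r 0)" for r
    have bdd: "bdd_above ((\<lambda>z. \<bar>kbar z - kbar 0\<bar>) ` S)" for S
    proof (rule bdd_aboveI2)
      show "\<bar>kbar z - kbar 0\<bar> \<le> 2 * B" for z using B[of z] B[of 0] by linarith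
    qed
    have "mono \<omega>"
      unfolding mono_def \<omega>_def kernel_modulus_def by (auto intro!: cSUP_subset_mono bdd)
    then have [measurable]: "\<omega> \<in> borel_measurable borel" by (rule borel_measurable_mono)
    have \<omega>0: "0 \<le> \<omega> r" for r
    proof -
      have "\<bar>kbar 0 - kbar 0\<bar> \<le> \<omega> r" unfolding \<omega>_def kernel_modulus_def by (intro cSUP_upper bdd) auto
      then show ?thesis by simp
    qed
    have k\<omega>: "\<bar>kbar z - kbar 0\<bar> \<le> \<omega> (norm z)" for z
      unfolding \<omega>_def kernel_modulus_def by (intro cSUP_upper bdd) auto
    define g where "g r = \<omega> r / r ^ ?N * indicat_real {0<..<1} r" for r
    have [measurable]: "g \<in> borel_measurable borel" unfolding g_def [abs_def] by measurable
    have nf: "norm (indicat_real (ball 0 1 - S) z *\<^sub>R f z) \<le> g (norm z)" for z S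
    proof (cases "z = 0")
      case False
      have "norm (f z) = \<bar>kbar z - kbar 0\<bar> / norm z ^ ?N"
        using False by (simp add: f_def)
      also have "\<dots> \<le> \<omega> (norm z) / norm z ^ ?N" by (intro divide_right_mono k\<omega>) auto
      finally show ?thesis using False \<omega>0 by (auto simp: g_def indicator_def)
    qed (simp add: f0 g_def)
    have gint: "(\<integral>\<^sup>+ z. ennreal (g (norm (z::real^'n))) \<partial>lborel) < \<infinity>"
    proof -
      have "(\<integral>\<^sup>+ z. ennreal (g (norm (z::real^'n))) \<partial>lborel)
        = (\<integral>\<^sup>+ r. ennreal (unit_ball_vol ?N * real ?N * r ^ (?N - 1)) * indicator {0..} r * ennreal (g r) \<partial>lborel)"
        by (subst nn_integral_norm_polar) auto
      also have "\<dots> = (\<integral>\<^sup>+ r. ennreal (unit_ball_vol ?N * real ?N) * (ennreal (kernel_modulus kbar r / r) * indicator {0<..<1} r) \<partial>lborel)"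
      proof (rule nn_integral_cong)
        fix r :: real
        show "ennreal (unit_ball_vol ?N * real ?N * r ^ (?N - 1)) * indicator {0..} r * ennreal (g r)
          = ennreal (unit_ball_vol ?N * real ?N) * (ennreal (kernel_modulus kbar r / r) * indicator {0<..<1} r)"
        proof (cases "0 < r \<and> r < 1")
          case True
          obtain k where k: "?N = Suc k" using zero_less_card_finite[where 'a='n] by (metis gr0_implies_Suc)
          have "r ^ (?N - 1) * (\<omega> r / r ^ ?N) = \<omega> r / r" unfolding k using True by (simp add: field_simps)
          then have "unit_ball_vol ?N * real ?N * r ^ (?N - 1) * (\<omega> r / r ^ ?N) = unit_ball_vol ?N * real ?N * (\<omega> r / r)"
            by (metis mult.assoc)
          moreover have "kernel_modulus kbar r = \<omega> r" using True by (simp add: \<omega>_def)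
          ultimately show ?thesis using True \<omega>0[of r]
            by (simp add: g_def ennreal_mult[symmetric] ennreal_mult'[symmetric])
        next
          case False
          then show ?thesis by (auto simp: g_def)
        qed
      qed
      also have "\<dots> = ennreal (unit_ball_vol ?N * real ?N) * (\<integral>\<^sup>+ r\<in>{0<..<1}. ennreal (kernel_modulus kbar r / r) \<partial>lborel)"
      proof (rule nn_integral_cmult)
        have "(\<lambda>r. ennreal (\<omega> r / r) * indicator {0<..<1} r) \<in> borel_measurable lborel" by measurable
        moreover have "(\<lambda>r. ennreal (kernel_modulus kbar r / r) * indicator {0<..<1} r) = (\<lambda>r. ennreal (\<omega> r / r) * indicator {0<..<1} r)"
          by (auto simp: \<omega>_def indicator_def fun_eq_iff)
        ultimately show "(\<lambda>r. ennreal (kernel_modulus kbar r / r) * indicator {0<..<1} r) \<in> borel_measurable lborel" by simp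
      qed
      also have "\<dots> < \<infinity>" using dini by (auto simp: ennreal_mult_less_top)
      finally show ?thesis .
    qed
    have gi: "integrable lebesgue (\<lambda>z::real^'n. g (norm z))"
    proof -
      have "integrable lborel (\<lambda>z::real^'n. g (norm z))"
        using gint \<omega>0 by (intro integrableI_nonneg) (auto simp: g_def)
      then show ?thesis by (subst integrable_completion) auto
    qed
    have "(truncated_drift kbar \<longlongrightarrow> (LINT z|lebesgue. indicat_real (ball 0 1 - {}) z *\<^sub>R f z)) (at_right 0)"
      unfolding tendsto_at_iff_sequentially
    proof (intro allI impI)
      fix X :: "nat \<Rightarrow> real" assume X: "\<forall>i. X i \<in> {0<..} - {0}" "X \<longlonglongrightarrow> 0"
      show "(truncated_drift kbar \<circ> X) \<longlonglongrightarrow> (LINT z|lebesgue. indicat_real (ball 0 1 - {}) z *\<^sub>R f z)"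
        unfolding o_def td
      proof (rule integral_dominated_convergence[OF indm indm gi])
        show "AE z in lebesgue. (\<lambda>n. indicat_real (ball 0 1 - ball 0 (X n)) z *\<^sub>R f z) \<longlonglongrightarrow> indicat_real (ball 0 1 - {}) z *\<^sub>R f z"
        proof (rule AE_I2)
          fix z :: "real^'n"
          show "(\<lambda>n. indicat_real (ball 0 1 - ball 0 (X n)) z *\<^sub>R f z) \<longlonglongrightarrow> indicat_real (ball 0 1 - {}) z *\<^sub>R f z"
          proof (cases "z = 0")
            case False
            have "\<forall>\<^sub>F n in sequentially. X n < norm z" using order_tendstoD(2)[OF X(2), of "norm z"] False by simp
            then have "\<forall>\<^sub>F n in sequentially. indicat_real (ball 0 1 - ball 0 (X n)) z *\<^sub>R f z = indicat_real (ball 0 1 - {}) z *\<^sub>R f z"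
              by eventually_elim (auto simp: indicator_def)
            then show ?thesis by (rule tendsto_eventually)
          qed (simp add: f0)
        qed
        show "AE z in lebesgue. norm (indicat_real (ball 0 1 - ball 0 (X n)) z *\<^sub>R f z) \<le> g (norm z)" for n
          by (rule AE_I2) (rule nf)
      qed auto
    qed
    then show ?thesis using False by blast
  qed
qed

section \<open>Assembly for the original cell problem\<close>

lemma cell_solution_iff:
  fixes a :: "real^'n \<Rightarrow> real^'n \<Rightarrow> real"
  assumes a: "\<And>y. 0 < a x y"
  shows "cell_solution a H b x p l c \<psi> \<longleftrightarrow>
    (\<exists>\<alpha>. 0 < \<alpha> \<and> \<alpha> < 1 \<and> C1_holder_torus \<alpha> \<psi> \<and>
      (\<forall>y. - (half_laplacian_const TYPE('n) / 2) * jump_integral \<psi> y + (H x y (p + grad \<psi> y) / a x y + b \<bullet> grad \<psi> y - l) = c * (1 / a x y)))"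
proof -
  have "- a x y * l + a x y * half_laplacian \<psi> y + a x y * (b \<bullet> grad \<psi> y) + H x y (p + grad \<psi> y) = c
     \<longleftrightarrow> half_laplacian \<psi> y + (H x y (p + grad \<psi> y) / a x y + b \<bullet> grad \<psi> y - l) = c * (1 / a x y)" for y
    using a[of y] by (simp add: field_simps)
  then show ?thesis
    unfolding cell_solution_def
    by (auto simp: half_laplacian_eq_jump_integral)
qed

theorem proposition5p1:
  fixes a :: "real ^ 'n \<Rightarrow> real ^ 'n \<Rightarrow> real"
    and H :: "real ^ 'n \<Rightarrow> real ^ 'n \<Rightarrow> real ^ 'n \<Rightarrow> real"
    and K kbar :: "real ^ 'n \<Rightarrow> real"
    and b :: "real ^ 'n"
    and m :: real
  assumes a_cont: "uniformly_continuous_on UNIV (\<lambda>(x, y). a x y)"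
    and H_cont: "continuous_on UNIV (\<lambda>(x, y, p). H x y p)"
    and K_nonneg: "\<forall>z. 0 \<le> K z"
    and K_measurable: "K \<in> borel_measurable lebesgue"
    and a_elliptic: "\<exists>a0>0. \<forall>x y. a0 \<le> a x y \<and> a x y \<le> inverse a0"
    and kbar: "\<forall>z. z \<noteq> 0 \<longrightarrow> kbar z = K z * norm z ^ (CARD('n) + 1)"
    and kbar_bounded: "bounded (range kbar)"
    and kbar_cont: "isCont kbar 0"
    and kbar_0: "kbar 0 = half_laplacian_const TYPE('n)" "0 < kbar 0"
    and H_0_bounded: "bounded (range (\<lambda>(x, y). H x y 0))"
    and a_bounded: "bounded (range (\<lambda>(x, y). a x y))"
    and a_periodic: "\<forall>x. zn_periodic (\<lambda>y. a x y)"
    and H_periodic: "\<forall>x p. zn_periodic (\<lambda>y. H x y p)"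
    and m: "1 < m"
    and H_coercive: "\<exists>b0>0. \<exists>C0>0. \<forall>\<mu> x y p. 0 < \<mu> \<and> \<mu> < 1 \<longrightarrow>
          \<mu> * H x y (inverse \<mu> *\<^sub>R p) - H x y p \<ge> (1 - \<mu>) * (b0 * norm p powr m - C0)"
    and H_a_lipschitz: "\<exists>L>0. \<forall>R>0. \<forall>x y x' y' p p'. norm p \<le> R \<and> norm p' \<le> R \<longrightarrow>
          \<bar>H x y p - H x' y' p'\<bar>
            \<le> L * (1 + R powr m) * norm ((x, y) - (x', y')) + L * (1 + R powr (m - 1)) * norm (p - p')
          \<and> \<bar>a x y - a x' y'\<bar> \<le> L * norm ((x, y) - (x', y'))"
    and kbar_dini: "\<not> (\<forall>z. K z = K (- z)) \<longrightarrow>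
          (\<integral>\<^sup>+ r\<in>{0<..<1}. ennreal (kernel_modulus kbar r / r) \<partial>lborel) < \<infinity>"
    and b: "b = Lim (at_right 0) (truncated_drift kbar)"
  shows "(truncated_drift kbar \<longlongrightarrow> b) (at_right 0)
       \<and> ((\<forall>z. K z = K (- z)) \<longrightarrow> b = 0)
       \<and> (\<forall>x p l. (\<exists>!c. \<exists>\<psi>. cell_solution a H b x p l c \<psi>)
            \<and> (\<forall>c \<psi> \<phi>. cell_solution a H b x p l c \<psi> \<and> cell_solution a H b x p l c \<phi>
                  \<longrightarrow> (\<exists>k. \<forall>y. \<psi> y = \<phi> y + k)))
       \<and> (\<exists>C>0. \<forall>x p l c \<psi>. cell_solution a H b x p l c \<psi> \<longrightarrow>
            esssup lborel (\<lambda>y. ereal \<bar>half_laplacian \<psi> y\<bar>)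
              \<le> ereal (C * (1 + \<bar>l\<bar> + norm p powr m) powr m))"
proof -
  let ?N = "CARD('n)"
  define \<kappa> where "\<kappa> = half_laplacian_const TYPE('n)"
  have \<kappa>: "0 < \<kappa>" using kbar_0 by (simp add: \<kappa>_def)
  obtain b' where b': "(truncated_drift kbar \<longlongrightarrow> b') (at_right 0)" "(\<forall>z. K z = K (- z)) \<longrightarrow> b' = 0"
    using truncated_drift_converges[OF K_measurable kbar kbar_bounded kbar_dini] by blast
  have "b = b'" unfolding b by (rule tendsto_Lim[OF trivial_limit_at_right_real b'(1)])
  with b' have drift: "(truncated_drift kbar \<longlongrightarrow> b) (at_right 0)" "(\<forall>z. K z = K (- z)) \<longrightarrow> b = 0" by auto
  obtain a0 where a0: "0 < a0" and a: "\<And>x y. a0 \<le> a x y" "\<And>x y. a x y \<le> inverse a0" using a_elliptic by blast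
  have a_pos: "0 < a x y" for x y using a(1)[of x y] a0 by linarith
  obtain h0 where h0': "\<And>x y. \<bar>H x y 0\<bar> \<le> h0" using H_0_bounded by (auto simp: bounded_iff)
  have h0: "0 \<le> h0" using h0'[of 0 0] by linarith
  obtain b0 C0 where bC: "0 < b0" "0 < C0"
    and coer: "\<And>\<mu> x y p. 0 < \<mu> \<Longrightarrow> \<mu> < 1 \<Longrightarrow> \<mu> * H x y (inverse \<mu> *\<^sub>R p) - H x y p \<ge> (1 - \<mu>) * (b0 * norm p powr m - C0)"
    using H_coercive by blast
  obtain L where L: "0 < L" and lip: "\<And>R x y x' y' p p'. 0 < R \<Longrightarrow> norm p \<le> R \<Longrightarrow> norm p' \<le> R \<Longrightarrow>
          \<bar>H x y p - H x' y' p'\<bar>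
            \<le> L * (1 + R powr m) * norm ((x, y) - (x', y')) + L * (1 + R powr (m - 1)) * norm (p - p')
          \<and> \<bar>a x y - a x' y'\<bar> \<le> L * norm ((x, y) - (x', y'))"
    using H_a_lipschitz by metis
  have nP: "norm ((x, y) - (x, y')) = norm (y - y')" for x y y' :: "real^'n" by simp
  define M where "M = 2 + L * 4 powr m / b0"
  define b1 where "b1 = a0 * b0 / 2 powr (m + 1)"
  define Hc where "Hc = h0 + L + 2 * L * 2 powr m"
  define C1 where "C1 = (C0 + L * (1 + (1 + M) powr (m - 1))) / a0 + 1 + b1 * M powr m"
  define C2 where "C2 = L / a0\<^sup>2 * Hc + L * (1 + 2 powr m) / a0"
  define C5 where "C5 = Hc / a0 + norm b + 1"
  define \<rho> where "\<rho> p l = 1 + norm p + \<bar>l\<bar> powr (1 / m)" for p :: "real^'n" and l :: real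
  define G where "G x p l y q = H x y (p + q) / a x y + b \<bullet> q - l" for x p y q :: "real^'n" and l :: real
  define w where "w x y = 1 / a x y" for x y :: "real^'n"
  have cell: "coercive_cell \<kappa> m b1 C1 C2 C5 a0 (L / a0\<^sup>2) (\<rho> p l) (G x p l) (w x)" for x p l
    unfolding b1_def C1_def C2_def C5_def Hc_def M_def \<rho>_def G_def [abs_def] w_def [abs_def]
  proof (rule coercive_cell_of_hamiltonian[OF \<kappa> m a0 L h0 bC])
    show "a0 \<le> a x y" "a x y \<le> 1 / a0" for y using a by (auto simp: inverse_eq_divide)
    show "\<bar>a x y - a x y'\<bar> \<le> L * norm (y - y')" for y y'
      using lip[of 1 0 0 x y x y'] unfolding nP by simp
    show "zn_periodic (a x)" using a_periodic by simp
    show "zn_periodic (\<lambda>y. H x y q)" for q using H_periodic by simp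
    show "\<bar>H x y 0\<bar> \<le> h0" for y by (rule h0')
    show "(1 - \<mu>) * (b0 * norm q powr m - C0) \<le> \<mu> * H x y ((1 / \<mu>) *\<^sub>R q) - H x y q" if "0 < \<mu>" "\<mu> < 1" for \<mu> y q
      using coer[OF that, of q x y] by (simp add: inverse_eq_divide)
    show "\<bar>H x y q - H x y' q'\<bar> \<le> L * (1 + R powr m) * norm (y - y') + L * (1 + R powr (m - 1)) * norm (q - q')"
      if "0 < R" "norm q \<le> R" "norm q' \<le> R" for R y y' q q'
      using lip[OF that, of x y x y'] unfolding nP by simp
  qed
  \<comment> \<open>One instance serves to read off the signs of the common constants, because the
    gradient constant \<open>Kg\<close> must be obtained before x, p and l are fixed.\<close>
  interpret c0: coercive_cell \<kappa> m b1 C1 C2 C5 a0 "L / a0\<^sup>2" "\<rho> 0 0" "G 0 0 0" "w 0" by (rule cell)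
  obtain Kg where Kg: "0 < Kg"
    and solv: "\<And>\<rho> (G::real^'n \<Rightarrow> real^'n \<Rightarrow> real) w. coercive_cell \<kappa> m b1 C1 C2 C5 a0 (L / a0\<^sup>2) \<rho> G w \<Longrightarrow>
     (\<exists>\<alpha> c \<psi>. 0 < \<alpha> \<and> \<alpha> < 1 \<and> C1_holder_torus \<alpha> \<psi> \<and>
        (\<forall>y. - (\<kappa> / 2) * jump_integral \<psi> y + G y (grad \<psi> y) = c * w y)) \<and>
     (\<forall>\<alpha> c \<psi>. 0 < \<alpha> \<longrightarrow> \<alpha> < 1 \<longrightarrow> C1_holder_torus \<alpha> \<psi> \<longrightarrow>
        (\<forall>y. - (\<kappa> / 2) * jump_integral \<psi> y + G y (grad \<psi> y) = c * w y) \<longrightarrow>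
        \<bar>c\<bar> \<le> C5 / a0 * \<rho> powr m \<and> (\<forall>y. norm (grad \<psi> y) \<le> Kg * \<rho>))"
    using coercive_cell_solvable[OF \<kappa> m c0.b1 c0.C1 c0.C2 c0.C5 a0 c0.Lw] by blast
  have sol_iff: "cell_solution a H b x p l c \<psi> \<longleftrightarrow> (\<exists>\<alpha>. 0 < \<alpha> \<and> \<alpha> < 1 \<and> C1_holder_torus \<alpha> \<psi> \<and>
      (\<forall>y. - (\<kappa> / 2) * jump_integral \<psi> y + G x p l y (grad \<psi> y) = c * w x y))" for x p l c \<psi>
    unfolding cell_solution_iff[of a x, OF a_pos] G_def w_def \<kappa>_def ..
  have w_pos: "0 < w x y" for x y using a_pos by (simp add: w_def)
  have le: "d \<le> c" if s1: "cell_solution a H b x p l c \<psi>" and s2: "cell_solution a H b x p l d \<phi>" for x p l c d \<psi> \<phi>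
  proof -
    obtain \<alpha> where \<psi>: "0 < \<alpha>" "\<alpha> < 1" "C1_holder_torus \<alpha> \<psi>"
      and e1: "\<And>y. - (\<kappa> / 2) * jump_integral \<psi> y + G x p l y (grad \<psi> y) = c * w x y"
      using iffD1[OF sol_iff s1] by blast
    obtain \<beta> where \<phi>: "0 < \<beta>" "\<beta> < 1" "C1_holder_torus \<beta> \<phi>"
      and e2: "\<And>y. - (\<kappa> / 2) * jump_integral \<phi> y + G x p l y (grad \<phi> y) = d * w x y"
      using iffD1[OF sol_iff s2] by blast
    show ?thesis by (rule cell_equation_unique(1)[OF \<psi>(3,1,2) \<phi>(3,1,2) \<kappa> w_pos e1 e2])
  qed
  have uniq: "\<exists>k. \<forall>y. \<psi> y = \<phi> y + k" if s1: "cell_solution a H b x p l c \<psi>" and s2: "cell_solution a H b x p l c \<phi>" for x p l c \<psi> \<phi>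
  proof -
    obtain \<alpha> where \<psi>: "0 < \<alpha>" "\<alpha> < 1" "C1_holder_torus \<alpha> \<psi>"
      and e1: "\<And>y. - (\<kappa> / 2) * jump_integral \<psi> y + G x p l y (grad \<psi> y) = c * w x y"
      using iffD1[OF sol_iff s1] by blast
    obtain \<beta> where \<phi>: "0 < \<beta>" "\<beta> < 1" "C1_holder_torus \<beta> \<phi>"
      and e2: "\<And>y. - (\<kappa> / 2) * jump_integral \<phi> y + G x p l y (grad \<phi> y) = c * w x y"
      using iffD1[OF sol_iff s2] by blast
    show ?thesis by (rule cell_equation_unique(2)[OF \<psi>(3,1,2) \<phi>(3,1,2) \<kappa> w_pos e1 e2 refl])
  qed
  have ex: "\<exists>!c. \<exists>\<psi>. cell_solution a H b x p l c \<psi>" for x p l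
  proof (rule ex_ex1I)
    show "\<exists>c \<psi>. cell_solution a H b x p l c \<psi>" using solv[OF cell[where p = p and l = l and x = x]] unfolding sol_iff by blast
    show "c = d" if "\<exists>\<psi>. cell_solution a H b x p l c \<psi>" "\<exists>\<psi>. cell_solution a H b x p l d \<psi>" for c d
      using that le by (meson antisym)
  qed
  \<comment> \<open>By the equation the half Laplacian is c w - G(y, D\<psi>), and both parts are
    multiples of \<rho>^m. The factor 3^m comes from the three summands of \<rho>; the added 1 makes
    C positive.\<close>
  define C where "C = (C5 / a0 * (1 / a0) + C5 * (1 + Kg powr m)) * (3 powr m) + 1"
  have C0: "0 \<le> C5 / a0 * (1 / a0) + C5 * (1 + Kg powr m)" using c0.C5 a0 by simp
  have C: "0 < C" unfolding C_def using C0 by (intro add_nonneg_pos mult_nonneg_nonneg) auto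
  have est: "esssup lborel (\<lambda>y. ereal \<bar>half_laplacian \<psi> y\<bar>) \<le> ereal (C * (1 + \<bar>l\<bar> + norm p powr m) powr m)"
    if sol: "cell_solution a H b x p l c \<psi>" for x p l c \<psi>
  proof -
    obtain \<alpha> where \<psi>: "0 < \<alpha>" "\<alpha> < 1" "C1_holder_torus \<alpha> \<psi>"
      and eq: "\<forall>y. - (\<kappa> / 2) * jump_integral \<psi> y + G x p l y (grad \<psi> y) = c * w x y"
      using sol unfolding sol_iff by blast
    interpret cc: coercive_cell \<kappa> m b1 C1 C2 C5 a0 "L / a0\<^sup>2" "\<rho> p l" "G x p l" "w x" by (rule cell)
    have bounds: "\<bar>c\<bar> \<le> C5 / a0 * \<rho> p l powr m" "\<And>y. norm (grad \<psi> y) \<le> Kg * \<rho> p l"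
      using solv[OF cell[where p = p and l = l and x = x]] \<psi> eq by blast+
    have hl: "half_laplacian \<psi> y = c * w x y - G x p l y (grad \<psi> y)" for y
    proof -
      have "half_laplacian \<psi> y = - (\<kappa> / 2) * jump_integral \<psi> y"
        unfolding \<kappa>_def by (rule half_laplacian_eq_jump_integral[OF \<psi>(3,1,2)])
      then show ?thesis using eq[rule_format, of y] by linarith
    qed
    \<comment> \<open>Measurability for the essential supremum is read off from the equation, which
      expresses the half Laplacian through continuous functions.\<close>
    have cg: "continuous_on UNIV (grad \<psi>)" by (rule C1_holder_torus_grad_continuous[OF \<psi>(3,1)])
    have ca: "continuous_on UNIV (a x)"
      using continuous_on_compose2[OF uniformly_continuous_imp_continuous[OF a_cont], of UNIV "\<lambda>y. (x, y)"]
      by (simp add: continuous_intros)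
    have cH: "continuous_on UNIV (\<lambda>y. H x y (p + grad \<psi> y))"
      using continuous_on_compose2[OF H_cont, of UNIV "\<lambda>y. (x, y, p + grad \<psi> y)"]
      by (simp add: continuous_intros cg)
    have "continuous_on UNIV (\<lambda>y. c * w x y - G x p l y (grad \<psi> y))"
    proof -
      have ne: "\<forall>y\<in>UNIV. a x y \<noteq> 0" 
      proof
        show "a x y \<noteq> 0" for y using a_pos[of x y] by simp
      qed
      have "continuous_on UNIV (\<lambda>y. 1 / a x y)" "continuous_on UNIV (\<lambda>y. H x y (p + grad \<psi> y) / a x y)"
        by (rule continuous_on_divide[OF continuous_on_const ca ne], rule continuous_on_divide[OF cH ca ne])
      then show ?thesis
        unfolding w_def G_def
        by (intro continuous_on_diff continuous_on_add continuous_on_mult continuous_on_const continuous_on_inner cg)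
    qed
    then have "continuous_on UNIV (half_laplacian \<psi>)" unfolding hl[abs_def, symmetric] .
    then have [measurable]: "half_laplacian \<psi> \<in> borel_measurable borel" by (rule borel_measurable_continuous_onI)
    have \<rho>le: "\<rho> p l powr m \<le> 3 powr m * (1 + \<bar>l\<bar> + norm p powr m) powr m"
    proof -
      let ?A = "norm p" and ?B = "\<bar>l\<bar> powr (1 / m)" and ?X = "1 + \<bar>l\<bar> + norm p powr m"
      have X1: "1 \<le> ?X" by simp
      have "?A \<le> ?X"
      proof (cases "?A \<le> 1")
        case False
        then have "?A \<le> ?A powr m" using powr_mono[of 1 m ?A] m by simp
        then show ?thesis by simp
      qed (use X1 in linarith)
      moreover have "?B \<le> ?X"
      proof (cases "\<bar>l\<bar> \<le> 1")
        case True
        then have "?B \<le> 1" using m by (intro powr_le1) auto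
        then show ?thesis using X1 by linarith
      next
        case False
        then have "?B \<le> \<bar>l\<bar> powr 1" using m by (intro powr_mono) auto
        then have "?B \<le> \<bar>l\<bar>" by simp
        moreover have "0 \<le> ?A powr m" by simp
        ultimately show ?thesis by linarith
      qed
      moreover have "1 + A + B \<le> 3 * X" if "A \<le> X" "B \<le> X" "1 \<le> X" for A B X :: real using that by linarith
      ultimately have "\<rho> p l \<le> 3 * ?X" using X1 unfolding \<rho>_def by blast
      then have "\<rho> p l powr m \<le> (3 * ?X) powr m" using m cc.\<rho> by (intro powr_mono2) auto
      then show ?thesis by (simp only: powr_mult)
    qed
    have "\<bar>half_laplacian \<psi> y\<bar> \<le> C * (1 + \<bar>l\<bar> + norm p powr m) powr m" for y
    proof -
      let ?r = "\<rho> p l powr m"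
      have "\<bar>c * w x y\<bar> \<le> (C5 / a0 * ?r) * (1 / a0)"
        unfolding abs_mult using bounds(1) cc.w_bounds(2)[of y] w_pos[of x y] by (intro mult_mono) auto
      moreover have "\<bar>G x p l y (grad \<psi> y)\<bar> \<le> C5 * (?r + Kg powr m * ?r)"
      proof -
        have "norm (grad \<psi> y) powr m \<le> (Kg * \<rho> p l) powr m" using bounds(2)[of y] m by (intro powr_mono2) auto
        then have "norm (grad \<psi> y) powr m \<le> Kg powr m * ?r" using Kg cc.\<rho> by (simp add: powr_mult)
        then have "C5 * (?r + norm (grad \<psi> y) powr m) \<le> C5 * (?r + Kg powr m * ?r)" using c0.C5 by (intro mult_left_mono) auto
        then show ?thesis using cc.G_growth[of y "grad \<psi> y"] by linarith
      qed
      ultimately have "\<bar>half_laplacian \<psi> y\<bar> \<le> (C5 / a0 * ?r) * (1 / a0) + C5 * (?r + Kg powr m * ?r)"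
        unfolding hl by linarith
      also have "\<dots> = (C5 / a0 * (1 / a0) + C5 * (1 + Kg powr m)) * ?r" by (simp add: algebra_simps)
      also have "\<dots> \<le> (C5 / a0 * (1 / a0) + C5 * (1 + Kg powr m)) * (3 powr m * (1 + \<bar>l\<bar> + norm p powr m) powr m)"
        using \<rho>le C0 by (rule mult_left_mono)
      also have "\<dots> \<le> C * (1 + \<bar>l\<bar> + norm p powr m) powr m"
        unfolding C_def by (simp add: mult.assoc distrib_right)
      finally show ?thesis .
    qed
    then show ?thesis by (intro esssup_I) auto
  qed
  have wellposed: "(\<exists>!c. \<exists>\<psi>. cell_solution a H b x p l c \<psi>)
      \<and> (\<forall>c \<psi> \<phi>. cell_solution a H b x p l c \<psi> \<and> cell_solution a H b x p l c \<phi> \<longrightarrow> (\<exists>k. \<forall>y. \<psi> y = \<phi> y + k))" for x p l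
    by (rule conjI[OF ex]) (use uniq in blast)
  have "\<exists>C>0. \<forall>x p l c \<psi>. cell_solution a H b x p l c \<psi> \<longrightarrow>
      esssup lborel (\<lambda>y. ereal \<bar>half_laplacian \<psi> y\<bar>) \<le> ereal (C * (1 + \<bar>l\<bar> + norm p powr m) powr m)"
    using C est by blast
  then show ?thesis
    by (rule conjI[OF drift(1) conjI[OF drift(2) conjI[OF allI[OF allI[OF allI[OF wellposed]]]]]])
qed

end
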